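(* There is $\varepsilon_7^*>0$ such that for every $\varepsilon<\min\{\varepsilon_2^*,\varepsilon_7^*\}$ and all sufficiently large $N$, the following holds, where $h^*_{\varepsilon,N}\in B_K$ denotes a fixed point of $\tilde{\mathcal L}_{\varepsilon,N}$. There is a $W^{1,1}$-neighbourhood $B'_{K,N}\subset B_K$ of $h^*_{\varepsilon,N}$ (relative to $F_N\cap\mathcal D_1$) such that for all $h^0_{\varepsilon,N}\in B'_{K,N}$ the Newton iteration $$h_{\varepsilon,N}^{n+1}:=h_{\varepsilon,N}^{n}-\left(I-D_{h_{\varepsilon,N}^{n}}\tilde{\mathcal L}_{\varepsilon,N}\right)^{-1}\left(h_{\varepsilon,N}^{n}-\tilde{\mathcal L}_{\varepsilon,N}(h_{\varepsilon,N}^{n})\right),\qquad n=0,1,2,\ldots$$ has order-2 convergence toward $h^*_{\varepsilon,N}$; that is, there are $C>0$ and $0<\tilde\gamma<1$ such that for all $n\ge 0$ $$\|h^n_{\varepsilon,N}-h^*_{\varepsilon,N}\|_{W^{1,1}}\le C\tilde\gamma^{2^n}.$$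
   Context: Function spaces. $\mathbb S^1$ is the circle. $W^{i,1}=W^{i,1}(\mathbb S^1)$ is the Sobolev space (of real functions) with norm $\|f\|_{W^{i,1}}=\|f\|_{L^1}+\sum_{j=1}^i\|f^{(j)}\|_{L^1}$, and $W^{0,1}:=L^1$. $\mathcal D_1=\{f\in L^1: f\ge0,\ \int_{\mathbb S^1}f=1\}$. Dynamics. $T:\mathbb S^1\to\mathbb S^1$ is a $C^5$ uniformly expanding map and $g:\mathbb S^1\times\mathbb S^1\to\mathbb R$ is $C^5$. For $\varepsilon\ge 0$ and $f\in\mathcal D_1$ put $I_{\varepsilon,f}(x)=x+\varepsilon\int g(x,y)f(y)\,dy$ (mod 1) and $T_{\varepsilon,f}=I_{\varepsilon,f}\circ T$. For a map $S$, $\mathcal L_S:L^1\to L^1$ is its transfer operator: $\int\varphi\circ S\cdot\psi\,dx=\int\varphi\cdot\mathcal L_S\psi\,dx$ for $\psi\in L^1$, $\varphi\in L^\infty$. The (nonlinear) self-consistent transfer operator is $\tilde{\mathcal L}_\varepsilon(h)=\mathcal L_{T_{\varepsilon,h}}h$ (defined on probability densities, and by the same formula near them). Standing constants. Fix a small $\varepsilon_0^*>0$, $\lambda\in(0,1)$ and $C_0>0$ such that all the maps $T_{\varepsilon,f}$ with $\varepsilon\in[0,\varepsilon_0^*]$, $f\in\mathcal D_1$ satisfy $\sup_x 1/|T_{\varepsilon,f}'(x)|\le\lambda$ and $\|T_{\varepsilon,f}\|_{C^5}<C_0$ (all values of $\varepsilon$ considered lie in $[0,\varepsilon_0^*]$).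 There is then a constant $C_{LY}>0$, fixed throughout, with $\|\mathcal L_{T_{\varepsilon,f_n}\circ\cdots\circ T_{\varepsilon,f_1}}h\|_{W^{i,1}}\le\lambda^{in}\|h\|_{W^{i,1}}+C_{LY}\|h\|_{W^{i-1,1}}$ for all such maps, $h\in W^{i,1}$, $i=1,2,3,4$, $n\in\mathbb N$. Fix $K\ge C_{LY}/(1-\lambda^2)$ and let $B_K=\{h\in\mathcal D_1\cap W^{2,1}:\|h\|_{W^{2,1}}\le K\}$. The constant $\varepsilon_2^*$. By known results there is $\varepsilon_1^*\in(0,\varepsilon_0^*]$, $C>0$, $\theta\in(0,1)$ with $\|\mathcal L_{T_{\varepsilon,f_n}}\cdots\mathcal L_{T_{\varepsilon,f_1}}h\|_{W^{i,1}}\le C\theta^n\|h\|_{W^{i,1}}$ for all $\varepsilon\in[0,\varepsilon_1^*]$, $i=1,2$, $h\in W^{i,1}$ with $\int h=0$, and all sequences $(f_j)$ in $B_K$; and there is $\varepsilon_2^*\in(0,\varepsilon_1^*]$ such that for all $\varepsilon\in[0,\varepsilon_2^*]$, $\tilde{\mathcal L}_\varepsilon$ has a unique fixed point $h_\varepsilon^*\in B_K$, and there are $C_K>0$, $\gamma\in(0,1)$ with $\|\tilde{\mathcal L}_\varepsilon^n(h^0)-h_\varepsilon^*\|_{W^{1,1}}\le C_K\gamma^n$ for all $\varepsilon\in[0,\varepsilon_2^*]$, $h^0\in B_K$. Discretisation. With $e_k(x)=e^{2\pi ikx}$, the Fejér kernel is $K_N=\sum_{|k|\le N-1}(1-|k|/N)e_k$,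 $\Pi_Nf(x)=\int_{\mathbb S^1}K_N(x-y)f(y)\,dy$, $F_N=\mathrm{span}\{e_k:k=-N+1,\ldots,N\}$ (real-valued elements being meant when they are arguments of the nonlinear operator), and $\tilde{\mathcal L}_{\varepsilon,N}:=\Pi_N\tilde{\mathcal L}_\varepsilon$. For every $\varepsilon\in[0,\varepsilon_0^*]$ and $N$, $\tilde{\mathcal L}_{\varepsilon,N}$ has a fixed point $h^*_{\varepsilon,N}\in B_K$. $D_f\tilde{\mathcal L}_{\varepsilon,N}$ denotes the Fréchet derivative at $f$ of $\tilde{\mathcal L}_{\varepsilon,N}$ as a map of $F_N$ with the $W^{1,1}$ norm, and the inverse $(I-D_f\tilde{\mathcal L}_{\varepsilon,N})^{-1}$ is taken on the subspace $\{e\in F_N:\int e=0\}$. *)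

theory Defs
  imports "HOL-Analysis.Analysis"
begin

text \<open>
  The circle is R/Z with its normalised Lebesgue measure. A function on the circle is a 1-periodic
  function on the line. Elements of L1 and of the Sobolev spaces are given by representatives;
  all notions below depend only on the almost-everywhere class of their arguments.
\<close>

definition periodic1 :: "(real \<Rightarrow> 'a) \<Rightarrow> bool" where
  "periodic1 f \<longleftrightarrow> (\<forall>x. f (x + 1) = f x)"

definition circ :: "real measure" where
  "circ = restrict_space lborel {0..<1}"

definition L1 :: "(real \<Rightarrow> real) \<Rightarrow> bool" where
  "L1 f \<longleftrightarrow> periodic1 f \<and> integrable circ f"

definition L1_norm :: "(real \<Rightarrow> real) \<Rightarrow> real" where
  "L1_norm f = (\<integral>x. \<bar>f x\<bar> \<partial>circ)"

definition Linf :: "(real \<Rightarrow> real) \<Rightarrow> bool" where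
  "Linf \<phi> \<longleftrightarrow> periodic1 \<phi> \<and> \<phi> \<in> borel_measurable borel \<and> (\<exists>M. AE x in circ. \<bar>\<phi> x\<bar> \<le> M)"

definition C_k :: "nat \<Rightarrow> (real \<Rightarrow> real) \<Rightarrow> bool" where
  "C_k k f \<longleftrightarrow> (\<forall>j<k. \<forall>x. (deriv ^^ j) f differentiable (at x))
             \<and> continuous_on UNIV ((deriv ^^ k) f)"

text \<open>A function of two variables is of class C^(k+1) iff both first partial derivatives exist
  everywhere and are of class C^k.\<close>

primrec C_k2 :: "nat \<Rightarrow> (real \<Rightarrow> real \<Rightarrow> real) \<Rightarrow> bool" where
  "C_k2 0 g \<longleftrightarrow> continuous_on UNIV (\<lambda>(x, y). g x y)"
| "C_k2 (Suc k) g \<longleftrightarrow> (\<exists>gx gy.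
     (\<forall>x y. ((\<lambda>t. g t y) has_real_derivative gx x y) (at x)
          \<and> ((\<lambda>t. g x t) has_real_derivative gy x y) (at y))
     \<and> C_k2 k gx \<and> C_k2 k gy)"

definition test_function :: "(real \<Rightarrow> real) \<Rightarrow> bool" where
  "test_function \<phi> \<longleftrightarrow> periodic1 \<phi> \<and> (\<forall>k. C_k k \<phi>)"

definition has_weak_deriv :: "nat \<Rightarrow> (real \<Rightarrow> real) \<Rightarrow> (real \<Rightarrow> real) \<Rightarrow> bool" where
  "has_weak_deriv j f u \<longleftrightarrow> L1 u \<and>
     (\<forall>\<phi>. test_function \<phi> \<longrightarrow>
        (\<integral>x. f x * (deriv ^^ j) \<phi> x \<partial>circ) = (-1) ^ j * (\<integral>x. u x * \<phi> x \<partial>circ))"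

definition weak_deriv :: "nat \<Rightarrow> (real \<Rightarrow> real) \<Rightarrow> real \<Rightarrow> real" where
  "weak_deriv j f = (SOME u. has_weak_deriv j f u)"

text \<open>Membership in W^(i,1), and its norm (meaningful for members only).\<close>

definition sobolev :: "nat \<Rightarrow> (real \<Rightarrow> real) \<Rightarrow> bool" where
  "sobolev i f \<longleftrightarrow> L1 f \<and> (\<forall>j\<in>{1..i}. \<exists>u. has_weak_deriv j f u)"

definition sobolev_norm :: "nat \<Rightarrow> (real \<Rightarrow> real) \<Rightarrow> real" where
  "sobolev_norm i f = L1_norm f + (\<Sum>j=1..i. L1_norm (weak_deriv j f))"

definition D1 :: "(real \<Rightarrow> real) set" where
  "D1 = {f. L1 f \<and> (AE x in circ. 0 \<le> f x) \<and> (\<integral>x. f x \<partial>circ) = 1}"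

definition B_ball :: "real \<Rightarrow> (real \<Rightarrow> real) set" where
  "B_ball K = {h \<in> D1. sobolev 2 h \<and> sobolev_norm 2 h \<le> K}"

text \<open>Maps of the circle are given by lifts to the line.\<close>

definition circle_lift :: "(real \<Rightarrow> real) \<Rightarrow> bool" where
  "circle_lift S \<longleftrightarrow> (\<exists>d::int. \<forall>x. S (x + 1) = S x + of_int d)"

definition uniformly_expanding :: "(real \<Rightarrow> real) \<Rightarrow> bool" where
  "uniformly_expanding S \<longleftrightarrow> (\<exists>\<sigma>>1. \<forall>x. \<sigma> \<le> \<bar>deriv S x\<bar>)"

text \<open>The C^5 norm of a circle map. The order-zero term is left out: a lift is only determined up
  to integers, and modulo 1 that term would be at most 1.\<close>

definition C5_norm :: "(real \<Rightarrow> real) \<Rightarrow> real" where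
  "C5_norm S = (\<Sum>j=1..5. SUP x. \<bar>(deriv ^^ j) S x\<bar>)"

text \<open>The transfer operator, by duality; this determines its value up to a null set.\<close>

definition is_transfer :: "(real \<Rightarrow> real) \<Rightarrow> (real \<Rightarrow> real) \<Rightarrow> (real \<Rightarrow> real) \<Rightarrow> bool" where
  "is_transfer S \<psi> \<rho> \<longleftrightarrow> L1 \<rho> \<and>
     (\<forall>\<phi>. Linf \<phi> \<longrightarrow> (\<integral>x. \<phi> (S x) * \<psi> x \<partial>circ) = (\<integral>x. \<phi> x * \<rho> x \<partial>circ))"

definition transfer_op :: "(real \<Rightarrow> real) \<Rightarrow> (real \<Rightarrow> real) \<Rightarrow> real \<Rightarrow> real" where
  "transfer_op S \<psi> = (SOME \<rho>. is_transfer S \<psi> \<rho>)"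

definition I_map :: "(real \<Rightarrow> real \<Rightarrow> real) \<Rightarrow> real \<Rightarrow> (real \<Rightarrow> real) \<Rightarrow> real \<Rightarrow> real" where
  "I_map g \<epsilon> f x = x + \<epsilon> * (\<integral>y. g x y * f y \<partial>circ)"

definition T_map :: "(real \<Rightarrow> real) \<Rightarrow> (real \<Rightarrow> real \<Rightarrow> real) \<Rightarrow> real \<Rightarrow> (real \<Rightarrow> real) \<Rightarrow> real \<Rightarrow> real" where
  "T_map T g \<epsilon> f = I_map g \<epsilon> f \<circ> T"

text \<open>\<open>T_comp T g \<epsilon> f n\<close> is the composition of the maps for \<open>f n, \<dots>, f 1\<close> (\<open>f 1\<close> acting first);
  \<open>L_comp\<close> is the corresponding composition of transfer operators.\<close>

primrec T_comp :: "(real \<Rightarrow> real) \<Rightarrow> (real \<Rightarrow> real \<Rightarrow> real) \<Rightarrow> real \<Rightarrow> (nat \<Rightarrow> real \<Rightarrow> real) \<Rightarrow> nat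
    \<Rightarrow> real \<Rightarrow> real" where
  "T_comp T g \<epsilon> f 0 = id"
| "T_comp T g \<epsilon> f (Suc n) = T_map T g \<epsilon> (f (Suc n)) \<circ> T_comp T g \<epsilon> f n"

primrec L_comp :: "(real \<Rightarrow> real) \<Rightarrow> (real \<Rightarrow> real \<Rightarrow> real) \<Rightarrow> real \<Rightarrow> (nat \<Rightarrow> real \<Rightarrow> real) \<Rightarrow> nat
    \<Rightarrow> (real \<Rightarrow> real) \<Rightarrow> real \<Rightarrow> real" where
  "L_comp T g \<epsilon> f 0 h = h"
| "L_comp T g \<epsilon> f (Suc n) h = transfer_op (T_map T g \<epsilon> (f (Suc n))) (L_comp T g \<epsilon> f n h)"

definition self_consistent ::
    "(real \<Rightarrow> real) \<Rightarrow> (real \<Rightarrow> real \<Rightarrow> real) \<Rightarrow> real \<Rightarrow> (real \<Rightarrow> real) \<Rightarrow> real \<Rightarrow> real" where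
  "self_consistent T g \<epsilon> h = transfer_op (T_map T g \<epsilon> h) h"

definition e_fun :: "int \<Rightarrow> real \<Rightarrow> complex" where
  "e_fun k x = exp (2 * of_real pi * \<i> * of_int k * of_real x)"

text \<open>The sum is real, its terms for \<open>k\<close> and \<open>-k\<close> being conjugate.\<close>

definition fejer :: "nat \<Rightarrow> real \<Rightarrow> real" where
  "fejer N x = Re (\<Sum>k\<in>{- int N + 1..int N - 1}. of_real (1 - \<bar>of_int k\<bar> / of_nat N) * e_fun k x)"

definition Pi_N :: "nat \<Rightarrow> (real \<Rightarrow> real) \<Rightarrow> real \<Rightarrow> real" where
  "Pi_N N f x = (\<integral>y. fejer N (x - y) * f y \<partial>circ)"

definition self_consistent_N ::
    "(real \<Rightarrow> real) \<Rightarrow> (real \<Rightarrow> real \<Rightarrow> real) \<Rightarrow> real \<Rightarrow> nat \<Rightarrow> (real \<Rightarrow> real) \<Rightarrow> real \<Rightarrow> real" where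
  "self_consistent_N T g \<epsilon> N h = Pi_N N (self_consistent T g \<epsilon> h)"

text \<open>The real-valued elements of the complex span of the \<open>e_fun k\<close>, \<open>k = -N+1, \<dots>, N\<close>.\<close>

definition F_space :: "nat \<Rightarrow> (real \<Rightarrow> real) set" where
  "F_space N = {f. \<exists>c :: int \<Rightarrow> complex.
     \<forall>x. of_real (f x) = (\<Sum>k\<in>{- int N + 1..int N}. c k * e_fun k x)}"

definition F0_space :: "nat \<Rightarrow> (real \<Rightarrow> real) set" where
  "F0_space N = {e \<in> F_space N. (\<integral>x. e x \<partial>circ) = 0}"

text \<open>\<open>D\<close> is the Frechet derivative at \<open>f\<close> of \<open>\<Phi>\<close>, seen as a map from \<open>F_space N\<close> to itself with the
  W^(1,1) norm. Its values outside \<open>F_space N\<close> are irrelevant; on \<open>F_space N\<close> it is unique.\<close>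

definition has_frechet_F ::
    "nat \<Rightarrow> ((real \<Rightarrow> real) \<Rightarrow> real \<Rightarrow> real) \<Rightarrow> (real \<Rightarrow> real) \<Rightarrow> ((real \<Rightarrow> real) \<Rightarrow> real \<Rightarrow> real) \<Rightarrow> bool" where
  "has_frechet_F N \<Phi> f D \<longleftrightarrow>
     f \<in> F_space N \<and>
     (\<forall>u\<in>F_space N. D u \<in> F_space N) \<and>
     (\<forall>u\<in>F_space N. \<forall>v\<in>F_space N. D (\<lambda>x. u x + v x) = (\<lambda>x. D u x + D v x)) \<and>
     (\<forall>a. \<forall>u\<in>F_space N. D (\<lambda>x. a * u x) = (\<lambda>x. a * D u x)) \<and>
     (\<exists>B. \<forall>u\<in>F_space N. sobolev_norm 1 (D u) \<le> B * sobolev_norm 1 u) \<and>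
     (\<forall>\<eta>>0. \<exists>\<delta>>0. \<forall>u\<in>F_space N. sobolev_norm 1 u < \<delta> \<longrightarrow>
        sobolev_norm 1 (\<lambda>x. \<Phi> (\<lambda>y. f y + u y) x - \<Phi> f x - D u x) \<le> \<eta> * sobolev_norm 1 u)"

definition frechet_F ::
    "nat \<Rightarrow> ((real \<Rightarrow> real) \<Rightarrow> real \<Rightarrow> real) \<Rightarrow> (real \<Rightarrow> real) \<Rightarrow> (real \<Rightarrow> real) \<Rightarrow> real \<Rightarrow> real" where
  "frechet_F N \<Phi> f = (SOME D. has_frechet_F N \<Phi> f D)"

definition I_minus_D ::
    "nat \<Rightarrow> ((real \<Rightarrow> real) \<Rightarrow> real \<Rightarrow> real) \<Rightarrow> (real \<Rightarrow> real) \<Rightarrow> (real \<Rightarrow> real) \<Rightarrow> real \<Rightarrow> real" where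
  "I_minus_D N \<Phi> f e = (\<lambda>x. e x - frechet_F N \<Phi> f e x)"

text \<open>One Newton step for the equation \<open>h = \<Phi> h\<close>. It is meaningful at \<open>h\<close> if \<open>newton_ok\<close> holds.\<close>

definition newton_step :: "nat \<Rightarrow> ((real \<Rightarrow> real) \<Rightarrow> real \<Rightarrow> real) \<Rightarrow> (real \<Rightarrow> real) \<Rightarrow> real \<Rightarrow> real" where
  "newton_step N \<Phi> h =
     (\<lambda>x. h x - inv_into (F0_space N) (I_minus_D N \<Phi> h) (\<lambda>y. h y - \<Phi> h y) x)"

definition newton_ok :: "nat \<Rightarrow> ((real \<Rightarrow> real) \<Rightarrow> real \<Rightarrow> real) \<Rightarrow> (real \<Rightarrow> real) \<Rightarrow> bool" where
  "newton_ok N \<Phi> h \<longleftrightarrow>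
     (\<exists>D. has_frechet_F N \<Phi> h D) \<and>
     bij_betw (I_minus_D N \<Phi> h) (F0_space N) (F0_space N) \<and>
     (\<lambda>y. h y - \<Phi> h y) \<in> F0_space N"

end

theory Submission
  imports Defs "HOL-Library.Function_Algebras"
begin

text \<open>
  Why Newton's method works. Duality turns the discretised operator into an integral operator,
  \<open>Phi N h x = (\<integral>z. fejer N (x - S h z) * h z)\<close> with \<open>S h = T_map T g \<epsilon> h\<close>. The kernel is a trigonometric
  polynomial and \<open>S h\<close> is affine in \<open>h\<close>, so \<open>Phi N\<close> is smooth on the finite-dimensional space
  \<open>F_space N\<close>, with explicit derivative \<open>D = dPhi N h\<close> and quadratic remainder (\<open>dPhi_bounds\<close>). Quadratic
  convergence of Newton's method near a fixed point \<open>h\<close> therefore reduces to the invertibility of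
  \<open>I - D\<close> at \<open>h\<close> on functions of mean zero, and in finite dimension a lower bound is enough
  (\<open>inj_endomorphism_surj\<close>).

  The lower bound is where the dynamics enters (\<open>lower_bound\<close>). Let \<open>P\<close> be the transfer operator of \<open>S h\<close>.
  Then \<open>D e = Pi_N N (P e) - \<epsilon> * Pi_N N (weak_deriv 1 (P w))\<close>, where \<open>w\<close> is \<open>h\<close> times the displacement
  caused by \<open>e\<close> (\<open>dPhi_eq\<close>). The second term is small with \<open>\<epsilon>\<close>, uniformly in \<open>N\<close>, because \<open>h\<close> is bounded in
  \<open>W\<^sup>3\<^sup>,\<^sup>1\<close> by the Lasota-Yorke inequality. In the first term averaging is close to the identity from
  \<open>W\<^sup>2\<^sup>,\<^sup>1\<close> to \<open>W\<^sup>1\<^sup>,\<^sup>1\<close>, at rate \<open>1 / sqrt N\<close> (\<open>sobolev_norm_Pi_N_minus\<close>). The Lasota-Yorke inequality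
  shows that a function \<open>e\<close> with \<open>e - D e = r\<close> is bounded in \<open>W\<^sup>2\<^sup>,\<^sup>1\<close> by its \<open>W\<^sup>1\<^sup>,\<^sup>1\<close> norm and \<open>r\<close>. So
  \<open>e - P e\<close> equals \<open>r\<close> up to a small multiple of \<open>e\<close>, and the exponential decay of \<open>P\<close> on functions of mean
  zero inverts \<open>I - P\<close> (\<open>sobolev_norm_le_resolvent\<close>).

  The neighbourhood must also lie in the ball of radius \<open>K\<close>. The iterates of the constant density under
  \<open>P\<close> have \<open>W\<^sup>2\<^sup>,\<^sup>1\<close> norm at most \<open>C_LY\<close> in the limit, and \<open>C_LY < K\<close>. The fixed point of the discretised
  operator differs from that limit by an error that vanishes as \<open>N\<close> grows, so for large \<open>N\<close> it lies in
  the interior of the ball (\<open>h_norm2_interior\<close>).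

  What has to be built first is the analysis on the circle: averages against the Fejer kernel and their
  convergence in \<open>L\<^sup>1\<close>, which also yields the uniqueness of weak derivatives, and the existence of
  transfer operators by the Radon-Nikodym theorem.
\<close>

section \<open>The circle\<close>

lemma space_circ [simp]: "space circ = {0..<1}"
  by (simp add: circ_def space_restrict_space)

lemma ident_circ_borel [measurable]: "(\<lambda>x. x) \<in> circ \<rightarrow>\<^sub>M borel"
  unfolding circ_def by (rule measurable_restrict_space1) simp

lemma borel_measurable_circ [intro]:
  "f \<in> borel \<rightarrow>\<^sub>M M \<Longrightarrow> f \<in> circ \<rightarrow>\<^sub>M M"
  by (rule measurable_compose[OF ident_circ_borel])

lemma emeasure_circ: "emeasure circ {0..<1} = 1"
  by (simp add: circ_def emeasure_restrict_space)

interpretation circ: finite_measure circ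
  by standard (simp add: emeasure_circ)

interpretation circ2: pair_sigma_finite circ circ ..

lemma measure_circ [simp]: "measure circ {0..<1} = 1"
  by (simp add: measure_def emeasure_circ)

lemma integral_circ: "(\<integral>x. f x \<partial>circ) = (\<integral>x. indicator {0..<1} x *\<^sub>R f x \<partial>lborel)"
  for f :: "real \<Rightarrow> 'a :: {banach, second_countable_topology}"
  unfolding circ_def by (simp add: integral_restrict_space)

lemma integrable_circ:
  "integrable circ f \<longleftrightarrow> integrable lborel (\<lambda>x. indicator {0..<1} x *\<^sub>R f x)"
  for f :: "real \<Rightarrow> 'a :: {banach, second_countable_topology}"
  unfolding circ_def by (simp add: integrable_restrict_space)

lemma integrable_circ_bounded:
  fixes f :: "real \<Rightarrow> 'a :: {banach, second_countable_topology}"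
  assumes [measurable]: "f \<in> borel_measurable borel"
    and "\<And>x. 0 \<le> x \<Longrightarrow> x < 1 \<Longrightarrow> norm (f x) \<le> B"
  shows "integrable circ f"
  by (rule circ.integrable_const_bound[where B = B]) (use assms in \<open>auto intro!: AE_I2\<close>)

lemma continuous_bounded_Icc:
  fixes f :: "real \<Rightarrow> 'a :: real_normed_vector"
  assumes "continuous_on UNIV f"
  obtains B where "B \<ge> 0" "\<And>x. a \<le> x \<Longrightarrow> x \<le> b \<Longrightarrow> norm (f x) \<le> B"
proof -
  have "compact (f ` {a..b})"
    by (intro compact_continuous_image continuous_on_subset[OF assms]) auto
  then obtain B where "\<forall>y\<in>f ` {a..b}. norm y \<le> B"
    using compact_imp_bounded bounded_iff by metis
  then show ?thesis
    by (intro that[of "\<bar>B\<bar>"]) (auto intro: order_trans[OF _ abs_ge_self])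
qed

lemma integrable_circ_continuous:
  fixes f :: "real \<Rightarrow> 'a :: {banach, second_countable_topology}"
  assumes "continuous_on UNIV f"
  shows "integrable circ f"
proof -
  obtain B where "\<And>x. 0 \<le> x \<Longrightarrow> x \<le> 1 \<Longrightarrow> norm (f x) \<le> B"
    using continuous_bounded_Icc[OF assms] by metis
  then show ?thesis
    by (intro integrable_circ_bounded[where B = B])
       (auto intro: borel_measurable_continuous_onI[OF assms])
qed

lemma integral_circ_FTC:
  fixes F :: "real \<Rightarrow> 'a :: euclidean_space"
  assumes "\<And>x. (F has_vector_derivative f x) (at x)" "continuous_on UNIV f"
  shows "(\<integral>x. f x \<partial>circ) = F 1 - F 0"
proof -
  have [measurable]: "f \<in> borel_measurable borel"
    by (rule borel_measurable_continuous_onI[OF assms(2)])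
  have "(\<integral>x. f x \<partial>circ) = (\<integral>x. indicator {0..1} x *\<^sub>R f x \<partial>lborel)"
    unfolding integral_circ using AE_lborel_singleton[of "1::real"]
    by (intro integral_cong_AE) (auto simp: indicator_def)
  also have "\<dots> = F 1 - F 0"
    by (rule integral_FTC_Icc)
       (auto intro: has_vector_derivative_at_within assms continuous_on_subset[OF assms(2)])
  finally show ?thesis .
qed

lemma integral_circ_FTC_real:
  assumes "\<And>x. (F has_real_derivative f x) (at x)" "continuous_on UNIV f"
  shows "(\<integral>x. f x \<partial>circ) = F 1 - F 0"
  by (rule integral_circ_FTC)
     (use assms in \<open>auto simp: has_real_derivative_iff_has_vector_derivative\<close>)

lemma integral_circ_abs_triangle:
  fixes f :: "real \<Rightarrow> real"
  shows "\<bar>\<integral>x. f x \<partial>circ\<bar> \<le> (\<integral>x. \<bar>f x\<bar> \<partial>circ)"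
  using integral_norm_bound[of circ f] by simp

lemma integral_circ_le_const:
  fixes f :: "real \<Rightarrow> real"
  assumes "integrable circ f" "\<And>x. f x \<le> c"
  shows "(\<integral>x. f x \<partial>circ) \<le> c"
proof -
  have "(\<integral>x. f x \<partial>circ) \<le> (\<integral>x. c \<partial>circ)"
    using assms by (intro integral_mono) auto
  then show ?thesis by simp
qed

subsection \<open>Periodic functions\<close>

lemma periodic1_int: "periodic1 f \<Longrightarrow> f (x + of_int n) = f x"
proof (induction n rule: int_induct[where k = 0])
  case (step1 i)
  have "f (x + of_int (i + 1)) = f ((x + of_int i) + 1)" by (simp add: algebra_simps)
  also have "\<dots> = f (x + of_int i)" using step1.prems by (simp add: periodic1_def)
  also have "\<dots> = f x" using step1 by simp
  finally show ?case .
next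
  case (step2 i)
  have "f (x + of_int (i - 1)) = f ((x + of_int (i - 1)) + 1)"
    using step2.prems unfolding periodic1_def by metis
  also have "\<dots> = f (x + of_int i)" by (simp add: algebra_simps)
  also have "\<dots> = f x" using step2 by simp
  finally show ?case .
qed simp

lemma periodic1_frac: "periodic1 f \<Longrightarrow> f (frac x) = f x"
  using periodic1_int[of f "frac x" "\<lfloor>x\<rfloor>"] by (simp add: frac_def)

lemma periodic1_minus1: "periodic1 f \<Longrightarrow> f (x - 1) = f x"
  using periodic1_int[of f x "-1"] by simp

lemma periodic1_bounded:
  fixes f :: "real \<Rightarrow> 'a :: real_normed_vector"
  assumes "periodic1 f" "continuous_on UNIV f"
  obtains B where "B \<ge> 0" "\<And>x. norm (f x) \<le> B"
proof -
  obtain B where B: "B \<ge> 0" "\<And>x. 0 \<le> x \<Longrightarrow> x \<le> 1 \<Longrightarrow> norm (f x) \<le> B"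
    using continuous_bounded_Icc[OF assms(2)] by metis
  show ?thesis
  proof (rule that[OF B(1)])
    fix x
    show "norm (f x) \<le> B"
      using B(2)[of "frac x"] frac_lt_1[of x] by (simp add: periodic1_frac[OF assms(1)])
  qed
qed

lemma frac_measurable: "frac \<in> borel \<rightarrow>\<^sub>M circ"
proof -
  have "frac = (\<lambda>x::real. x - of_int \<lfloor>x\<rfloor>)" by (simp add: frac_def fun_eq_iff)
  moreover have "(\<lambda>x::real. x - real_of_int \<lfloor>x\<rfloor>) \<in> borel_measurable borel"
    by (intro borel_measurable_diff borel_measurable_real_floor) auto
  ultimately have "frac \<in> borel_measurable (borel :: real measure)" by metis
  then show ?thesis
    unfolding circ_def by (intro measurable_restrict_space2) (auto simp: frac_lt_1)
qed

lemma periodic1_measurable: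
  assumes "periodic1 f" "f \<in> borel_measurable circ"
  shows "f \<in> borel_measurable borel"
proof -
  have "(\<lambda>x. f (frac x)) \<in> borel_measurable borel"
    by (rule measurable_compose[OF frac_measurable assms(2)])
  then show ?thesis using periodic1_frac[OF assms(1)] by simp
qed

text \<open>Translation by the fractional part \<open>s\<close> of \<open>t\<close> moves the unit interval to \<open>[s, 1 + s)\<close>; the piece
  beyond 1 is moved back by periodicity.\<close>

lemma
  fixes f :: "real \<Rightarrow> 'a :: {banach, second_countable_topology}"
  assumes per: "periodic1 f" and int: "integrable circ f"
  shows integrable_circ_translate: "integrable circ (\<lambda>x. f (x + t))"
    and integral_circ_translate: "(\<integral>x. f (x + t) \<partial>circ) = (\<integral>x. f x \<partial>circ)"
proof -
  define s where "s = frac t"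
  have s: "0 \<le> s" "s < 1" by (auto simp: s_def frac_lt_1)
  have fs: "f (x + t) = f (s + x)" for x
    using periodic1_int[OF per, of "x + s" "\<lfloor>t\<rfloor>"] by (simp add: s_def frac_def algebra_simps)
  have i0: "integrable lborel (\<lambda>x. indicator {0..<1} x *\<^sub>R f x)"
    using int by (simp add: integrable_circ)
  have sub: "integrable lborel (\<lambda>x. indicator {a..<b} x *\<^sub>R f x)" if "0 \<le> a" "b \<le> 1" for a b
  proof -
    have "integrable lborel (\<lambda>x. indicator {a..<b} x *\<^sub>R (indicator {0..<1} x *\<^sub>R f x))"
      by (rule integrable_mult_indicator[OF _ i0]) simp
    also have "(\<lambda>x. indicator {a..<b} x *\<^sub>R (indicator {0..<1} x *\<^sub>R f x))
        = (\<lambda>x. indicator {a..<b} x *\<^sub>R f x)"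
      using that by (auto simp: indicator_def fun_eq_iff)
    finally show ?thesis .
  qed
  have i1: "integrable lborel (\<lambda>x. indicator {s..<1} x *\<^sub>R f x)" using sub s by simp
  have i2: "integrable lborel (\<lambda>x. indicator {0..<s} x *\<^sub>R f x)" using sub s by simp
  have sh: "(\<lambda>x. indicator {1..<1+s} (1 + 1 * x) *\<^sub>R f (1 + 1 * x))
      = (\<lambda>x. indicator {0..<s} x *\<^sub>R f x)"
    using per by (auto simp: indicator_def fun_eq_iff periodic1_def add.commute)
  have i3: "integrable lborel (\<lambda>x. indicator {1..<1+s} x *\<^sub>R f x)"
    using lborel_integrable_real_affine_iff[of 1 "\<lambda>x. indicator {1..<1+s} x *\<^sub>R f x" 1] i2 sh by simp
  have e3: "(\<integral>x. indicator {1..<1+s} x *\<^sub>R f x \<partial>lborel) = (\<integral>x. indicator {0..<s} x *\<^sub>R f x \<partial>lborel)"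
    using lborel_integral_real_affine[of 1 "\<lambda>x. indicator {1..<1+s} x *\<^sub>R f x" 1] sh by simp
  have eq: "(\<lambda>x. indicator {s..<1+s} x *\<^sub>R f x)
      = (\<lambda>x. indicator {s..<1} x *\<^sub>R f x + indicator {1..<1+s} x *\<^sub>R f x)"
    using s by (auto simp: indicator_def fun_eq_iff)
  have eq0: "(\<lambda>x. indicator {0..<1} x *\<^sub>R f x)
      = (\<lambda>x. indicator {s..<1} x *\<^sub>R f x + indicator {0..<s} x *\<^sub>R f x)"
    using s by (auto simp: indicator_def fun_eq_iff)
  have sh2: "(\<lambda>x. indicator {s..<1+s} (s + 1 * x) *\<^sub>R f (s + 1 * x))
      = (\<lambda>x. indicator {0..<1} x *\<^sub>R f (s + x))"
    by (auto simp: indicator_def fun_eq_iff)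
  have i4: "integrable lborel (\<lambda>x. indicator {s..<1+s} x *\<^sub>R f x)"
    unfolding eq using i1 i3 by (rule Bochner_Integration.integrable_add)
  show "integrable circ (\<lambda>x. f (x + t))"
    unfolding fs integrable_circ
    using lborel_integrable_real_affine[of "\<lambda>x. indicator {s..<1+s} x *\<^sub>R f x" 1 s] i4 sh2 by simp
  have "(\<integral>x. f (x + t) \<partial>circ) = (\<integral>x. indicator {s..<1+s} x *\<^sub>R f x \<partial>lborel)"
    unfolding fs integral_circ
    using lborel_integral_real_affine[of 1 "\<lambda>x. indicator {s..<1+s} x *\<^sub>R f x" s] sh2 by simp
  also have "\<dots> = (\<integral>x. f x \<partial>circ)"
    unfolding eq integral_circ eq0 using i1 i2 i3 e3 by simp
  finally show "(\<integral>x. f (x + t) \<partial>circ) = (\<integral>x. f x \<partial>circ)" .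
qed

subsection \<open>Integrable functions on the circle\<close>

lemma L1D: "L1 f \<Longrightarrow> periodic1 f" "L1 f \<Longrightarrow> integrable circ f"
  by (auto simp: L1_def)

lemma L1_borel_measurable: "L1 f \<Longrightarrow> f \<in> borel_measurable borel"
  unfolding L1_def by (auto intro: periodic1_measurable)

lemma L1_const [simp]: "L1 (\<lambda>_. c)"
  by (simp add: L1_def periodic1_def)

lemma L1_add: "L1 f \<Longrightarrow> L1 g \<Longrightarrow> L1 (\<lambda>x. f x + g x)"
  by (auto simp: L1_def periodic1_def)

lemma L1_diff: "L1 f \<Longrightarrow> L1 g \<Longrightarrow> L1 (\<lambda>x. f x - g x)"
  by (auto simp: L1_def periodic1_def)

lemma L1_cmult: "L1 f \<Longrightarrow> L1 (\<lambda>x. c * f x)"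
  by (auto simp: L1_def periodic1_def)

lemma L1_continuous: "periodic1 f \<Longrightarrow> continuous_on UNIV f \<Longrightarrow> L1 f"
  by (simp add: L1_def integrable_circ_continuous)

lemma L1_bounded:
  "periodic1 f \<Longrightarrow> f \<in> borel_measurable borel \<Longrightarrow> (\<And>x. \<bar>f x\<bar> \<le> B) \<Longrightarrow> L1 f"
  unfolding L1_def by (auto intro!: integrable_circ_bounded[where B = B])

lemma L1_translate: "L1 f \<Longrightarrow> L1 (\<lambda>x. f (x + t))"
  unfolding L1_def using integrable_circ_translate
  by (auto simp: periodic1_def) (metis add.assoc add.commute)

lemma L1_norm_nonneg [simp]: "0 \<le> L1_norm f"
  by (simp add: L1_norm_def)

lemma L1_norm_add: "L1 f \<Longrightarrow> L1 g \<Longrightarrow> L1_norm (\<lambda>x. f x + g x) \<le> L1_norm f + L1_norm g"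
  using integral_mono[of circ "\<lambda>x. \<bar>f x + g x\<bar>" "\<lambda>x. \<bar>f x\<bar> + \<bar>g x\<bar>"]
  by (auto simp: L1_norm_def L1_def abs_triangle_ineq)

lemma L1_norm_diff: "L1 f \<Longrightarrow> L1 g \<Longrightarrow> L1_norm (\<lambda>x. f x - g x) \<le> L1_norm f + L1_norm g"
  using integral_mono[of circ "\<lambda>x. \<bar>f x - g x\<bar>" "\<lambda>x. \<bar>f x\<bar> + \<bar>g x\<bar>"]
  by (auto simp: L1_norm_def L1_def abs_triangle_ineq4)

lemma L1_norm_cmult: "L1_norm (\<lambda>x. c * f x) = \<bar>c\<bar> * L1_norm f"
  by (simp add: L1_norm_def abs_mult)

lemma L1_norm_cong_AE:
  assumes "L1 f" "L1 g" "AE x in circ. f x = g x"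
  shows "L1_norm f = L1_norm g"
  unfolding L1_norm_def using assms by (intro integral_cong_AE) (auto simp: L1_def)

lemma L1_norm_le_sup:
  assumes "L1 f" "\<And>x. \<bar>f x\<bar> \<le> B"
  shows "L1_norm f \<le> B"
  unfolding L1_norm_def using assms by (intro integral_circ_le_const) (auto simp: L1_def)

lemma L1_norm_const [simp]: "L1_norm (\<lambda>_. c) = \<bar>c\<bar>"
  by (simp add: L1_norm_def)

lemma L1_norm_translate: "L1 f \<Longrightarrow> L1_norm (\<lambda>x. f (x + t)) = L1_norm f"
  unfolding L1_norm_def L1_def
  by (rule integral_circ_translate) (auto simp: periodic1_def)

lemma L1_norm_eq_0: "L1 f \<Longrightarrow> L1_norm f = 0 \<Longrightarrow> AE x in circ. f x = 0"
  unfolding L1_norm_def L1_def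
  by (subst (asm) integral_nonneg_eq_0_iff_AE) auto

lemma integrable_mult_bounded:
  fixes k w :: "real \<Rightarrow> real"
  assumes "integrable circ w" "k \<in> borel_measurable borel" "\<And>x. \<bar>k x\<bar> \<le> B"
  shows "integrable circ (\<lambda>x. k x * w x)"
proof (rule Bochner_Integration.integrable_bound[where f = "\<lambda>x. B * w x"])
  have B: "0 \<le> B" using assms(3)[of 0] by linarith
  show "AE x in circ. norm (k x * w x) \<le> norm (B * w x)"
    using assms(3) B by (intro AE_I2) (auto simp: abs_mult intro!: mult_right_mono)
qed (use assms in \<open>auto intro!: borel_measurable_times borel_measurable_circ\<close>)

lemma integral_mult_le_sup:
  fixes k w :: "real \<Rightarrow> real"
  assumes "integrable circ w" "k \<in> borel_measurable borel" "\<And>x. \<bar>k x\<bar> \<le> B"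
  shows "\<bar>\<integral>x. k x * w x \<partial>circ\<bar> \<le> B * L1_norm w"
proof -
  have i: "integrable circ (\<lambda>x. k x * w x)" by (rule integrable_mult_bounded[OF assms])
  have "\<bar>\<integral>x. k x * w x \<partial>circ\<bar> \<le> (\<integral>x. \<bar>k x * w x\<bar> \<partial>circ)" by (rule integral_circ_abs_triangle)
  also have "\<dots> \<le> (\<integral>x. B * \<bar>w x\<bar> \<partial>circ)"
    using assms integrable_norm[OF i]
    by (intro integral_mono) (auto simp: abs_mult intro!: mult_right_mono)
  finally show ?thesis by (simp add: L1_norm_def)
qed

lemma L1_mult_bounded:
  assumes "L1 w" "periodic1 k" "k \<in> borel_measurable borel" "\<And>x. \<bar>k x\<bar> \<le> B"
  shows "L1 (\<lambda>x. k x * w x)"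
  using assms integrable_mult_bounded[of w k B] by (auto simp: L1_def periodic1_def)

text \<open>The form of integrability on the torus that every exchange of integrals below needs: a bounded
  kernel times an integrable function of one variable.\<close>

lemma integrable_kernel:
  fixes w :: "real \<Rightarrow> real" and k :: "real \<Rightarrow> real \<Rightarrow> real"
  assumes w: "integrable circ w" and km: "case_prod k \<in> borel_measurable (circ \<Otimes>\<^sub>M circ)"
    and B: "\<And>x y. \<bar>k x y\<bar> \<le> B"
  shows "integrable (circ \<Otimes>\<^sub>M circ) (\<lambda>(x, y). k x y * w y)"
proof (rule circ2.Fubini_integrable)
  have [measurable]: "w \<in> borel_measurable circ" using w by auto
  note km[measurable]
  have km1[measurable]: "k x \<in> borel_measurable circ" if "x \<in> space circ" for x
    using measurable_compose[OF measurable_Pair1'[OF that] km] by simp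
  have B0: "0 \<le> B" using B[of 0 0] by linarith
  show 1: "(\<lambda>(x, y). k x y * w y) \<in> borel_measurable (circ \<Otimes>\<^sub>M circ)" by measurable
  have inn: "integrable circ (\<lambda>y. k x y * w y)" if "x \<in> space circ" for x
  proof (rule Bochner_Integration.integrable_bound[where f = "\<lambda>x. B * w x"])
    show "AE y in circ. norm (k x y * w y) \<le> norm (B * w y)"
      using B B0 by (intro AE_I2) (auto simp: abs_mult intro!: mult_right_mono)
  qed (use w km1[OF that] in auto)
  show "AE x in circ. integrable circ (\<lambda>y. case (x, y) of (x, y) \<Rightarrow> k x y * w y)"
    using inn by (intro AE_I2) auto
  show "integrable circ (\<lambda>x. \<integral>y. norm (case (x, y) of (x, y) \<Rightarrow> k x y * w y) \<partial>circ)"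
  proof (rule circ.integrable_const_bound[where B = "B * L1_norm w"])
    show "AE x in circ. norm (\<integral>y. norm (case (x, y) of (x, y) \<Rightarrow> k x y * w y) \<partial>circ) \<le> B * L1_norm w"
    proof (rule AE_I2)
      fix x assume x: "x \<in> space circ"
      have "(\<integral>y. norm (k x y * w y) \<partial>circ) \<le> (\<integral>y. B * \<bar>w y\<bar> \<partial>circ)"
        using integrable_norm[OF inn[OF x]] w B
        by (intro integral_mono) (auto simp: abs_mult intro!: mult_right_mono)
      then show "norm (\<integral>y. norm (case (x, y) of (x, y) \<Rightarrow> k x y * w y) \<partial>circ) \<le> B * L1_norm w"
        by (simp add: L1_norm_def)
    qed
  qed measurable
qed

section \<open>Trigonometric polynomials and the Fejer kernel\<close>

subsection \<open>Test functions\<close>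

lemma test_functionI:
  assumes "\<phi> \<in> X" "\<And>f. f \<in> X \<Longrightarrow> periodic1 f"
    and der: "\<And>f. f \<in> X \<Longrightarrow> \<exists>f'\<in>X. \<forall>x. (f has_real_derivative f' x) (at x)"
  shows "test_function \<phi>"
proof -
  have X: "(deriv ^^ k) \<phi> \<in> X" for k
  proof (induction k)
    case (Suc k)
    obtain f' where f': "f' \<in> X" "\<And>x. ((deriv ^^ k) \<phi> has_real_derivative f' x) (at x)"
      using der[OF Suc] by blast
    have "deriv ((deriv ^^ k) \<phi>) = f'"
      using DERIV_imp_deriv[OF f'(2)] by blast
    then show ?case using f' by simp
  qed (use assms in simp)
  have diff: "(deriv ^^ k) \<phi> differentiable (at x)" for k x
    using der[OF X[of k]] real_differentiable_def by blast
  then have "continuous_on UNIV ((deriv ^^ k) \<phi>)" for k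
    by (intro differentiable_imp_continuous_on) (auto simp: differentiable_on_def)
  then show ?thesis
    using diff assms by (auto simp: test_function_def C_k_def)
qed

lemma test_function_DERIV:
  assumes "test_function \<phi>"
  shows "(\<phi> has_real_derivative deriv \<phi> x) (at x)"
proof -
  have "C_k 1 \<phi>" using assms by (simp add: test_function_def)
  then have "\<phi> differentiable (at x)" by (simp add: C_k_def)
  then show ?thesis by (simp add: DERIV_deriv_iff_real_differentiable)
qed

lemma test_function_continuous: "test_function \<phi> \<Longrightarrow> continuous_on UNIV \<phi>"
  unfolding test_function_def C_k_def by (metis funpow_0)

lemma test_function_deriv:
  assumes "test_function \<phi>"
  shows "test_function (deriv \<phi>)"
proof -
  have "C_k k (deriv \<phi>)" for k
  proof -
    have "C_k (Suc k) \<phi>" using assms by (simp add: test_function_def)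
    then have "(deriv ^^ Suc j) \<phi> differentiable (at x)" if "j < k" for j x
      using that unfolding C_k_def by blast
    moreover have "continuous_on UNIV ((deriv ^^ Suc k) \<phi>)"
      using \<open>C_k (Suc k) \<phi>\<close> unfolding C_k_def by blast
    ultimately show ?thesis
      unfolding C_k_def by (simp add: funpow_swap1)
  qed
  moreover have "periodic1 (deriv \<phi>)"
    unfolding periodic1_def
  proof
    fix x
    have "((\<lambda>x. \<phi> (x + 1)) has_real_derivative deriv \<phi> (x + 1)) (at x)"
      using DERIV_shift[of \<phi> "deriv \<phi> (x + 1)" x 1] test_function_DERIV[OF assms] by (simp add: add.commute)
    moreover have "(\<lambda>x. \<phi> (x + 1)) = \<phi>"
      using assms by (auto simp: test_function_def periodic1_def)
    ultimately show "deriv \<phi> (x + 1) = deriv \<phi> x"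
      using DERIV_unique test_function_DERIV[OF assms] by metis
  qed
  ultimately show ?thesis by (simp add: test_function_def)
qed

lemma test_function_funpow: "test_function \<phi> \<Longrightarrow> test_function ((deriv ^^ k) \<phi>)"
  by (induction k) (auto intro: test_function_deriv)

lemma test_function_periodic: "test_function \<phi> \<Longrightarrow> periodic1 \<phi>"
  by (simp add: test_function_def)

lemma test_function_L1: "test_function \<phi> \<Longrightarrow> L1 \<phi>"
  by (intro L1_continuous test_function_periodic test_function_continuous)

lemma test_function_bounded:
  assumes "test_function \<phi>"
  obtains B where "B \<ge> 0" "\<And>x. \<bar>\<phi> x\<bar> \<le> B"
  using periodic1_bounded[OF test_function_periodic[OF assms] test_function_continuous[OF assms]]
  by auto

subsection \<open>Characters\<close>

lemma e_fun_cis: "e_fun k x = cis (2 * pi * (of_int k * x))"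
  by (simp add: e_fun_def cis_conv_exp algebra_simps)

lemma norm_e_fun [simp]: "cmod (e_fun k x) = 1"
  by (simp add: e_fun_cis)

lemma e_fun_0 [simp]: "e_fun 0 x = 1"
  by (simp add: e_fun_cis)

lemma e_fun_add_arg: "e_fun k (x + y) = e_fun k x * e_fun k y"
  by (simp add: e_fun_cis cis_mult algebra_simps)

lemma e_fun_diff_arg: "e_fun k (x - y) = e_fun k x * e_fun (- k) y"
  by (simp add: e_fun_cis cis_mult algebra_simps)

lemma e_fun_add: "e_fun (k + l) x = e_fun k x * e_fun l x"
  by (simp add: e_fun_cis cis_mult algebra_simps)

lemma e_fun_at_1 [simp]: "e_fun k 1 = 1"
  using cis_multiple_2pi[of "of_int k"] by (simp add: e_fun_cis)

lemma e_fun_at_0 [simp]: "e_fun k 0 = 1"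
  by (simp add: e_fun_cis)

lemma e_fun_periodic: "e_fun k (x + 1) = e_fun k x"
  by (simp add: e_fun_add_arg)

lemma cnj_e_fun: "cnj (e_fun k x) = e_fun (- k) x"
  by (simp add: e_fun_cis cis_cnj)

lemma Re_e_fun: "Re (e_fun k x) = cos (2 * pi * (of_int k * x))"
  by (simp add: e_fun_cis)

lemma e_fun_has_vector_derivative:
  "(e_fun k has_vector_derivative (2 * of_real pi * \<i> * of_int k) * e_fun k x) (at x)"
proof -
  have "((\<lambda>x. exp (x *\<^sub>R (2 * of_real pi * \<i> * of_int k)))
      has_vector_derivative (2 * of_real pi * \<i> * of_int k) *
        exp (x *\<^sub>R (2 * of_real pi * \<i> * of_int k))) (at x)"
    by (rule exp_scaleR_has_vector_derivative_left)
  moreover have "e_fun k = (\<lambda>x. exp (x *\<^sub>R (2 * of_real pi * \<i> * of_int k)))"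
    by (auto simp: e_fun_def scaleR_conv_of_real mult_ac)
  ultimately show ?thesis by simp
qed

lemma e_fun_continuous: "continuous_on UNIV (e_fun k)"
  using has_vector_derivative_continuous[OF e_fun_has_vector_derivative]
  by (auto simp: continuous_on_eq_continuous_within)

lemma e_fun_measurable [measurable]: "e_fun k \<in> borel_measurable borel"
  by (rule borel_measurable_continuous_onI[OF e_fun_continuous])

lemma integral_e_fun: "(\<integral>x. e_fun k x \<partial>circ) = (if k = 0 then 1 else 0)"
proof (cases "k = 0")
  case False
  define a where "a = 2 * of_real pi * \<i> * of_int k"
  have a: "a \<noteq> 0" using False by (simp add: a_def)
  have "((\<lambda>x. e_fun k x * (1 / a)) has_vector_derivative e_fun k x) (at x)" for x
  proof -
    have "((\<lambda>x. e_fun k x * (1 / a)) has_vector_derivative (a * e_fun k x) * (1 / a)) (at x)"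
      unfolding a_def by (rule has_vector_derivative_mult_left[OF e_fun_has_vector_derivative])
    moreover have "(a * e_fun k x) * (1 / a) = e_fun k x" using a by simp
    ultimately show ?thesis by metis
  qed
  then have "(\<integral>x. e_fun k x \<partial>circ) = e_fun k 1 * (1 / a) - e_fun k 0 * (1 / a)"
    by (rule integral_circ_FTC[OF _ e_fun_continuous])
  then show ?thesis using False by simp
qed simp

lemma integrable_e_fun: "integrable circ (e_fun k)"
  by (rule integrable_circ_continuous[OF e_fun_continuous])

subsection \<open>The spaces of trigonometric polynomials\<close>

text \<open>A real function together with the complex coefficients of its expansion. The coefficients are what
  differentiation and averaging act on by multiplication.\<close>

definition trig_rep :: "int set \<Rightarrow> (int \<Rightarrow> complex) \<Rightarrow> (real \<Rightarrow> real) \<Rightarrow> bool" where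
  "trig_rep A c f \<longleftrightarrow> finite A \<and> (\<forall>x. of_real (f x) = (\<Sum>k\<in>A. c k * e_fun k x))"

lemma F_space_trig_rep: "f \<in> F_space N \<longleftrightarrow> (\<exists>c. trig_rep {- int N + 1..int N} c f)"
  by (auto simp: F_space_def trig_rep_def)

lemma trig_rep_periodic: "trig_rep A c f \<Longrightarrow> periodic1 f"
  unfolding trig_rep_def periodic1_def e_fun_periodic
  by (metis (no_types, lifting) e_fun_periodic of_real_eq_iff sum.cong)

text \<open>The derivative of the complex expansion is real because the expansion has constant imaginary part
  zero.\<close>

lemma trig_rep_deriv:
  assumes "trig_rep A c f"
  obtains f' where "trig_rep A (\<lambda>k. (2 * of_real pi * \<i> * of_int k) * c k) f'"
    "\<And>x. (f has_real_derivative f' x) (at x)"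
proof -
  define F where "F x = (\<Sum>k\<in>A. c k * e_fun k x)" for x
  define G where "G x = (\<Sum>k\<in>A. ((2 * of_real pi * \<i> * of_int k) * c k) * e_fun k x)" for x
  have fF: "of_real (f x) = F x" for x using assms by (simp add: trig_rep_def F_def)
  have der1: "((\<lambda>x. c k * e_fun k x) has_vector_derivative
      ((2 * of_real pi * \<i> * of_int k) * c k) * e_fun k x) (at x)" for k x
    using has_vector_derivative_mult_right[OF e_fun_has_vector_derivative, of "c k" k x]
    by (simp only: mult_ac)
  have der: "(F has_vector_derivative G x) (at x)" for x
    unfolding F_def G_def by (rule has_vector_derivative_sum[OF der1])
  have re: "(f has_real_derivative Re (G x)) (at x)" for x
  proof -
    have "((\<lambda>x. Re (F x)) has_vector_derivative Re (G x)) (at x)"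
      by (rule bounded_linear.has_vector_derivative[OF bounded_linear_Re der])
    moreover have "(\<lambda>x. Re (F x)) = f" by (simp add: fun_eq_iff flip: fF)
    ultimately show ?thesis by (simp add: has_real_derivative_iff_has_vector_derivative)
  qed
  have "((\<lambda>x. Im (F x)) has_vector_derivative Im (G x)) (at x)" for x
    by (rule bounded_linear.has_vector_derivative[OF bounded_linear_Im der])
  moreover have "(\<lambda>x. Im (F x)) = (\<lambda>x. 0)" by (simp add: fun_eq_iff flip: fF)
  ultimately have "((\<lambda>x. 0) has_vector_derivative Im (G x)) (at x)" for x by simp
  then have "Im (G x) = 0" for x
    by (rule vector_derivative_unique_at) (rule has_vector_derivative_const)
  then have "of_real (Re (G x)) = G x" for x by (simp add: complex_eq_iff)
  then have "trig_rep A (\<lambda>k. (2 * of_real pi * \<i> * of_int k) * c k) (\<lambda>x. Re (G x))"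
    using assms by (simp add: trig_rep_def G_def)
  then show ?thesis using re that by blast
qed

lemma trig_rep_test_function: "trig_rep A c f \<Longrightarrow> test_function f"
proof (rule test_functionI[where X = "{f. \<exists>A c. trig_rep A c f}"])
  fix f assume "f \<in> {f. \<exists>A c. trig_rep A c f}"
  then obtain A c where f: "trig_rep A c f" by blast
  obtain f' c' where "trig_rep A c' f'" "\<And>x. (f has_real_derivative f' x) (at x)"
    by (rule trig_rep_deriv[OF f]) blast
  then show "\<exists>f'\<in>{f. \<exists>A c. trig_rep A c f}. \<forall>x. (f has_real_derivative f' x) (at x)"
    by blast
qed (blast intro: trig_rep_periodic)+

lemma trig_rep_coeff:
  assumes "trig_rep A c f" "k \<in> A"
  shows "c k = (\<integral>x. of_real (f x) * e_fun (- k) x \<partial>circ)"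
proof -
  have e: "e_fun (j - k) x = e_fun j x * e_fun (- k) x" for j x
    using e_fun_add[of j "- k" x] by simp
  have "(\<integral>x. of_real (f x) * e_fun (- k) x \<partial>circ) = (\<integral>x. (\<Sum>j\<in>A. c j * e_fun (j - k) x) \<partial>circ)"
    using assms unfolding e by (simp add: trig_rep_def sum_distrib_right mult.assoc)
  also have "\<dots> = (\<Sum>j\<in>A. (\<integral>x. c j * e_fun (j - k) x \<partial>circ))"
    by (rule Bochner_Integration.integral_sum) (auto intro: integrable_e_fun)
  also have "\<dots> = (\<Sum>j\<in>A. if j = k then c j else 0)"
    by (intro sum.cong) (auto simp: integral_e_fun)
  also have "\<dots> = c k"
    using assms by (simp add: trig_rep_def)
  finally show ?thesis by simp
qed

lemma trig_rep_coeff_bound: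
  assumes "trig_rep A c f" "k \<in> A"
  shows "cmod (c k) \<le> L1_norm f"
proof -
  have "cmod (c k) \<le> (\<integral>x. cmod (of_real (f x) * e_fun (- k) x) \<partial>circ)"
    unfolding trig_rep_coeff[OF assms] by (rule integral_norm_bound)
  then show ?thesis by (simp add: norm_mult L1_norm_def)
qed

text \<open>Translation by a parameter multiplies the coefficients by characters, and averaging over the
  parameter turns these into constants. This is why the discretised operator and its derivatives take
  values in trigonometric polynomials.\<close>

lemma trig_rep_average:
  assumes \<kappa>: "trig_rep A c \<kappa>" and s: "s \<in> borel_measurable borel" and w: "integrable circ w"
  shows "trig_rep A (\<lambda>k. c k * (\<integral>z. e_fun (- k) (s z) * of_real (w z) \<partial>circ))
    (\<lambda>x. \<integral>z. \<kappa> (x - s z) * w z \<partial>circ)"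
  unfolding trig_rep_def
proof (intro conjI allI)
  show "finite A" using \<kappa> by (simp add: trig_rep_def)
  fix x
  have ef: "(\<lambda>z. e_fun k (s z)) \<in> borel_measurable circ" for k
    using measurable_compose[OF s e_fun_measurable] by blast
  have i: "integrable circ (\<lambda>z. e_fun k (s z) * of_real (w z))" for k
  proof (rule Bochner_Integration.integrable_bound[OF w])
    show "(\<lambda>z. e_fun k (s z) * of_real (w z)) \<in> borel_measurable circ"
      using ef w by (intro borel_measurable_times borel_measurable_of_real) auto
  qed (auto simp: norm_mult)
  have "complex_of_real (\<integral>z. \<kappa> (x - s z) * w z \<partial>circ) = (\<integral>z. complex_of_real (\<kappa> (x - s z) * w z) \<partial>circ)"
    by (rule integral_complex_of_real[symmetric])
  also have "\<dots> = (\<integral>z. (\<Sum>k\<in>A. (c k * e_fun k x) * (e_fun (- k) (s z) * of_real (w z))) \<partial>circ)"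
  proof (intro Bochner_Integration.integral_cong refl)
    fix z
    have "complex_of_real (\<kappa> (x - s z) * w z) = (\<Sum>k\<in>A. c k * e_fun k (x - s z)) * of_real (w z)"
      using \<kappa> by (simp add: trig_rep_def)
    then show "complex_of_real (\<kappa> (x - s z) * w z)
        = (\<Sum>k\<in>A. (c k * e_fun k x) * (e_fun (- k) (s z) * of_real (w z)))"
      by (simp add: sum_distrib_right e_fun_diff_arg mult.assoc)
  qed
  also have "\<dots> = (\<Sum>k\<in>A. (\<integral>z. (c k * e_fun k x) * (e_fun (- k) (s z) * of_real (w z)) \<partial>circ))"
    by (rule Bochner_Integration.integral_sum) (auto intro: i)
  also have "\<dots> = (\<Sum>k\<in>A. c k * (\<integral>z. e_fun (- k) (s z) * of_real (w z) \<partial>circ) * e_fun k x)"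
    using i by (intro sum.cong) (auto simp: mult_ac)
  finally show "of_real (\<integral>z. \<kappa> (x - s z) * w z \<partial>circ) = \<dots>" .
qed

lemma F_space_test_function: "f \<in> F_space N \<Longrightarrow> test_function f"
  by (auto simp: F_space_trig_rep intro: trig_rep_test_function)

lemma F_space_L1: "f \<in> F_space N \<Longrightarrow> L1 f"
  by (intro test_function_L1 F_space_test_function)

lemma F_space_average:
  assumes "\<kappa> \<in> F_space N" "s \<in> borel_measurable borel" "integrable circ w"
  shows "(\<lambda>x. \<integral>z. \<kappa> (x - s z) * w z \<partial>circ) \<in> F_space N"
  using assms trig_rep_average[of _ _ \<kappa> s w] unfolding F_space_trig_rep by blast

lemma F_space_deriv:
  assumes "f \<in> F_space N"
  shows "deriv f \<in> F_space N"
proof -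
  obtain c where "trig_rep {- int N + 1..int N} c f" using assms by (auto simp: F_space_trig_rep)
  from trig_rep_deriv[OF this] obtain f' c'
    where f': "trig_rep {- int N + 1..int N} c' f'" "\<And>x. (f has_real_derivative f' x) (at x)"
    by metis
  have "deriv f = f'" using DERIV_imp_deriv[OF f'(2)] by blast
  then show ?thesis using f' by (auto simp: F_space_trig_rep)
qed

lemma F_space_funpow_deriv: "f \<in> F_space N \<Longrightarrow> (deriv ^^ j) f \<in> F_space N"
  by (induction j) (auto intro: F_space_deriv)

lemma F_space_add:
  assumes "f \<in> F_space N" "g \<in> F_space N"
  shows "(\<lambda>x. f x + g x) \<in> F_space N"
proof -
  obtain c d where "\<forall>x. of_real (f x) = (\<Sum>k\<in>{- int N + 1..int N}. c k * e_fun k x)"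
    "\<forall>x. of_real (g x) = (\<Sum>k\<in>{- int N + 1..int N}. d k * e_fun k x)"
    using assms by (auto simp: F_space_def)
  then show ?thesis unfolding F_space_def
    by (auto intro!: exI[of _ "\<lambda>k. c k + d k"] simp: sum.distrib distrib_right)
qed

lemma F_space_cmult:
  assumes "f \<in> F_space N"
  shows "(\<lambda>x. a * f x) \<in> F_space N"
proof -
  obtain c where "\<forall>x. of_real (f x) = (\<Sum>k\<in>{- int N + 1..int N}. c k * e_fun k x)"
    using assms by (auto simp: F_space_def)
  then show ?thesis unfolding F_space_def
    by (auto intro!: exI[of _ "\<lambda>k. of_real a * c k"] simp: sum_distrib_left mult.assoc)
qed

lemma F_space_diff: "f \<in> F_space N \<Longrightarrow> g \<in> F_space N \<Longrightarrow> (\<lambda>x. f x - g x) \<in> F_space N"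
  using F_space_add[of f N "\<lambda>x. (-1) * g x"] F_space_cmult[of g N "-1"] by simp

lemma F_space_zero: "(\<lambda>x. 0) \<in> F_space N"
  unfolding F_space_def by (auto intro!: exI[of _ "\<lambda>_. 0"])

text \<open>The \<open>L\<^sup>1\<close> norm dominates every Fourier coefficient, and there are finitely many of them.\<close>

lemma F_space_sup_bound: "\<exists>C\<ge>0. \<forall>f\<in>F_space N. \<forall>x. \<bar>f x\<bar> \<le> C * L1_norm f"
proof (intro exI conjI ballI allI)
  fix f x assume "f \<in> F_space N"
  then obtain c where c: "trig_rep {- int N + 1..int N} c f" by (auto simp: F_space_trig_rep)
  have "\<bar>f x\<bar> = cmod (of_real (f x))" by simp
  also have "\<dots> = cmod (\<Sum>k\<in>{- int N + 1..int N}. c k * e_fun k x)"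
    using c unfolding trig_rep_def by metis
  also have "\<dots> \<le> (\<Sum>k\<in>{- int N + 1..int N}. cmod (c k * e_fun k x))" by (rule norm_sum)
  also have "\<dots> \<le> (\<Sum>k\<in>{- int N + 1..int N}. L1_norm f)"
    by (intro sum_mono) (use trig_rep_coeff_bound[OF c] in \<open>simp add: norm_mult\<close>)
  finally show "\<bar>f x\<bar> \<le> real (2 * N) * L1_norm f" by simp
qed simp

lemma F_space_deriv_L1_bound: "\<exists>C\<ge>0. \<forall>f\<in>F_space N. L1_norm (deriv f) \<le> C * L1_norm f"
proof (intro exI conjI ballI allI)
  fix f assume fF: "f \<in> F_space N"
  then obtain c where c: "trig_rep {- int N + 1..int N} c f" by (auto simp: F_space_trig_rep)
  obtain f'
    where f': "trig_rep {- int N + 1..int N} (\<lambda>k. (2 * of_real pi * \<i> * of_int k) * c k) f'"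
      "\<And>x. (f has_real_derivative f' x) (at x)"
    by (rule trig_rep_deriv[OF c]) blast
  have ff': "deriv f = f'" using DERIV_imp_deriv[OF f'(2)] by blast
  show "L1_norm (deriv f) \<le> (\<Sum>k\<in>{- int N + 1..int N}. 2 * pi * \<bar>of_int k\<bar>) * L1_norm f"
  proof (rule L1_norm_le_sup)
    show "L1 (deriv f)" by (rule F_space_L1[OF F_space_deriv[OF fF]])
    fix x
    have "\<bar>f' x\<bar> = cmod (of_real (f' x))" by simp
    also have "\<dots> = cmod (\<Sum>k\<in>{- int N + 1..int N}. (2 * of_real pi * \<i> * of_int k) * c k * e_fun k x)"
      using f'(1) unfolding trig_rep_def by metis
    also have "\<dots> \<le> (\<Sum>k\<in>{- int N + 1..int N}. cmod ((2 * of_real pi * \<i> * of_int k) * c k * e_fun k x))"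
      by (rule norm_sum)
    also have "\<dots> \<le> (\<Sum>k\<in>{- int N + 1..int N}. 2 * pi * \<bar>of_int k\<bar> * L1_norm f)"
      by (intro sum_mono)
         (use trig_rep_coeff_bound[OF c] in \<open>simp add: norm_mult mult_left_mono\<close>)
    finally show "\<bar>deriv f x\<bar> \<le> (\<Sum>k\<in>{- int N + 1..int N}. 2 * pi * \<bar>of_int k\<bar>) * L1_norm f"
      by (simp add: ff' sum_distrib_right)
  qed
qed (auto intro: sum_nonneg)

subsection \<open>The Fejer kernel\<close>

lemma fejer_trig_rep:
  assumes "N \<ge> 1"
  shows "trig_rep {- int N + 1..int N} (\<lambda>k. of_real (1 - \<bar>of_int k\<bar> / of_nat N)) (fejer N)"
  unfolding trig_rep_def
proof (intro conjI allI)
  fix x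
  let ?t = "\<lambda>k. of_real (1 - \<bar>of_int k\<bar> / of_nat N) * e_fun k x"
  let ?S = "\<Sum>k\<in>{- int N + 1..int N - 1}. ?t k"
  have "cnj ?S = (\<Sum>k\<in>{- int N + 1..int N - 1}. ?t (- k))"
    by (simp add: cnj_e_fun cnj_sum)
  also have "\<dots> = ?S"
    by (rule sum.reindex_bij_witness[where i = uminus and j = uminus]) auto
  finally have "?S \<in> \<real>" by (simp only: Reals_cnj_iff)
  then have "of_real (Re ?S) = ?S" by (rule of_real_Re)
  also have "?S = (\<Sum>k\<in>insert (int N) {- int N + 1..int N - 1}. ?t k)"
    using assms by (subst sum.insert) auto
  also have "insert (int N) {- int N + 1..int N - 1} = {- int N + 1..int N}"
    using assms by auto
  finally show "of_real (fejer N x) = (\<Sum>k\<in>{- int N + 1..int N}. ?t k)"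
    by (simp only: fejer_def)
qed simp

lemma fejer_F_space: "N \<ge> 1 \<Longrightarrow> fejer N \<in> F_space N"
  using fejer_trig_rep unfolding F_space_trig_rep by blast

lemma fejer_test: "N \<ge> 1 \<Longrightarrow> test_function (fejer N)"
  by (rule F_space_test_function[OF fejer_F_space])

lemma fejer_even: "fejer N (- x) = fejer N x"
  by (simp add: fejer_def Re_e_fun)

lemma integral_fejer: "N \<ge> 1 \<Longrightarrow> (\<integral>x. fejer N x \<partial>circ) = 1"
  using trig_rep_coeff[OF fejer_trig_rep, of N 0] by (simp add: complex_eq_iff)

lemma integral_fejer_cos: 
  assumes "N \<ge> 1"
  shows "(\<integral>x. fejer N x * cos (2 * pi * x) \<partial>circ) = 1 - 1 / N"
proof -
  have i: "integrable circ (\<lambda>x. of_real (fejer N x) * e_fun (- 1) x)"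
    by (intro integrable_circ_continuous continuous_intros e_fun_continuous
        test_function_continuous fejer_test assms)
  have "complex_of_real (1 - 1 / N) = (\<integral>x. of_real (fejer N x) * e_fun (- 1) x \<partial>circ)"
    using trig_rep_coeff[OF fejer_trig_rep[OF assms], of 1] assms by simp
  then have "1 - 1 / N = Re (\<integral>x. of_real (fejer N x) * e_fun (- 1) x \<partial>circ)"
    by (metis Re_complex_of_real)
  also have "\<dots> = (\<integral>x. Re (of_real (fejer N x) * e_fun (- 1) x) \<partial>circ)"
    using i by (rule integral_Re[symmetric])
  finally show ?thesis by (simp add: Re_e_fun)
qed

lemma sum_int_symmetric_Suc:
  fixes a :: "int \<Rightarrow> real"
  shows "(\<Sum>k\<in>{- int (Suc N)..int (Suc N)}. a k)
    = (\<Sum>k\<in>{- int N..int N}. a k) + a (int (Suc N)) + a (- int (Suc N))"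
proof -
  have "{- int (Suc N)..int (Suc N)} = insert (int (Suc N)) (insert (- int (Suc N)) {- int N..int N})"
    by auto
  then show ?thesis by simp
qed

lemma dirichlet_sum:
  "(\<Sum>k\<in>{- int N..int N}. cos (of_int k * \<theta>)) = 1 + 2 * (\<Sum>j<N. cos ((real N - real j) * \<theta>))"
proof (induction N)
  case (Suc N)
  have "(\<Sum>j<Suc N. cos ((real (Suc N) - real j) * \<theta>))
      = cos (real (Suc N) * \<theta>) + (\<Sum>j<N. cos ((real N - real j) * \<theta>))"
    by (subst sum.lessThan_Suc_shift) (simp add: algebra_simps)
  moreover have "cos (real_of_int (- int (Suc N)) * \<theta>) = cos (real (Suc N) * \<theta>)"
    by (metis cos_minus mult_minus_left of_int_minus of_int_of_nat_eq)
  ultimately show ?case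
    unfolding sum_int_symmetric_Suc Suc by simp
qed simp

text \<open>Positivity of the Fejer kernel: \<open>N\<close> times the kernel is the squared modulus of the sum of the
  first \<open>N\<close> characters. The increments of both sides in \<open>N\<close> are the Dirichlet kernel.\<close>

lemma fejer_square_sum:
  "(\<Sum>k\<in>{- int N..int N}. (real N - \<bar>of_int k\<bar>) * cos (of_int k * \<theta>))
    = (\<Sum>j<N. cos (real j * \<theta>))\<^sup>2 + (\<Sum>j<N. sin (real j * \<theta>))\<^sup>2"
proof (induction N)
  case (Suc N)
  let ?C = "\<Sum>j<N. cos (real j * \<theta>)" and ?S = "\<Sum>j<N. sin (real j * \<theta>)"
  have "(\<Sum>k\<in>{- int (Suc N)..int (Suc N)}. (real (Suc N) - \<bar>of_int k\<bar>) * cos (of_int k * \<theta>))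
      = (\<Sum>k\<in>{- int N..int N}. (real N - \<bar>of_int k\<bar>) * cos (of_int k * \<theta>) + cos (of_int k * \<theta>))"
    unfolding sum_int_symmetric_Suc by (simp add: algebra_simps)
  also have "\<dots> = ?C\<^sup>2 + ?S\<^sup>2 + (1 + 2 * (\<Sum>j<N. cos ((real N - real j) * \<theta>)))"
    unfolding sum.distrib Suc dirichlet_sum ..
  also have "(\<Sum>j<N. cos ((real N - real j) * \<theta>)) = cos (real N * \<theta>) * ?C + sin (real N * \<theta>) * ?S"
    by (simp add: left_diff_distrib cos_diff sum.distrib sum_distrib_left)
  also have "?C\<^sup>2 + ?S\<^sup>2 + (1 + 2 * (cos (real N * \<theta>) * ?C + sin (real N * \<theta>) * ?S))
      = (?C + cos (real N * \<theta>))\<^sup>2 + (?S + sin (real N * \<theta>))\<^sup>2"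
    using sin_cos_squared_add[of "real N * \<theta>"] by (simp add: power2_eq_square algebra_simps)
  finally show ?case by simp
qed simp

lemma fejer_nonneg: "N \<ge> 1 \<Longrightarrow> 0 \<le> fejer N x"
proof -
  assume N: "N \<ge> 1"
  define \<theta> where "\<theta> = 2 * pi * x"
  have eq: "{- int N..int N} = insert (- int N) (insert (int N) {- int N + 1..int N - 1})" by auto
  have "real N * fejer N x
      = (\<Sum>k\<in>{- int N + 1..int N - 1}. real N * ((1 - \<bar>of_int k\<bar> / of_nat N) * cos (of_int k * \<theta>)))"
    by (simp add: fejer_def Re_e_fun \<theta>_def sum_distrib_left mult_ac)
  also have "\<dots> = (\<Sum>k\<in>{- int N + 1..int N - 1}. (real N - \<bar>of_int k\<bar>) * cos (of_int k * \<theta>))"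
    using N by (intro sum.cong) (auto simp: field_simps)
  also have "\<dots> = (\<Sum>k\<in>{- int N..int N}. (real N - \<bar>of_int k\<bar>) * cos (of_int k * \<theta>))"
    using N unfolding eq by simp
  also have "\<dots> \<ge> 0" unfolding fejer_square_sum by simp
  finally show ?thesis using N by (simp add: zero_le_mult_iff)
qed

text \<open>Jordan's inequality with the constant 1 instead of 2: up to 1/3 the mean value theorem suffices,
  as the cosine is at least 1/2 there, and from 1/3 on the sine is at least 1/2.\<close>

lemma sin_pi_ge:
  assumes "0 \<le> d" "d \<le> 1 / 2"
  shows "d \<le> sin (pi * d)"
proof (cases "d \<le> 1 / 3")
  case True
  show ?thesis
  proof (cases "d = 0")
    case False
    then have "0 < pi * d" using assms by simp
    from MVT2[OF this, of sin cos] obtain z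
      where z: "0 < z" "z < pi * d" "sin (pi * d) = pi * d * cos z" by auto
    have "pi * d \<le> pi / 3" using True by simp
    then have "cos (pi / 3) \<le> cos z"
      using z pi_gt_zero by (intro cos_monotone_0_pi_le) linarith+
    then have "1 / 2 \<le> cos z" by (simp add: cos_60)
    then have "pi * d * (1 / 2) \<le> sin (pi * d)"
      unfolding z(3) using assms by (intro mult_left_mono) auto
    moreover have "2 * d \<le> pi * d" using pi_ge_two assms by (intro mult_right_mono) auto
    ultimately show ?thesis by linarith
  qed simp
next
  case False
  have "pi * d \<le> pi / 2" using assms by simp
  moreover have "pi / 6 \<le> pi * d" using False by simp
  ultimately have "sin (pi / 6) \<le> sin (pi * d)"
    using pi_gt_zero by (intro sin_monotone_2pi_le) linarith+
  then show ?thesis using assms by (simp add: sin_30)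
qed

text \<open>The distance of \<open>t\<close> to the nearest integer, for \<open>t\<close> in the unit interval, is \<open>min t (1 - t)\<close>.
  The concentration of the kernel is measured against \<open>1 - cos (2 * pi * t)\<close>, a trigonometric
  polynomial whose integral against the kernel is explicit.\<close>

lemma circle_dist_cos:
  assumes "0 \<le> t" "t \<le> 1"
  shows "(min t (1 - t))\<^sup>2 \<le> (1 - cos (2 * pi * t)) / 2"
proof -
  define d where "d = min t (1 - t)"
  have "cos (2 * pi * t) = cos (2 * (pi * d))"
  proof (cases "t \<le> 1 - t")
    case False
    have "cos (2 * (pi * (1 - t))) = cos (2 * pi - 2 * pi * t)" by (simp add: algebra_simps)
    then show ?thesis using False by (simp add: d_def cos_diff)
  qed (simp add: d_def mult_ac)
  also have "\<dots> = 1 - 2 * (sin (pi * d))\<^sup>2" by (simp add: cos_double_sin)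
  finally have "(1 - cos (2 * pi * t)) / 2 = (sin (pi * d))\<^sup>2" by simp
  moreover have "d\<^sup>2 \<le> (sin (pi * d))\<^sup>2"
    using assms by (intro power_mono sin_pi_ge) (auto simp: d_def min_def)
  ultimately show ?thesis by (simp add: d_def)
qed

lemma integral_fejer_one_minus_cos:
  assumes "N \<ge> 1"
  shows "(\<integral>t. fejer N t * (1 - cos (2 * pi * t)) \<partial>circ) = 1 / N"
proof -
  have "integrable circ (fejer N)" "integrable circ (\<lambda>t. fejer N t * cos (2 * pi * t))"
    by (intro integrable_circ_continuous continuous_intros test_function_continuous fejer_test assms)+
  then show ?thesis
    using integral_fejer[OF assms] integral_fejer_cos[OF assms] by (simp add: right_diff_distrib)
qed

text \<open>By the inequality of arithmetic and geometric means the distance is bounded by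
  \<open>\<eta> / 2\<close> plus its square over \<open>2 * \<eta>\<close>, and the kernel integrates that square to order \<open>1 / N\<close>.
  The value \<open>\<eta> = 1 / sqrt N\<close> balances the two terms.\<close>

lemma integral_fejer_dist:
  assumes "N \<ge> 1"
  shows "(\<integral>t. fejer N t * min t (1 - t) \<partial>circ) \<le> 1 / sqrt N"
proof -
  define \<eta> where "\<eta> = 1 / sqrt N"
  have \<eta>: "\<eta> > 0" "\<eta> * \<eta> = 1 / N" using assms by (auto simp: \<eta>_def field_simps)
  note cont = continuous_intros test_function_continuous fejer_test assms
  have pw: "min t (1 - t) \<le> \<eta> / 2 + (1 - cos (2 * pi * t)) / (4 * \<eta>)" if "0 \<le> t" "t \<le> 1" for t
  proof -
    define d where "d = min t (1 - t)"
    have "0 \<le> (d - \<eta>)\<^sup>2" by simp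
    then have "2 * \<eta> * d \<le> \<eta>\<^sup>2 + d\<^sup>2" by (simp add: power2_eq_square algebra_simps)
    also have "\<dots> \<le> \<eta>\<^sup>2 + (1 - cos (2 * pi * t)) / 2"
      using circle_dist_cos[OF that] by (simp add: d_def)
    finally show ?thesis using \<eta>(1) by (simp add: d_def field_simps power2_eq_square)
  qed
  have "(\<integral>t. fejer N t * min t (1 - t) \<partial>circ)
      \<le> (\<integral>t. fejer N t * (\<eta> / 2) + fejer N t * (1 - cos (2 * pi * t)) / (4 * \<eta>) \<partial>circ)"
  proof (rule integral_mono)
    fix t assume "t \<in> space circ"
    then have "fejer N t * min t (1 - t) \<le> fejer N t * (\<eta> / 2 + (1 - cos (2 * pi * t)) / (4 * \<eta>))"
      by (intro mult_left_mono pw fejer_nonneg assms) auto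
    then show "fejer N t * min t (1 - t) \<le> fejer N t * (\<eta> / 2) + fejer N t * (1 - cos (2 * pi * t)) / (4 * \<eta>)"
      by (simp add: distrib_left)
  qed (use \<eta> in \<open>intro integrable_circ_continuous cont; simp\<close>)+
  also have "\<dots> = (\<integral>t. fejer N t * (\<eta> / 2) \<partial>circ)
      + (\<integral>t. fejer N t * (1 - cos (2 * pi * t)) / (4 * \<eta>) \<partial>circ)"
    by (rule Bochner_Integration.integral_add) (use \<eta> in \<open>intro integrable_circ_continuous cont; simp\<close>)+
  also have "\<dots> = \<eta> / 2 + 1 / N / (4 * \<eta>)"
    using integral_fejer[OF assms] integral_fejer_one_minus_cos[OF assms] by simp
  also have "\<dots> \<le> \<eta>" using \<eta> by (simp flip: \<eta>(2))
  finally show ?thesis by (simp add: \<eta>_def)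
qed

section \<open>Averaging against the Fejer kernel\<close>

lemma integral_kernel_swap:
  fixes w v :: "real \<Rightarrow> real" and k :: "real \<Rightarrow> real \<Rightarrow> real"
  assumes "integrable circ w" "case_prod k \<in> borel_measurable (circ \<Otimes>\<^sub>M circ)" "\<And>x y. \<bar>k x y\<bar> \<le> B"
  shows "(\<integral>x. (\<integral>y. k x y * w y \<partial>circ) \<partial>circ) = (\<integral>y. (\<integral>x. k x y \<partial>circ) * w y \<partial>circ)"
  using circ2.Fubini_integral[OF integrable_kernel[OF assms]] by simp

lemma test_function_measurable: "test_function \<phi> \<Longrightarrow> \<phi> \<in> borel_measurable borel"
  by (rule borel_measurable_continuous_onI[OF test_function_continuous])

lemma measurable_pair_circ_compose:
  assumes "\<phi> \<in> borel_measurable borel" "(\<lambda>z. a (fst z) (snd z)) \<in> borel_measurable (borel \<Otimes>\<^sub>M borel)"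
  shows "(\<lambda>(x, y). \<phi> (a x y) :: real) \<in> borel_measurable (circ \<Otimes>\<^sub>M circ)"
proof -
  have "(\<lambda>z. (fst z, snd z)) \<in> circ \<Otimes>\<^sub>M circ \<rightarrow>\<^sub>M borel \<Otimes>\<^sub>M borel"
    by (intro measurable_Pair measurable_compose[OF measurable_fst ident_circ_borel]
        measurable_compose[OF measurable_snd ident_circ_borel])
  then have "(\<lambda>z. a (fst z) (snd z)) \<in> borel_measurable (circ \<Otimes>\<^sub>M circ)"
    using measurable_compose assms(2) by fastforce
  from measurable_compose[OF this assms(1)] show ?thesis by (simp add: case_prod_beta')
qed

lemma integral_periodic_shift:
  "L1 \<phi> \<Longrightarrow> (\<integral>x. \<phi> (x - c) \<partial>circ) = (\<integral>x. \<phi> x \<partial>circ)"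
  using integral_circ_translate[of \<phi> "- c"] by (simp add: L1_def)

lemma integral_average:
  assumes \<kappa>: "test_function \<kappa>" and s: "s \<in> borel_measurable borel" and w: "integrable circ w"
  shows "(\<integral>x. (\<integral>z. \<kappa> (x - s z) * w z \<partial>circ) \<partial>circ) = (\<integral>x. \<kappa> x \<partial>circ) * (\<integral>z. w z \<partial>circ)"
proof -
  obtain B where B: "\<And>x. \<bar>\<kappa> x\<bar> \<le> B" using test_function_bounded[OF \<kappa>] by metis
  have "(\<lambda>(x, z). \<kappa> (x - s z)) \<in> borel_measurable (circ \<Otimes>\<^sub>M circ)"
    using s by (intro measurable_pair_circ_compose[where \<phi> = \<kappa> and a = "\<lambda>x z. x - s z"]
        test_function_measurable \<kappa> borel_measurable_diff measurable_fst
        measurable_compose[OF measurable_snd s])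
  then have "(\<integral>x. (\<integral>z. \<kappa> (x - s z) * w z \<partial>circ) \<partial>circ) = (\<integral>z. (\<integral>x. \<kappa> (x - s z) \<partial>circ) * w z \<partial>circ)"
    by (intro integral_kernel_swap[where k = "\<lambda>x z. \<kappa> (x - s z)" and B = B] w B) auto
  then show ?thesis by (simp add: integral_periodic_shift test_function_L1 \<kappa>)
qed

lemma Pi_N_F_space: "N \<ge> 1 \<Longrightarrow> L1 f \<Longrightarrow> Pi_N N f \<in> F_space N"
  unfolding Pi_N_def by (rule F_space_average) (auto intro: fejer_F_space L1D)

lemma Pi_N_L1: "N \<ge> 1 \<Longrightarrow> L1 f \<Longrightarrow> L1 (Pi_N N f)"
  by (rule F_space_L1[OF Pi_N_F_space])

lemma Pi_N_integrable:
  assumes "N \<ge> 1" "L1 f"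
  shows "integrable circ (\<lambda>y. fejer N (x - y) * f y)"
proof -
  obtain B where "\<And>x. \<bar>fejer N x\<bar> \<le> B" using test_function_bounded[OF fejer_test[OF assms(1)]] by metis
  moreover have "(\<lambda>y. fejer N (x - y)) \<in> borel_measurable borel"
    using measurable_compose[OF _ test_function_measurable[OF fejer_test[OF assms(1)]], of "\<lambda>y. x - y" borel]
    by simp
  ultimately show ?thesis
    using assms by (intro integrable_mult_bounded[where B = B]) (auto intro: L1D)
qed

lemma Pi_N_eq:
  assumes "N \<ge> 1" "L1 f"
  shows "Pi_N N f x = (\<integral>t. fejer N t * f (x + t) \<partial>circ)"
proof -
  have "fejer N (x - (y + 1)) = fejer N (x - y)" for y
    using periodic1_minus1[OF test_function_periodic[OF fejer_test[OF assms(1)]], of "x - y"]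
    by (simp add: algebra_simps)
  then have per: "periodic1 (\<lambda>y. fejer N (x - y) * f y)"
    using assms(2) by (simp add: periodic1_def L1_def)
  have "Pi_N N f x = (\<integral>y. fejer N (x - (y + x)) * f (y + x) \<partial>circ)"
    unfolding Pi_N_def by (rule integral_circ_translate[OF per Pi_N_integrable[OF assms], symmetric])
  then show ?thesis by (simp add: fejer_even add.commute)
qed

lemma Pi_N_diff:
  "N \<ge> 1 \<Longrightarrow> L1 f \<Longrightarrow> L1 g \<Longrightarrow> Pi_N N (\<lambda>x. f x - g x) x = Pi_N N f x - Pi_N N g x"
  unfolding Pi_N_def using Pi_N_integrable by (simp add: right_diff_distrib)

lemma integral_Pi_N:
  assumes "N \<ge> 1" "L1 f"
  shows "(\<integral>x. Pi_N N f x \<partial>circ) = (\<integral>x. f x \<partial>circ)"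
proof -
  have "(\<integral>x. Pi_N N f x \<partial>circ) = (\<integral>x. fejer N x \<partial>circ) * (\<integral>x. f x \<partial>circ)"
    unfolding Pi_N_def
    by (rule integral_average[OF fejer_test[OF assms(1)] _ L1D(2)[OF assms(2)]]) simp
  then show ?thesis unfolding integral_fejer[OF assms(1)] by simp
qed

lemma Pi_N_abs_le: "N \<ge> 1 \<Longrightarrow> \<bar>Pi_N N f x\<bar> \<le> Pi_N N (\<lambda>x. \<bar>f x\<bar>) x"
  unfolding Pi_N_def
  using integral_circ_abs_triangle[of "\<lambda>y. fejer N (x - y) * f y"]
  by (simp add: abs_mult fejer_nonneg)

lemma L1_abs: "L1 f \<Longrightarrow> L1 (\<lambda>x. \<bar>f x\<bar>)"
  by (auto simp: L1_def periodic1_def)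

lemma L1_norm_Pi_N:
  assumes "N \<ge> 1" "L1 f"
  shows "L1_norm (Pi_N N f) \<le> L1_norm f"
proof -
  have "L1_norm (Pi_N N f) \<le> (\<integral>x. Pi_N N (\<lambda>x. \<bar>f x\<bar>) x \<partial>circ)"
    unfolding L1_norm_def using assms
    by (intro integral_mono Pi_N_abs_le integrable_abs L1D(2)[OF Pi_N_L1] L1_abs)
  also have "\<dots> = L1_norm f"
    unfolding L1_norm_def by (rule integral_Pi_N[OF assms(1) L1_abs[OF assms(2)]])
  finally show ?thesis .
qed

lemma Pi_N_minus_eq:
  assumes N: "N \<ge> 1" and f: "L1 f" "\<And>x. \<bar>f x\<bar> \<le> B"
  shows "\<bar>Pi_N N f x - f x\<bar> \<le> (\<integral>t. fejer N t * \<bar>f (x + t) - f x\<bar> \<partial>circ)"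
proof -
  have i: "integrable circ (\<lambda>t. fejer N t * f (x + t))"
  proof -
    have "(\<lambda>t. f (x + t)) \<in> borel_measurable borel"
      using measurable_compose[OF _ L1_borel_measurable[OF f(1)], of "\<lambda>t. x + t" borel] by simp
    then have "integrable circ (\<lambda>t. f (x + t) * fejer N t)"
      using f(2) by (intro integrable_mult_bounded[where B = B])
        (auto intro: L1D test_function_L1 fejer_test N)
    then show ?thesis by (simp add: mult.commute)
  qed
  have j: "integrable circ (fejer N)" by (intro L1D test_function_L1 fejer_test N)
  have "Pi_N N f x - f x = (\<integral>t. fejer N t * f (x + t) \<partial>circ) - (\<integral>t. fejer N t \<partial>circ) * f x"
    by (simp add: Pi_N_eq[OF N f(1)] integral_fejer[OF N])
  also have "\<dots> = (\<integral>t. fejer N t * (f (x + t) - f x) \<partial>circ)"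
    using i j by (simp add: right_diff_distrib)
  also have "\<bar>\<dots>\<bar> \<le> (\<integral>t. \<bar>fejer N t * (f (x + t) - f x)\<bar> \<partial>circ)" by (rule integral_circ_abs_triangle)
  finally show ?thesis by (simp add: abs_mult fejer_nonneg[OF N])
qed

text \<open>The fundamental theorem of calculus on a segment of length \<open>t\<close> gives the factor \<open>t\<close>; by periodicity
  the translations by \<open>t\<close> and by \<open>1 - t\<close> move the function by the same amount.\<close>

lemma L1_norm_translate_diff:
  assumes p: "test_function p" and t: "0 \<le> t" "t \<le> 1"
  shows "L1_norm (\<lambda>x. p (x + t) - p x) \<le> min t (1 - t) * L1_norm (deriv p)"
proof -
  note p' = test_function_deriv[OF p]
  obtain B where B: "\<And>x. \<bar>deriv p x\<bar> \<le> B" using test_function_bounded[OF p'] by metis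
  have key: "L1_norm (\<lambda>x. p (x + s) - p x) \<le> s * L1_norm (deriv p)" if s: "0 \<le> s" for s
  proof -
    have ftc: "p (x + s) - p x = (\<integral>r. s * deriv p (x + s * r) \<partial>circ)" for x
    proof -
      have "((\<lambda>r. p (x + s * r)) has_real_derivative s * deriv p (x + s * r)) (at r)" for r
      proof -
        have "((\<lambda>r. x + s * r) has_real_derivative s) (at r)" by (auto intro!: derivative_eq_intros)
        from DERIV_chain2[OF test_function_DERIV[OF p] this] show ?thesis by (simp add: mult.commute)
      qed
      moreover have "continuous_on UNIV (\<lambda>r. s * deriv p (x + s * r))"
        by (intro continuous_intros continuous_on_compose2[OF test_function_continuous[OF p']]) auto
      ultimately show ?thesis using integral_circ_FTC_real by fastforce
    qed
    have m: "(\<lambda>(x, r). \<bar>deriv p (x + s * r)\<bar>) \<in> borel_measurable (circ \<Otimes>\<^sub>M circ)"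
      by (rule measurable_pair_circ_compose[where \<phi> = "\<lambda>x. \<bar>deriv p x\<bar>"])
         (use borel_measurable_abs[OF test_function_measurable[OF p']] in auto)
    have pw: "\<bar>p (x + s) - p x\<bar> \<le> (\<integral>r. \<bar>deriv p (x + s * r)\<bar> * s \<partial>circ)" for x
      unfolding ftc using s integral_circ_abs_triangle[of "\<lambda>r. s * deriv p (x + s * r)"]
      by (simp add: abs_mult mult.commute)
    have ik: "integrable circ (\<lambda>x. \<integral>r. \<bar>deriv p (x + s * r)\<bar> * s \<partial>circ)"
      using circ2.integrable_fst'[OF integrable_kernel[where w = "\<lambda>_. s" and B = B, OF _ m]] B
      by simp
    have "L1_norm (\<lambda>x. p (x + s) - p x) \<le> (\<integral>x. (\<integral>r. \<bar>deriv p (x + s * r)\<bar> * s \<partial>circ) \<partial>circ)"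
      unfolding L1_norm_def using pw ik
      by (intro integral_mono[OF _ ik] integrable_abs L1D L1_diff L1_translate test_function_L1 p)
    also have "\<dots> = (\<integral>r. (\<integral>x. \<bar>deriv p (x + s * r)\<bar> \<partial>circ) * s \<partial>circ)"
      using B by (intro integral_kernel_swap[where B = B] m) auto
    also have "\<dots> = s * L1_norm (deriv p)"
      using L1_norm_translate[OF test_function_L1[OF p']] by (simp add: L1_norm_def mult.commute)
    finally show ?thesis .
  qed
  have "L1_norm (\<lambda>x. p (x + t) - p x) = L1_norm (\<lambda>x. p (x + (1 - t)) - p x)"
  proof -
    have "L1 (\<lambda>x. p (x + t) - p x)" by (intro L1_diff L1_translate test_function_L1 p)
    from L1_norm_translate[OF this, of "1 - t"]
    have "L1_norm (\<lambda>x. p (x + t) - p x) = L1_norm (\<lambda>x. p (x + 1) - p (x + (1 - t)))"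
      by simp
    also have "\<dots> = L1_norm (\<lambda>x. p (x + (1 - t)) - p x)"
      using test_function_periodic[OF p] by (simp add: L1_norm_def periodic1_def abs_minus_commute)
    finally show ?thesis .
  qed
  then show ?thesis using key[of t] key[of "1 - t"] t by (auto simp: min_def)
qed

lemma L1_norm_Pi_N_minus_test:
  assumes N: "N \<ge> 1" and p: "test_function p"
  shows "L1_norm (\<lambda>x. Pi_N N p x - p x) \<le> 1 / sqrt N * L1_norm (deriv p)"
proof -
  obtain B where B: "\<And>x. \<bar>p x\<bar> \<le> B" using test_function_bounded[OF p] by metis
  have pm: "p \<in> borel_measurable borel" by (rule test_function_measurable[OF p])
  have m: "(\<lambda>(x, t). \<bar>p (x + t) - p x\<bar>) \<in> borel_measurable (circ \<Otimes>\<^sub>M circ)"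
    using measurable_pair_circ_compose[OF pm, of "\<lambda>x t. x + t"]
      measurable_pair_circ_compose[OF pm, of "\<lambda>x t. x"] by (auto simp: case_prod_beta')
  have B2: "\<bar>\<bar>p (x + t) - p x\<bar>\<bar> \<le> 2 * B" for x t using B[of x] B[of "x + t"] by linarith
  have K: "integrable circ (fejer N)" by (intro L1D test_function_L1 fejer_test N)
  note sw = K m B2
  have ik: "integrable circ (\<lambda>x. \<integral>t. \<bar>p (x + t) - p x\<bar> * fejer N t \<partial>circ)"
    using circ2.integrable_fst'[OF integrable_kernel[OF sw]] by simp
  have "L1_norm (\<lambda>x. Pi_N N p x - p x) \<le> (\<integral>x. (\<integral>t. \<bar>p (x + t) - p x\<bar> * fejer N t \<partial>circ) \<partial>circ)"
    unfolding L1_norm_def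
  proof (rule integral_mono[OF _ ik])
    show "integrable circ (\<lambda>x. \<bar>Pi_N N p x - p x\<bar>)"
      by (intro integrable_abs L1D L1_diff Pi_N_L1 N test_function_L1 p)
    show "\<bar>Pi_N N p x - p x\<bar> \<le> (\<integral>t. \<bar>p (x + t) - p x\<bar> * fejer N t \<partial>circ)" for x
      using Pi_N_minus_eq[OF N test_function_L1[OF p] B] by (simp add: mult.commute)
  qed
  also have "\<dots> = (\<integral>t. (\<integral>x. \<bar>p (x + t) - p x\<bar> \<partial>circ) * fejer N t \<partial>circ)"
    by (rule integral_kernel_swap[OF sw])
  also have "\<dots> \<le> (\<integral>t. fejer N t * min t (1 - t) * L1_norm (deriv p) \<partial>circ)"
  proof (rule integral_mono)
    show "integrable circ (\<lambda>t. (\<integral>x. \<bar>p (x + t) - p x\<bar> \<partial>circ) * fejer N t)"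
      using circ2.integrable_snd[OF integrable_kernel[OF sw]] by simp
    show "integrable circ (\<lambda>t. fejer N t * min t (1 - t) * L1_norm (deriv p))"
      by (intro integrable_circ_continuous continuous_intros test_function_continuous fejer_test N)
    fix t assume "t \<in> space circ"
    then show "(\<integral>x. \<bar>p (x + t) - p x\<bar> \<partial>circ) * fejer N t \<le> fejer N t * min t (1 - t) * L1_norm (deriv p)"
      using mult_left_mono[OF L1_norm_translate_diff[OF p, of t] fejer_nonneg[OF N, of t]]
      by (simp add: L1_norm_def mult_ac)
  qed
  also have "\<dots> \<le> 1 / sqrt N * L1_norm (deriv p)"
    using mult_right_mono[OF integral_fejer_dist[OF N], of "L1_norm (deriv p)"] by simp
  finally show ?thesis .
qed

subsection \<open>Convergence of the averages in L1\<close>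

text \<open>Near 0 the difference is small by continuity; away from 0 the weight \<open>1 - cos (2 * pi * t)\<close> is
  bounded below, so that a multiple of it dominates the difference.\<close>

lemma Pi_N_tendsto_at_continuity:
  assumes g: "L1 g" "\<And>x. \<bar>g x\<bar> \<le> B" and c: "isCont g x"
  shows "(\<lambda>M. Pi_N (Suc M) g x) \<longlonglongrightarrow> g x"
proof (rule LIMSEQ_I)
  fix r :: real assume r: "0 < r"
  have B: "0 \<le> B" using g(2)[of 0] by linarith
  obtain d where d: "d > 0" "\<And>y. \<bar>y - x\<bar> < d \<Longrightarrow> \<bar>g y - g x\<bar> < r / 2"
    using c r unfolding continuous_at_eps_delta dist_real_def
    by (metis half_gt_zero)
  define A where "A = B / d\<^sup>2"
  have pw: "\<bar>g (x + t) - g x\<bar> \<le> r / 2 + A * (1 - cos (2 * pi * t))" if t: "0 \<le> t" "t \<le> 1" for t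
  proof -
    have A0: "0 \<le> A * (1 - cos (2 * pi * t))" using B by (simp add: A_def)
    consider "t < d" | "1 - t < d" | "d \<le> min t (1 - t)" by linarith
    then show ?thesis
    proof cases
      case 1
      then show ?thesis using d(2)[of "x + t"] t A0 by simp
    next
      case 2
      have "g (x + t) = g (x + t - 1)" using periodic1_minus1[OF L1D(1)[OF g(1)]] by metis
      then show ?thesis using d(2)[of "x + t - 1"] 2 t A0 by simp
    next
      case 3
      have "d\<^sup>2 \<le> (min t (1 - t))\<^sup>2" using 3 d(1) by (intro power_mono) auto
      also have "\<dots> \<le> (1 - cos (2 * pi * t)) / 2" by (rule circle_dist_cos[OF t])
      finally have "2 \<le> (1 - cos (2 * pi * t)) / d\<^sup>2" using d(1) by (simp add: field_simps)
      then have "2 * B \<le> A * (1 - cos (2 * pi * t))"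
        using mult_left_mono[OF _ B] by (fastforce simp: A_def mult.commute)
      then show ?thesis using g(2)[of x] g(2)[of "x + t"] r by linarith
    qed
  qed
  have bd: "\<bar>Pi_N N g x - g x\<bar> \<le> r / 2 + A / N" if N: "N \<ge> 1" for N
  proof -
    note cont = continuous_intros test_function_continuous fejer_test N
    have i1: "integrable circ (\<lambda>t. fejer N t * (r / 2))"
      and i2: "integrable circ (\<lambda>t. A * (fejer N t * (1 - cos (2 * pi * t))))"
      by (intro integrable_circ_continuous cont)+
    have gm: "(\<lambda>t. \<bar>g (x + t) - g x\<bar>) \<in> borel_measurable borel"
      using measurable_compose[OF _ L1_borel_measurable[OF g(1)], of "\<lambda>t. x + t" borel] by simp
    have "\<bar>\<bar>g (x + t) - g x\<bar>\<bar> \<le> 2 * B" for t using g(2)[of x] g(2)[of "x + t"] by linarith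
    then have i3: "integrable circ (\<lambda>t. \<bar>g (x + t) - g x\<bar> * fejer N t)"
      by (intro integrable_mult_bounded[where B = "2 * B"] gm L1D test_function_L1 fejer_test N)
    have "\<bar>Pi_N N g x - g x\<bar> \<le> (\<integral>t. fejer N t * \<bar>g (x + t) - g x\<bar> \<partial>circ)"
      by (rule Pi_N_minus_eq[OF N g])
    also have "\<dots> \<le> (\<integral>t. fejer N t * (r / 2) + A * (fejer N t * (1 - cos (2 * pi * t))) \<partial>circ)"
    proof (rule integral_mono)
      fix t assume "t \<in> space circ"
      then have "fejer N t * \<bar>g (x + t) - g x\<bar> \<le> fejer N t * (r / 2 + A * (1 - cos (2 * pi * t)))"
        by (intro mult_left_mono pw fejer_nonneg N) auto
      then show "fejer N t * \<bar>g (x + t) - g x\<bar> \<le> fejer N t * (r / 2) + A * (fejer N t * (1 - cos (2 * pi * t)))"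
        by (simp add: algebra_simps)
    qed (use i1 i2 i3 in \<open>auto simp: mult.commute\<close>)
    also have "\<dots> = r / 2 + A / N"
      using i1 i2 integral_fejer[OF N] integral_fejer_one_minus_cos[OF N] by simp
    finally show ?thesis .
  qed
  have "(\<lambda>M. A / real (Suc M)) \<longlonglongrightarrow> 0" by (rule LIMSEQ_Suc[OF lim_const_over_n])
  from LIMSEQ_D[OF this, of "r / 2"] r obtain M0 where M0: "\<And>M. M \<ge> M0 \<Longrightarrow> \<bar>A / real (Suc M)\<bar> < r / 2"
    by auto
  show "\<exists>M0. \<forall>M\<ge>M0. norm (Pi_N (Suc M) g x - g x) < r"
  proof (intro exI allI impI)
    fix M assume "M0 \<le> M"
    then have "A / real (Suc M) < r / 2" using M0[of M] by linarith
    moreover have "\<bar>Pi_N (Suc M) g x - g x\<bar> \<le> r / 2 + A / real (Suc M)" by (rule bd) simp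
    ultimately show "norm (Pi_N (Suc M) g x - g x) < r" unfolding real_norm_def by linarith
  qed
qed

lemma L1_norm_Pi_N_tendsto_bounded:
  assumes g: "L1 g" "\<And>x. \<bar>g x\<bar> \<le> B" and c: "AE x in circ. isCont g x"
  shows "(\<lambda>M. L1_norm (\<lambda>x. Pi_N (Suc M) g x - g x)) \<longlonglongrightarrow> 0"
proof -
  have gm: "g \<in> borel_measurable circ" using L1D(2)[OF g(1)] by auto
  have "(\<lambda>M. \<integral>x. \<bar>Pi_N (Suc M) g x - g x\<bar> \<partial>circ) \<longlonglongrightarrow> (\<integral>x. 0 \<partial>circ)"
  proof (rule integral_dominated_convergence[where w = "\<lambda>_. 2 * B"])
    fix M
    show "(\<lambda>x. \<bar>Pi_N (Suc M) g x - g x\<bar>) \<in> borel_measurable circ"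
      using L1D(2)[OF Pi_N_L1[OF _ g(1), of "Suc M"]] gm by auto
    have "\<bar>Pi_N (Suc M) g x\<bar> \<le> B" for x
    proof -
      have m: "(\<lambda>t. g (x + t)) \<in> borel_measurable borel"
        using measurable_compose[OF _ L1_borel_measurable[OF g(1)], of "\<lambda>t. x + t" borel] by simp
      have "\<bar>\<integral>t. g (x + t) * fejer (Suc M) t \<partial>circ\<bar> \<le> B * L1_norm (fejer (Suc M))"
        by (intro integral_mult_le_sup m g L1D test_function_L1 fejer_test) simp
      then show ?thesis
        by (simp add: Pi_N_eq[OF _ g(1)] L1_norm_def fejer_nonneg integral_fejer mult.commute)
    qed
    then have "\<bar>Pi_N (Suc M) g x - g x\<bar> \<le> 2 * B" for x
      using g(2)[of x] by (smt (verit))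
    then show "AE x in circ. norm \<bar>Pi_N (Suc M) g x - g x\<bar> \<le> 2 * B" by simp
  next
    show "AE x in circ. (\<lambda>M. \<bar>Pi_N (Suc M) g x - g x\<bar>) \<longlonglongrightarrow> 0"
      using c
    proof eventually_elim
      case (elim x)
      show ?case
        using tendsto_rabs[OF tendsto_diff[OF Pi_N_tendsto_at_continuity[OF g elim] tendsto_const[of "g x"]]]
        by simp
    qed
  qed auto
  then show ?thesis by (simp add: L1_norm_def)
qed

text \<open>A measurable function is an almost everywhere limit of continuous ones, and truncation makes the
  convergence dominated. Making the approximants periodic may introduce a jump at the integers only,
  which is why continuity is asked for almost everywhere.\<close>

lemma L1_approx_ae_continuous:
  assumes f: "L1 f" and r: "r > 0"
  obtains g B where "L1 g" "\<And>x. \<bar>g x\<bar> \<le> B" "AE x in circ. isCont g x"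
    "L1_norm (\<lambda>x. f x - g x) < r"
proof -
  define cl where "cl m y = max (- real m) (min (real m) y)" for m y
  have cl_bd: "\<bar>cl m y\<bar> \<le> m" for m y by (simp add: cl_def)
  have cl_cont: "continuous_on UNIV (cl m)" for m
    unfolding cl_def by (intro continuous_intros)
  then have cl_isCont: "isCont (cl m) y" for m y
    by (simp add: continuous_on_eq_continuous_at)
  have clm[measurable]: "cl m \<in> borel_measurable borel" for m
    by (rule borel_measurable_continuous_onI[OF cl_cont])
  have fm[measurable]: "f \<in> borel_measurable borel" by (rule L1_borel_measurable[OF f])
  have fc: "f \<in> borel_measurable circ" by (rule borel_measurable_circ[OF fm])
  have "(\<lambda>m. \<integral>x. \<bar>f x - cl m (f x)\<bar> \<partial>circ) \<longlonglongrightarrow> (\<integral>x. 0 \<partial>circ)"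
  proof (rule integral_dominated_convergence[where w = "\<lambda>x. \<bar>f x\<bar>"])
    show "AE x in circ. (\<lambda>m. \<bar>f x - cl m (f x)\<bar>) \<longlonglongrightarrow> 0"
    proof (rule AE_I2, rule tendsto_eventually)
      fix x
      obtain m0 :: nat where "\<bar>f x\<bar> \<le> m0" using real_arch_simple by blast
      then show "\<forall>\<^sub>F m in sequentially. \<bar>f x - cl m (f x)\<bar> = 0"
        unfolding eventually_sequentially
        by (intro exI[of _ m0]) (auto simp: cl_def max_def min_def)
    qed
    show "AE x in circ. norm \<bar>f x - cl m (f x)\<bar> \<le> \<bar>f x\<bar>" for m
      by (rule AE_I2) (auto simp: cl_def max_def min_def)
    show "(\<lambda>x. \<bar>f x - cl m (f x)\<bar>) \<in> borel_measurable circ" for m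
      by (intro borel_measurable_circ) measurable
  qed (use L1D[OF f] in auto)
  then have "\<forall>\<^sub>F m in sequentially. (\<integral>x. \<bar>f x - cl m (f x)\<bar> \<partial>circ) < r / 2"
    by (rule order_tendstoD) (use r in simp)
  then obtain m where m: "(\<integral>x. \<bar>f x - cl m (f x)\<bar> \<partial>circ) < r / 2"
    using eventually_happens'[OF sequentially_bot] by blast
  have "f \<in> borel_measurable (lebesgue_on UNIV)"
    using fm by (simp add: lebesgue_on_UNIV_eq measurable_completion)
  then have "f measurable_on UNIV" by (subst measurable_on_iff_borel_measurable) auto
  then obtain Z G where Z: "negligible Z" and G: "\<And>n. continuous_on UNIV (G n :: real \<Rightarrow> real)"
    "\<And>x. x \<notin> Z \<Longrightarrow> (\<lambda>n. G n x) \<longlonglongrightarrow> f x"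
    unfolding measurable_on_def by auto
  have Gm[measurable]: "G n \<in> borel_measurable borel" for n
    by (rule borel_measurable_continuous_onI[OF G(1)])
  have "AE x in lebesgue. x \<notin> Z" using Z by (simp add: negligible_iff_null_sets AE_not_in)
  then have "AE x in lborel. x \<notin> Z" by (simp add: AE_completion_iff)
  then have ZA: "AE x in circ. x \<notin> Z"
    unfolding circ_def by (subst AE_restrict_space_iff) auto
  have "(\<lambda>n. \<integral>x. \<bar>cl m (f x) - cl m (G n x)\<bar> \<partial>circ) \<longlonglongrightarrow> (\<integral>x. 0 \<partial>circ)"
  proof (rule integral_dominated_convergence[where w = "\<lambda>x. 2 * real m"])
    show "AE x in circ. (\<lambda>n. \<bar>cl m (f x) - cl m (G n x)\<bar>) \<longlonglongrightarrow> 0"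
      using ZA
    proof eventually_elim
      case (elim x)
      have "(\<lambda>n. cl m (G n x)) \<longlonglongrightarrow> cl m (f x)"
        by (rule isCont_tendsto_compose[OF cl_isCont G(2)[OF elim]])
      from tendsto_rabs[OF tendsto_diff[OF tendsto_const[of "cl m (f x)"] this]] show ?case by simp
    qed
    show "AE x in circ. norm \<bar>cl m (f x) - cl m (G n x)\<bar> \<le> 2 * real m" for n
    proof (rule AE_I2)
      fix x show "norm \<bar>cl m (f x) - cl m (G n x)\<bar> \<le> 2 * real m"
        unfolding real_norm_def using cl_bd[of m "f x"] cl_bd[of m "G n x"] by linarith
    qed
    show "(\<lambda>x. \<bar>cl m (f x) - cl m (G n x)\<bar>) \<in> borel_measurable circ" for n
      by (intro borel_measurable_circ borel_measurable_abs borel_measurable_diff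
          measurable_compose[OF fm clm] measurable_compose[OF Gm clm])
  qed auto
  then have "\<forall>\<^sub>F n in sequentially. (\<integral>x. \<bar>cl m (f x) - cl m (G n x)\<bar> \<partial>circ) < r / 2"
    by (rule order_tendstoD) (use r in simp)
  then obtain n where n: "(\<integral>x. \<bar>cl m (f x) - cl m (G n x)\<bar> \<partial>circ) < r / 2"
    using eventually_happens'[OF sequentially_bot] by blast
  define g where "g x = cl m (G n (frac x))" for x
  have gm: "g \<in> borel_measurable borel"
    unfolding g_def
    using measurable_compose[OF frac_measurable borel_measurable_circ[OF measurable_compose[OF Gm clm]]] .
  have gb: "\<bar>g x\<bar> \<le> m" for x unfolding g_def by (rule cl_bd)
  have gL: "L1 g"
    by (rule L1_bounded[OF _ gm gb]) (simp add: periodic1_def g_def frac_1_eq)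
  have "continuous_on {0<..<1} g"
  proof -
    have "continuous_on {0<..<1} (\<lambda>x. cl m (G n x))"
      by (rule continuous_on_compose2[OF cl_cont continuous_on_subset[OF G(1)]]) auto
    then show ?thesis by (rule continuous_on_eq) (simp add: g_def frac_eq)
  qed
  then have gc: "isCont g x" if "0 < x" "x < 1" for x
    using that by (simp add: continuous_on_eq_continuous_at)
  have "AE x in circ. x \<noteq> 0"
    using AE_lborel_singleton[of "0::real"] unfolding circ_def
    by (subst AE_restrict_space_iff) auto
  then have gA: "AE x in circ. isCont g x"
    using AE_space by eventually_elim (auto intro: gc)
  have geq: "g x = cl m (G n x)" if "x \<in> space circ" for x
    using that by (simp add: g_def frac_eq)
  have "L1_norm (\<lambda>x. f x - g x) = (\<integral>x. \<bar>f x - cl m (G n x)\<bar> \<partial>circ)"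
    unfolding L1_norm_def using geq by (intro Bochner_Integration.integral_cong) auto
  also have "\<dots> \<le> (\<integral>x. \<bar>f x - cl m (f x)\<bar> + \<bar>cl m (f x) - cl m (G n x)\<bar> \<partial>circ)"
  proof (rule integral_mono)
    have bi: "integrable circ (\<lambda>x. cl m (h x))" if "h \<in> borel_measurable borel" for h
      using that cl_bd by (intro integrable_circ_bounded[where B = m]) auto
    show "integrable circ (\<lambda>x. \<bar>f x - cl m (G n x)\<bar>)"
      "integrable circ (\<lambda>x. \<bar>f x - cl m (f x)\<bar> + \<bar>cl m (f x) - cl m (G n x)\<bar>)"
      using bi[OF fm] bi[OF Gm] L1D(2)[OF f] by auto
  qed auto
  also have "\<dots> = (\<integral>x. \<bar>f x - cl m (f x)\<bar> \<partial>circ) + (\<integral>x. \<bar>cl m (f x) - cl m (G n x)\<bar> \<partial>circ)"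
  proof (rule Bochner_Integration.integral_add)
    have bi: "integrable circ (\<lambda>x. cl m (h x))" if "h \<in> borel_measurable borel" for h
      using that cl_bd by (intro integrable_circ_bounded[where B = m]) auto
    show "integrable circ (\<lambda>x. \<bar>f x - cl m (f x)\<bar>)"
      "integrable circ (\<lambda>x. \<bar>cl m (f x) - cl m (G n x)\<bar>)"
      using bi[OF fm] bi[OF Gm] L1D(2)[OF f] by auto
  qed
  also have "\<dots> < r" using m n by linarith
  finally show ?thesis using that gL gb gA by blast
qed

text \<open>Averaging is a contraction in \<open>L\<^sup>1\<close>, so convergence passes from a dense set to the whole space.\<close>

lemma L1_norm_Pi_N_tendsto:
  assumes f: "L1 f"
  shows "(\<lambda>M. L1_norm (\<lambda>x. Pi_N (Suc M) f x - f x)) \<longlonglongrightarrow> 0"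
proof (rule LIMSEQ_I)
  fix r :: real assume r: "0 < r"
  obtain g B where g: "L1 g" "\<And>x. \<bar>g x\<bar> \<le> B" "AE x in circ. isCont g x"
    and fg: "L1_norm (\<lambda>x. f x - g x) < r / 3"
    using L1_approx_ae_continuous[OF f, of "r / 3"] r by auto
  from LIMSEQ_D[OF L1_norm_Pi_N_tendsto_bounded[OF g], of "r / 3"] r obtain M0
    where M0: "\<And>M. M \<ge> M0 \<Longrightarrow> L1_norm (\<lambda>x. Pi_N (Suc M) g x - g x) < r / 3" by auto
  show "\<exists>M0. \<forall>M\<ge>M0. norm (L1_norm (\<lambda>x. Pi_N (Suc M) f x - f x) - 0) < r"
  proof (intro exI allI impI)
    fix M assume M: "M0 \<le> M"
    have d: "L1 (\<lambda>x. f x - g x)" by (rule L1_diff[OF f g(1)])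
    have "L1_norm (\<lambda>x. Pi_N (Suc M) f x - f x)
        = L1_norm (\<lambda>x. (Pi_N (Suc M) (\<lambda>x. f x - g x) x + (Pi_N (Suc M) g x - g x)) - (f x - g x))"
      by (simp add: Pi_N_diff f g(1))
    also have "\<dots> \<le> L1_norm (\<lambda>x. Pi_N (Suc M) (\<lambda>x. f x - g x) x + (Pi_N (Suc M) g x - g x))
        + L1_norm (\<lambda>x. f x - g x)"
      by (intro L1_norm_diff L1_add L1_diff Pi_N_L1 d f g(1)) auto
    also have "\<dots> \<le> (L1_norm (Pi_N (Suc M) (\<lambda>x. f x - g x)) + L1_norm (\<lambda>x. Pi_N (Suc M) g x - g x))
        + L1_norm (\<lambda>x. f x - g x)"
      by (intro add_right_mono L1_norm_add L1_diff Pi_N_L1 d g(1)) auto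
    also have "\<dots> < r"
      using L1_norm_Pi_N[OF _ d, of "Suc M"] fg M0[OF M] by simp
    finally show "norm (L1_norm (\<lambda>x. Pi_N (Suc M) f x - f x) - 0) < r" by simp
  qed
qed

section \<open>Weak derivatives and Sobolev norms\<close>

lemma test_function_reflect:
  assumes "test_function \<phi>"
  shows "test_function (\<lambda>y. \<phi> (x - y))"
    and "(deriv ^^ j) (\<lambda>y. \<phi> (x - y)) = (\<lambda>y. (-1) ^ j * (deriv ^^ j) \<phi> (x - y))"
proof -
  define X where "X = {(\<lambda>y. a * \<psi> (x - y)) | a \<psi>. test_function \<psi>}"
  have der: "((\<lambda>y. a * \<psi> (x - y)) has_real_derivative (- a) * deriv \<psi> (x - y)) (at y)"
    if "test_function \<psi>" for a \<psi> y
  proof -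
    have "((\<lambda>y. x - y) has_real_derivative - 1) (at y)" by (auto intro!: derivative_eq_intros)
    from DERIV_cmult[OF DERIV_chain2[OF test_function_DERIV[OF that] this], of a] show ?thesis by simp
  qed
  show "test_function (\<lambda>y. \<phi> (x - y))"
  proof (rule test_functionI[where X = X])
    show "(\<lambda>y. \<phi> (x - y)) \<in> X" unfolding X_def using assms
      by (auto intro!: exI[of _ 1] exI[of _ \<phi>])
  next
    fix f assume "f \<in> X"
    then obtain a \<psi> where f: "f = (\<lambda>y. a * \<psi> (x - y))" and \<psi>: "test_function \<psi>"
      unfolding X_def by blast
    have "\<psi> (x - (y + 1)) = \<psi> (x - y)" for y
      using periodic1_minus1[OF test_function_periodic[OF \<psi>], of "x - y"] by (simp add: algebra_simps)
    then show "periodic1 f" by (simp add: f periodic1_def)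
    show "\<exists>f'\<in>X. \<forall>y. (f has_real_derivative f' y) (at y)"
    proof
      show "(\<lambda>y. (- a) * deriv \<psi> (x - y)) \<in> X"
        unfolding X_def using test_function_deriv[OF \<psi>] by blast
      show "\<forall>y. (f has_real_derivative (- a) * deriv \<psi> (x - y)) (at y)"
        unfolding f using der[OF \<psi>] by blast
    qed
  qed
  show "(deriv ^^ j) (\<lambda>y. \<phi> (x - y)) = (\<lambda>y. (-1) ^ j * (deriv ^^ j) \<phi> (x - y))"
  proof (induction j)
    case (Suc j)
    have "deriv (\<lambda>y. (-1) ^ j * (deriv ^^ j) \<phi> (x - y)) y = - ((-1) ^ j) * deriv ((deriv ^^ j) \<phi>) (x - y)" for y
      by (rule DERIV_imp_deriv[OF der[OF test_function_funpow[OF assms]]])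
    then show ?case by (simp add: Suc fun_eq_iff)
  qed simp
qed

text \<open>A function orthogonal to all test functions has vanishing Fejer averages, which converge to it.\<close>

lemma AE_zero_if_orthogonal_test_functions:
  assumes u: "L1 u" and z: "\<And>\<phi>. test_function \<phi> \<Longrightarrow> (\<integral>x. u x * \<phi> x \<partial>circ) = 0"
  shows "AE x in circ. u x = 0"
proof -
  have "Pi_N (Suc M) u x = 0" for M x
    unfolding Pi_N_def
    using z[OF test_function_reflect(1)[OF fejer_test[of "Suc M"], of x]] by (simp add: mult.commute)
  then have "(\<lambda>M. L1_norm u) \<longlonglongrightarrow> 0"
    using L1_norm_Pi_N_tendsto[OF u] by (simp add: L1_norm_def)
  then show ?thesis using L1_norm_eq_0[OF u] by (simp add: LIMSEQ_const_iff)
qed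

lemma integrable_mult_test:
  assumes "integrable circ f" "test_function \<phi>"
  shows "integrable circ (\<lambda>x. f x * \<phi> x)"
proof -
  obtain B where "\<And>x. \<bar>\<phi> x\<bar> \<le> B" using test_function_bounded[OF assms(2)] by metis
  then have "integrable circ (\<lambda>x. \<phi> x * f x)"
    by (intro integrable_mult_bounded[where B = B] assms test_function_measurable)
  then show ?thesis by (simp add: mult.commute)
qed

lemma has_weak_deriv_L1: "has_weak_deriv j f u \<Longrightarrow> L1 u"
  by (simp add: has_weak_deriv_def)

lemma has_weak_derivD:
  "has_weak_deriv j f u \<Longrightarrow> test_function \<phi> \<Longrightarrow>
    (\<integral>x. f x * (deriv ^^ j) \<phi> x \<partial>circ) = (-1) ^ j * (\<integral>x. u x * \<phi> x \<partial>circ)"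
  by (simp add: has_weak_deriv_def)

lemma has_weak_deriv_unique:
  assumes u: "has_weak_deriv j f u" and v: "has_weak_deriv j f v"
  shows "AE x in circ. u x = v x"
proof -
  note L = has_weak_deriv_L1[OF u] has_weak_deriv_L1[OF v]
  have "AE x in circ. u x - v x = 0"
  proof (rule AE_zero_if_orthogonal_test_functions[OF L1_diff[OF L]])
    fix \<phi> assume \<phi>: "test_function \<phi>"
    have "(-1) ^ j * (\<integral>x. u x * \<phi> x \<partial>circ) = (-1) ^ j * (\<integral>x. v x * \<phi> x \<partial>circ)"
      using has_weak_derivD[OF u \<phi>] has_weak_derivD[OF v \<phi>] by simp
    then have "(\<integral>x. u x * \<phi> x \<partial>circ) = (\<integral>x. v x * \<phi> x \<partial>circ)" by simp
    then show "(\<integral>x. (u x - v x) * \<phi> x \<partial>circ) = 0"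
      using integrable_mult_test[OF L1D(2)[OF L(1)] \<phi>] integrable_mult_test[OF L1D(2)[OF L(2)] \<phi>]
      by (simp add: left_diff_distrib)
  qed
  then show ?thesis by simp
qed

lemma has_weak_deriv_weak_deriv: "has_weak_deriv j f u \<Longrightarrow> has_weak_deriv j f (weak_deriv j f)"
  unfolding weak_deriv_def by (rule someI[where P = "has_weak_deriv j f"])

lemma L1_norm_weak_deriv: "has_weak_deriv j f u \<Longrightarrow> L1_norm (weak_deriv j f) = L1_norm u"
  by (rule L1_norm_cong_AE[OF has_weak_deriv_L1[OF has_weak_deriv_weak_deriv] has_weak_deriv_L1
      has_weak_deriv_unique[OF has_weak_deriv_weak_deriv]])

lemma has_weak_deriv_diff:
  assumes f: "L1 f" "has_weak_deriv j f u" and g: "L1 g" "has_weak_deriv j g v"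
  shows "has_weak_deriv j (\<lambda>x. f x - g x) (\<lambda>x. u x - v x)"
  unfolding has_weak_deriv_def
proof (intro conjI allI impI)
  note L = has_weak_deriv_L1[OF f(2)] has_weak_deriv_L1[OF g(2)]
  show "L1 (\<lambda>x. u x - v x)" by (rule L1_diff[OF L])
  fix \<phi> assume \<phi>: "test_function \<phi>"
  note \<phi>' = test_function_funpow[OF \<phi>, of j]
  show "(\<integral>x. (f x - g x) * (deriv ^^ j) \<phi> x \<partial>circ) = (-1) ^ j * (\<integral>x. (u x - v x) * \<phi> x \<partial>circ)"
    using integrable_mult_test[OF L1D(2)[OF L(1)] \<phi>] integrable_mult_test[OF L1D(2)[OF L(2)] \<phi>]
      integrable_mult_test[OF L1D(2)[OF f(1)] \<phi>'] integrable_mult_test[OF L1D(2)[OF g(1)] \<phi>']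
      has_weak_derivD[OF f(2) \<phi>] has_weak_derivD[OF g(2) \<phi>]
    by (simp add: left_diff_distrib right_diff_distrib)
qed

lemma has_weak_deriv_cmult:
  assumes "has_weak_deriv j f u"
  shows "has_weak_deriv j (\<lambda>x. c * f x) (\<lambda>x. c * u x)"
  unfolding has_weak_deriv_def
proof (intro conjI allI impI)
  show "L1 (\<lambda>x. c * u x)" by (intro L1_cmult has_weak_deriv_L1[OF assms])
  fix \<phi> assume "test_function \<phi>"
  from has_weak_derivD[OF assms this]
  show "(\<integral>x. c * f x * (deriv ^^ j) \<phi> x \<partial>circ) = (-1) ^ j * (\<integral>x. c * u x * \<phi> x \<partial>circ)"
    by (simp add: mult.assoc)
qed

lemma has_weak_deriv_cong_AE:
  assumes f: "L1 f" and g: "L1 g" and ae: "AE x in circ. f x = g x" and w: "has_weak_deriv j f u"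
  shows "has_weak_deriv j g u"
  unfolding has_weak_deriv_def
proof (intro conjI allI impI)
  show "L1 u" by (rule has_weak_deriv_L1[OF w])
  fix \<phi> assume \<phi>: "test_function \<phi>"
  note \<phi>' = test_function_funpow[OF \<phi>, of j]
  have "(\<integral>x. g x * (deriv ^^ j) \<phi> x \<partial>circ) = (\<integral>x. f x * (deriv ^^ j) \<phi> x \<partial>circ)"
    using integrable_mult_test[OF L1D(2)[OF f] \<phi>'] integrable_mult_test[OF L1D(2)[OF g] \<phi>'] ae
    by (intro integral_cong_AE) auto
  then show "(\<integral>x. g x * (deriv ^^ j) \<phi> x \<partial>circ) = (-1) ^ j * (\<integral>x. u x * \<phi> x \<partial>circ)"
    using has_weak_derivD[OF w \<phi>] by simp
qed

lemma has_weak_deriv_of_weak_deriv: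
  assumes u: "has_weak_deriv i f u" and v: "has_weak_deriv (j + i) f v"
  shows "has_weak_deriv j u v"
  unfolding has_weak_deriv_def
proof (intro conjI allI impI)
  show "L1 v" by (rule has_weak_deriv_L1[OF v])
  fix \<phi> assume \<phi>: "test_function \<phi>"
  have "(deriv ^^ i) ((deriv ^^ j) \<phi>) = (deriv ^^ (j + i)) \<phi>"
    by (simp add: funpow_add add.commute[of j i])
  then have "(-1) ^ i * (\<integral>x. u x * (deriv ^^ j) \<phi> x \<partial>circ) = (-1) ^ (j + i) * (\<integral>x. v x * \<phi> x \<partial>circ)"
    using has_weak_derivD[OF u test_function_funpow[OF \<phi>, of j]] has_weak_derivD[OF v \<phi>] by simp
  then show "(\<integral>x. u x * (deriv ^^ j) \<phi> x \<partial>circ) = (-1) ^ j * (\<integral>x. v x * \<phi> x \<partial>circ)"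
    by (simp add: power_add)
qed

text \<open>Integration by parts on the circle has no boundary terms, by periodicity.\<close>

lemma has_weak_deriv_classical:
  assumes per: "\<And>i. i \<le> k \<Longrightarrow> periodic1 (p i)"
    and cont: "\<And>i. i \<le> k \<Longrightarrow> continuous_on UNIV (p i)"
    and der: "\<And>i x. i < k \<Longrightarrow> (p i has_real_derivative p (Suc i) x) (at x)"
    and j: "j \<le> k"
  shows "has_weak_deriv j (p 0) (p j)"
  using j
proof (induction j)
  case 0
  then show ?case using L1_continuous[OF per cont] by (simp add: has_weak_deriv_def)
next
  case (Suc j)
  show ?case
    unfolding has_weak_deriv_def
  proof (intro conjI allI impI)
    show "L1 (p (Suc j))" using Suc.prems by (intro L1_continuous per cont)
    fix \<phi> assume \<phi>: "test_function \<phi>"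
    note \<phi>' = test_function_deriv[OF \<phi>]
    have i1: "integrable circ (\<lambda>x. p (Suc j) x * \<phi> x)" and i2: "integrable circ (\<lambda>x. p j x * deriv \<phi> x)"
      using Suc.prems
      by (intro integrable_circ_continuous continuous_on_mult cont test_function_continuous[OF \<phi>]
          test_function_continuous[OF \<phi>']; simp)+
    have "(\<integral>x. p (Suc j) x * \<phi> x + p j x * deriv \<phi> x \<partial>circ) = p j 1 * \<phi> 1 - p j 0 * \<phi> 0"
    proof (rule integral_circ_FTC_real)
      show "((\<lambda>x. p j x * \<phi> x) has_real_derivative p (Suc j) x * \<phi> x + p j x * deriv \<phi> x) (at x)" for x
        using DERIV_mult[OF der test_function_DERIV[OF \<phi>]] Suc.prems by (simp add: mult.commute add.commute)
      show "continuous_on UNIV (\<lambda>x. p (Suc j) x * \<phi> x + p j x * deriv \<phi> x)"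
        using Suc.prems by (intro continuous_intros cont test_function_continuous \<phi> \<phi>') auto
    qed
    also have "\<dots> = 0"
      using per[of j] test_function_periodic[OF \<phi>] Suc.prems unfolding periodic1_def
      by (metis Suc_leD add_0 diff_self)
    finally have "(\<integral>x. p j x * deriv \<phi> x \<partial>circ) = - (\<integral>x. p (Suc j) x * \<phi> x \<partial>circ)"
      using i1 i2 by simp
    moreover have "(\<integral>x. p 0 x * (deriv ^^ j) (deriv \<phi>) x \<partial>circ) = (-1) ^ j * (\<integral>x. p j x * deriv \<phi> x \<partial>circ)"
      using Suc by (intro has_weak_derivD \<phi>') auto
    ultimately show "(\<integral>x. p 0 x * (deriv ^^ Suc j) \<phi> x \<partial>circ) = (-1) ^ Suc j * (\<integral>x. p (Suc j) x * \<phi> x \<partial>circ)"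
      by (simp add: funpow_swap1)
  qed
qed

lemma test_function_has_weak_deriv:
  assumes "test_function f"
  shows "has_weak_deriv j f ((deriv ^^ j) f)"
  using has_weak_deriv_classical[of j "\<lambda>i. (deriv ^^ i) f" j] test_function_funpow[OF assms]
  by (auto intro: test_function_periodic test_function_continuous test_function_DERIV)

lemma sobolev_L1: "sobolev i f \<Longrightarrow> L1 f"
  by (simp add: sobolev_def)

lemma sobolev_has_weak_deriv:
  "sobolev i f \<Longrightarrow> 1 \<le> j \<Longrightarrow> j \<le> i \<Longrightarrow> has_weak_deriv j f (weak_deriv j f)"
  unfolding sobolev_def using has_weak_deriv_weak_deriv by fastforce

lemma sobolevI: "L1 f \<Longrightarrow> (\<And>j. 1 \<le> j \<Longrightarrow> j \<le> i \<Longrightarrow> has_weak_deriv j f (u j)) \<Longrightarrow> sobolev i f"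
  unfolding sobolev_def by fastforce

lemma sobolev_norm_eq:
  "(\<And>j. 1 \<le> j \<Longrightarrow> j \<le> i \<Longrightarrow> has_weak_deriv j f (u j)) \<Longrightarrow>
    sobolev_norm i f = L1_norm f + (\<Sum>j=1..i. L1_norm (u j))"
  unfolding sobolev_norm_def
  by (intro arg_cong2[where f = "(+)"] refl sum.cong L1_norm_weak_deriv) auto

lemma sobolev_norm_nonneg [simp]: "0 \<le> sobolev_norm i f"
  by (simp add: sobolev_norm_def sum_nonneg)

lemma L1_norm_le_sobolev_norm: "L1_norm f \<le> sobolev_norm i f"
  by (simp add: sobolev_norm_def sum_nonneg)

lemma sobolev_norm_mono: "i \<le> j \<Longrightarrow> sobolev_norm i f \<le> sobolev_norm j f"
  unfolding sobolev_norm_def by (intro add_left_mono sum_mono2) auto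

lemma sobolev_mono: "sobolev j f \<Longrightarrow> i \<le> j \<Longrightarrow> sobolev i f"
  by (auto simp: sobolev_def)

lemma
  assumes "sobolev i f" "sobolev i g"
  shows sobolev_diff: "sobolev i (\<lambda>x. f x - g x)"
    and sobolev_norm_diff: "sobolev_norm i (\<lambda>x. f x - g x) \<le> sobolev_norm i f + sobolev_norm i g"
proof -
  have w: "has_weak_deriv j (\<lambda>x. f x - g x) (\<lambda>x. weak_deriv j f x - weak_deriv j g x)"
    if "1 \<le> j" "j \<le> i" for j
    using assms that by (intro has_weak_deriv_diff sobolev_L1 sobolev_has_weak_deriv)
  show "sobolev i (\<lambda>x. f x - g x)"
    by (rule sobolevI[OF L1_diff w]) (use assms sobolev_L1 in auto)
  have "sobolev_norm i (\<lambda>x. f x - g x)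
      = L1_norm (\<lambda>x. f x - g x) + (\<Sum>j=1..i. L1_norm (\<lambda>x. weak_deriv j f x - weak_deriv j g x))"
    by (rule sobolev_norm_eq[OF w])
  also have "\<dots> \<le> (L1_norm f + L1_norm g) + (\<Sum>j=1..i. L1_norm (weak_deriv j f) + L1_norm (weak_deriv j g))"
    using assms
    by (intro add_mono L1_norm_diff sum_mono sobolev_L1 has_weak_deriv_L1[OF sobolev_has_weak_deriv]) auto
  also have "\<dots> = sobolev_norm i f + sobolev_norm i g"
    by (simp add: sobolev_norm_def sum.distrib)
  finally show "sobolev_norm i (\<lambda>x. f x - g x) \<le> sobolev_norm i f + sobolev_norm i g" .
qed

lemma
  assumes "sobolev i f"
  shows sobolev_cmult: "sobolev i (\<lambda>x. c * f x)"
    and sobolev_norm_cmult: "sobolev_norm i (\<lambda>x. c * f x) = \<bar>c\<bar> * sobolev_norm i f"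
proof -
  have w: "has_weak_deriv j (\<lambda>x. c * f x) (\<lambda>x. c * weak_deriv j f x)" if "1 \<le> j" "j \<le> i" for j
    using assms that by (intro has_weak_deriv_cmult sobolev_has_weak_deriv)
  show "sobolev i (\<lambda>x. c * f x)"
    by (rule sobolevI[OF L1_cmult w]) (use assms sobolev_L1 in auto)
  show "sobolev_norm i (\<lambda>x. c * f x) = \<bar>c\<bar> * sobolev_norm i f"
    by (subst sobolev_norm_eq[OF w]) (simp_all add: sobolev_norm_def L1_norm_cmult sum_distrib_left distrib_left)
qed

lemma
  assumes "sobolev i f" "sobolev i g"
  shows sobolev_add: "sobolev i (\<lambda>x. f x + g x)"
    and sobolev_norm_add: "sobolev_norm i (\<lambda>x. f x + g x) \<le> sobolev_norm i f + sobolev_norm i g"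
  using sobolev_diff[OF assms(1) sobolev_cmult[OF assms(2), of "- 1"]]
    sobolev_norm_diff[OF assms(1) sobolev_cmult[OF assms(2), of "- 1"]]
    sobolev_norm_cmult[OF assms(2), of "- 1"] by simp_all

lemma sobolev_norm_cong_AE:
  assumes f: "sobolev i f" and g: "L1 g" and ae: "AE x in circ. f x = g x"
  shows "sobolev_norm i g = sobolev_norm i f"
proof -
  have w: "has_weak_deriv j g (weak_deriv j f)" if "1 \<le> j" "j \<le> i" for j
    using f that by (intro has_weak_deriv_cong_AE[OF sobolev_L1[OF f] g ae] sobolev_has_weak_deriv)
  show ?thesis
    using L1_norm_cong_AE[OF sobolev_L1[OF f] g ae]
    by (subst sobolev_norm_eq[OF w]) (simp_all add: sobolev_norm_def)
qed

lemma sobolev_test_function: "test_function f \<Longrightarrow> sobolev i f"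
  by (rule sobolevI[OF test_function_L1 test_function_has_weak_deriv])

lemma sobolev_F_space: "f \<in> F_space N \<Longrightarrow> sobolev i f"
  by (intro sobolev_test_function F_space_test_function)

lemma sobolev_weak_deriv:
  assumes "sobolev (i + j) f" "1 \<le> j"
  shows "sobolev i (weak_deriv j f)"
    and "sobolev_norm i (weak_deriv j f) \<le> sobolev_norm (i + j) f"
proof -
  have w: "has_weak_deriv k (weak_deriv j f) (weak_deriv (k + j) f)" if "1 \<le> k" "k \<le> i" for k
    by (rule has_weak_deriv_of_weak_deriv[where i = j and f = f])
       (use assms that in \<open>auto intro!: sobolev_has_weak_deriv[OF assms(1)]\<close>)
  have L: "L1 (weak_deriv j f)"
    using assms by (intro has_weak_deriv_L1[OF sobolev_has_weak_deriv]) auto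
  show "sobolev i (weak_deriv j f)" by (rule sobolevI[OF L w])
  have "sobolev_norm i (weak_deriv j f) = L1_norm (weak_deriv j f) + (\<Sum>k=1..i. L1_norm (weak_deriv (k + j) f))"
    by (rule sobolev_norm_eq[OF w])
  also have "\<dots> = (\<Sum>k=0..i. L1_norm (weak_deriv (k + j) f))"
    by (simp add: sum.atLeast_Suc_atMost[of 0 i])
  also have "\<dots> = (\<Sum>k\<in>(\<lambda>k. k + j) ` {0..i}. L1_norm (weak_deriv k f))"
    by (subst sum.reindex) (simp_all add: o_def del: image_add_atLeastAtMost')
  also have "\<dots> \<le> (\<Sum>k=1..i+j. L1_norm (weak_deriv k f))"
    using assms(2) by (intro sum_mono2) auto
  also have "\<dots> \<le> sobolev_norm (i + j) f" by (simp add: sobolev_norm_def)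
  finally show "sobolev_norm i (weak_deriv j f) \<le> sobolev_norm (i + j) f" .
qed

text \<open>On a fixed space of trigonometric polynomials the Sobolev norms are equivalent to the \<open>L\<^sup>1\<close>
  norm. This makes every estimate for Newton's method a matter of the \<open>L\<^sup>1\<close> norm, at the price of
  constants that depend on \<open>N\<close>.\<close>

lemma F_space_sobolev_norm_bound:
  "\<exists>C\<ge>0. \<forall>f\<in>F_space N. sobolev_norm i f \<le> C * L1_norm f"
proof -
  obtain C where C: "C \<ge> 0" "\<forall>f\<in>F_space N. L1_norm (deriv f) \<le> C * L1_norm f"
    using F_space_deriv_L1_bound by blast
  have pow: "L1_norm ((deriv ^^ j) f) \<le> C ^ j * L1_norm f" if f: "f \<in> F_space N" for f j
  proof (induction j)
    case (Suc j)
    have "L1_norm ((deriv ^^ Suc j) f) \<le> C * L1_norm ((deriv ^^ j) f)"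
      using C(2) F_space_funpow_deriv[OF f] by simp
    also have "\<dots> \<le> C * (C ^ j * L1_norm f)" using Suc C(1) by (rule mult_left_mono)
    finally show ?case by (simp add: mult.assoc)
  qed simp
  show ?thesis
  proof (intro exI conjI ballI)
    show "0 \<le> 1 + (\<Sum>j=1..i. C ^ j)" using C(1) by (simp add: sum_nonneg add_nonneg_nonneg)
    fix f assume f: "f \<in> F_space N"
    have "sobolev_norm i f = L1_norm f + (\<Sum>j=1..i. L1_norm ((deriv ^^ j) f))"
      by (rule sobolev_norm_eq) (rule test_function_has_weak_deriv[OF F_space_test_function[OF f]])
    also have "\<dots> \<le> L1_norm f + (\<Sum>j=1..i. C ^ j * L1_norm f)"
      by (intro add_left_mono sum_mono pow f)
    finally show "sobolev_norm i f \<le> (1 + (\<Sum>j=1..i. C ^ j)) * L1_norm f"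
      by (simp add: distrib_right sum_distrib_right)
  qed
qed

subsection \<open>Fejer averages of Sobolev functions\<close>

text \<open>Both sides are trigonometric polynomials with the same coefficients, so no differentiation under
  the integral sign is involved.\<close>

lemma F_space_average_deriv:
  assumes "\<kappa> \<in> F_space N" "s \<in> borel_measurable borel" "integrable circ w"
  shows "(deriv ^^ j) (\<lambda>x. \<integral>z. \<kappa> (x - s z) * w z \<partial>circ) = (\<lambda>x. \<integral>z. (deriv ^^ j) \<kappa> (x - s z) * w z \<partial>circ)"
proof (induction j)
  case (Suc j)
  define q where "q = (deriv ^^ j) \<kappa>"
  have "q \<in> F_space N" unfolding q_def by (rule F_space_funpow_deriv[OF assms(1)])
  then obtain c where c: "trig_rep {- int N + 1..int N} c q" by (auto simp: F_space_trig_rep)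
  obtain q' where q': "trig_rep {- int N + 1..int N} (\<lambda>k. (2 * of_real pi * \<i> * of_int k) * c k) q'"
    "\<And>x. (q has_real_derivative q' x) (at x)"
    by (rule trig_rep_deriv[OF c]) blast
  have dq: "deriv q = q'" using DERIV_imp_deriv[OF q'(2)] by blast
  obtain r where r: "trig_rep {- int N + 1..int N} (\<lambda>k. (2 * of_real pi * \<i> * of_int k) *
      (c k * (\<integral>z. e_fun (- k) (s z) * of_real (w z) \<partial>circ))) r"
    "\<And>x. ((\<lambda>x. \<integral>z. q (x - s z) * w z \<partial>circ) has_real_derivative r x) (at x)"
    by (rule trig_rep_deriv[OF trig_rep_average[OF c assms(2,3)]]) blast
  have "complex_of_real (r x) = complex_of_real (\<integral>z. q' (x - s z) * w z \<partial>circ)" for x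
    using r(1)[unfolded trig_rep_def, THEN conjunct2, rule_format, of x]
      trig_rep_average[OF q'(1) assms(2,3), unfolded trig_rep_def, THEN conjunct2, rule_format, of x]
    by (simp only: mult.assoc)
  then have "r x = (\<integral>z. q' (x - s z) * w z \<partial>circ)" for x by (simp only: of_real_eq_iff)
  then have "deriv (\<lambda>x. \<integral>z. q (x - s z) * w z \<partial>circ) = (\<lambda>x. \<integral>z. q' (x - s z) * w z \<partial>circ)"
    using DERIV_imp_deriv[OF r(2)] by auto
  then show ?case using Suc dq by (simp add: q_def)
qed simp

text \<open>The derivative falls on the kernel, which as a function of the integration variable is a test
  function; by definition of the weak derivative it can be moved to \<open>f\<close>.\<close>

lemma Pi_N_funpow_deriv:
  assumes N: "N \<ge> 1" and f: "L1 f" and u: "has_weak_deriv j f u"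
  shows "(deriv ^^ j) (Pi_N N f) = Pi_N N u"
proof
  fix x
  note K = fejer_test[OF N]
  have sgn: "(-1) ^ j * (-1) ^ j = (1::real)" by (simp flip: power_mult_distrib)
  have "(deriv ^^ j) (Pi_N N f) x = (\<integral>z. (deriv ^^ j) (fejer N) (x - z) * f z \<partial>circ)"
    using F_space_average_deriv[OF fejer_F_space[OF N], of "\<lambda>z. z" f j] L1D(2)[OF f]
    by (simp add: Pi_N_def[abs_def] fun_eq_iff)
  also have "\<dots> = (-1) ^ j * ((-1) ^ j * (\<integral>z. (deriv ^^ j) (fejer N) (x - z) * f z \<partial>circ))"
    using sgn by (simp only: mult.assoc[symmetric] mult_1)
  also have "(-1) ^ j * (\<integral>z. (deriv ^^ j) (fejer N) (x - z) * f z \<partial>circ)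
      = (\<integral>z. f z * (deriv ^^ j) (\<lambda>y. fejer N (x - y)) z \<partial>circ)"
    unfolding test_function_reflect(2)[OF K]
    by (subst integral_mult_right_zero[symmetric]) (simp only: mult_ac)
  also have "\<dots> = (-1) ^ j * (\<integral>z. u z * fejer N (x - z) \<partial>circ)"
    by (rule has_weak_derivD[OF u test_function_reflect(1)[OF K]])
  also have "(-1) ^ j * ((-1) ^ j * (\<integral>z. u z * fejer N (x - z) \<partial>circ)) = Pi_N N u x"
    using sgn by (simp only: mult.assoc[symmetric] mult_1 Pi_N_def mult.commute)
  finally show "(deriv ^^ j) (Pi_N N f) x = Pi_N N u x" .
qed

lemma has_weak_deriv_Pi_N:
  "N \<ge> 1 \<Longrightarrow> L1 f \<Longrightarrow> has_weak_deriv j f u \<Longrightarrow> has_weak_deriv j (Pi_N N f) (Pi_N N u)"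
  using test_function_has_weak_deriv[OF F_space_test_function[OF Pi_N_F_space], of N f j]
  by (simp add: Pi_N_funpow_deriv)

lemma sobolev_norm_Pi_N:
  assumes N: "N \<ge> 1" and f: "sobolev i f"
  shows "sobolev_norm i (Pi_N N f) \<le> sobolev_norm i f"
proof -
  have "sobolev_norm i (Pi_N N f) = L1_norm (Pi_N N f) + (\<Sum>j=1..i. L1_norm (Pi_N N (weak_deriv j f)))"
    using f by (intro sobolev_norm_eq has_weak_deriv_Pi_N N sobolev_L1 sobolev_has_weak_deriv)
  also have "\<dots> \<le> sobolev_norm i f"
    unfolding sobolev_norm_def using f
    by (intro add_mono sum_mono L1_norm_Pi_N N sobolev_L1 has_weak_deriv_L1[OF sobolev_has_weak_deriv]) auto
  finally show ?thesis .
qed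

text \<open>The rate of approximation: for a smooth function it follows from the estimate for translations,
  and the general case is reduced to the smooth one by replacing the function by its own averages.\<close>

lemma L1_norm_Pi_N_minus:
  assumes N: "N \<ge> 1" and f: "L1 f" and u: "has_weak_deriv 1 f u"
  shows "L1_norm (\<lambda>x. Pi_N N f x - f x) \<le> 1 / sqrt N * L1_norm u"
proof -
  have "L1_norm (\<lambda>x. Pi_N N f x - f x)
      \<le> 1 / sqrt N * L1_norm u + 2 * L1_norm (\<lambda>x. Pi_N (Suc M) f x - f x)" for M
  proof -
    define p where "p = Pi_N (Suc M) f"
    have pt: "test_function p" unfolding p_def
      by (rule F_space_test_function[OF Pi_N_F_space]) (auto simp: f)
    have pL: "L1 p" by (rule test_function_L1[OF pt])
    have d: "L1 (\<lambda>x. p x - f x)" by (rule L1_diff[OF pL f])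
    have "deriv p = Pi_N (Suc M) u"
      unfolding p_def using Pi_N_funpow_deriv[OF _ f u, of "Suc M"] by simp
    then have "L1_norm (deriv p) \<le> L1_norm u" using L1_norm_Pi_N[OF _ has_weak_deriv_L1[OF u]] by simp
    then have 1: "L1_norm (\<lambda>x. Pi_N N p x - p x) \<le> 1 / sqrt N * L1_norm u"
      by (intro order_trans[OF L1_norm_Pi_N_minus_test[OF N pt]] mult_left_mono) auto
    have "L1_norm (\<lambda>x. Pi_N N f x - f x)
        = L1_norm (\<lambda>x. ((Pi_N N p x - p x) - Pi_N N (\<lambda>x. p x - f x) x) + (p x - f x))"
      by (simp add: Pi_N_diff[OF N pL f])
    also have "\<dots> \<le> L1_norm (\<lambda>x. (Pi_N N p x - p x) - Pi_N N (\<lambda>x. p x - f x) x) + L1_norm (\<lambda>x. p x - f x)"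
      by (intro L1_norm_add L1_diff Pi_N_L1 N pL f d)
    also have "\<dots> \<le> (L1_norm (\<lambda>x. Pi_N N p x - p x) + L1_norm (Pi_N N (\<lambda>x. p x - f x))) + L1_norm (\<lambda>x. p x - f x)"
      by (intro add_right_mono L1_norm_diff L1_diff Pi_N_L1 N pL d)
    also have "\<dots> \<le> 1 / sqrt N * L1_norm u + 2 * L1_norm (\<lambda>x. p x - f x)"
      using 1 L1_norm_Pi_N[OF N d] by linarith
    finally show ?thesis by (simp add: p_def)
  qed
  moreover have "(\<lambda>M. 1 / sqrt N * L1_norm u + 2 * L1_norm (\<lambda>x. Pi_N (Suc M) f x - f x))
      \<longlonglongrightarrow> 1 / sqrt N * L1_norm u + 2 * 0"
    by (intro tendsto_intros L1_norm_Pi_N_tendsto f)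
  ultimately show ?thesis
    by (intro LIMSEQ_le_const[where a = "L1_norm (\<lambda>x. Pi_N N f x - f x)"]) auto
qed

lemma sobolev_norm_Pi_N_minus:
  assumes N: "N \<ge> 1" and f: "sobolev (Suc i) f"
  shows "sobolev_norm i (\<lambda>x. Pi_N N f x - f x) \<le> 1 / sqrt N * sobolev_norm (Suc i) f"
proof -
  have w: "has_weak_deriv j f (weak_deriv j f)" if "1 \<le> j" "j \<le> Suc i" for j
    using f that by (rule sobolev_has_weak_deriv)
  have "sobolev_norm i (\<lambda>x. Pi_N N f x - f x) = L1_norm (\<lambda>x. Pi_N N f x - f x)
      + (\<Sum>j=1..i. L1_norm (\<lambda>x. Pi_N N (weak_deriv j f) x - weak_deriv j f x))"
    by (intro sobolev_norm_eq has_weak_deriv_diff has_weak_deriv_Pi_N Pi_N_L1 N sobolev_L1[OF f] w) auto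
  also have "\<dots> \<le> 1 / sqrt N * L1_norm (weak_deriv 1 f)
      + (\<Sum>j=1..i. 1 / sqrt N * L1_norm (weak_deriv (Suc j) f))"
  proof (intro add_mono sum_mono L1_norm_Pi_N_minus N sobolev_L1[OF f])
    fix j assume j: "j \<in> {1..i}"
    show "L1 (weak_deriv j f)" using j by (intro has_weak_deriv_L1[OF w]) auto
    show "has_weak_deriv 1 (weak_deriv j f) (weak_deriv (Suc j) f)"
      by (rule has_weak_deriv_of_weak_deriv[where i = j and f = f]) (use j in \<open>auto intro: w\<close>)
  qed (intro w, auto)
  also have "\<dots> = 1 / sqrt N * (\<Sum>j=0..i. L1_norm (weak_deriv (Suc j) f))"
    by (simp add: sum.atLeast_Suc_atMost[of 0 i] sum_distrib_left distrib_left)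
  also have "(\<Sum>j=0..i. L1_norm (weak_deriv (Suc j) f)) = (\<Sum>j=1..Suc i. L1_norm (weak_deriv j f))"
    by (simp only: sum.shift_bounds_cl_Suc_ivl One_nat_def)
  also have "1 / sqrt N * \<dots> \<le> 1 / sqrt N * sobolev_norm (Suc i) f"
    by (intro mult_left_mono) (auto simp: sobolev_norm_def)
  finally show ?thesis .
qed

section \<open>Transfer operators\<close>

text \<open>The maps for which transfer operators are shown to exist. Expansion is known for densities only,
  whereas a Newton iterate is merely a function of integral one near a density; a derivative without
  zeros survives small perturbations and suffices.\<close>

definition nonsingular_lift :: "(real \<Rightarrow> real) \<Rightarrow> bool" where
  "nonsingular_lift S \<longleftrightarrow> circle_lift S \<and> (\<forall>x. \<exists>D. D \<noteq> 0 \<and> (S has_real_derivative D) (at x))"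

lemma nonsingular_lift_id: "nonsingular_lift id"
  unfolding nonsingular_lift_def circle_lift_def
proof (intro conjI allI)
  show "\<exists>d. \<forall>x. id (x + 1) = id x + real_of_int d" by (rule exI[of _ 1]) simp
  show "\<exists>D. D \<noteq> 0 \<and> (id has_real_derivative D) (at x)" for x
    by (rule exI[of _ 1]) (simp add: id_def)
qed

lemma nonsingular_lift_comp:
  assumes "nonsingular_lift S" "nonsingular_lift R"
  shows "nonsingular_lift (S \<circ> R)"
  unfolding nonsingular_lift_def circle_lift_def
proof (intro conjI allI)
  obtain d e where d: "\<And>x. S (x + 1) = S x + of_int d" and e: "\<And>x. R (x + 1) = R x + of_int e"
    using assms unfolding nonsingular_lift_def circle_lift_def by blast
  have "periodic1 (\<lambda>x. S x - of_int d * x)" by (simp add: periodic1_def d algebra_simps)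
  from periodic1_int[OF this] have "S (x + of_int n) = S x + of_int (d * n)" for x n
    by (simp add: algebra_simps)
  then show "\<exists>d. \<forall>x. (S \<circ> R) (x + 1) = (S \<circ> R) x + real_of_int d"
    by (intro exI[of _ "d * e"]) (simp add: e)
  fix x
  obtain D E where "D \<noteq> 0" "(S has_real_derivative D) (at (R x))" "E \<noteq> 0" "(R has_real_derivative E) (at x)"
    using assms unfolding nonsingular_lift_def by blast
  then show "\<exists>D. D \<noteq> 0 \<and> (S \<circ> R has_real_derivative D) (at x)"
    by (intro exI[of _ "D * E"]) (auto intro: DERIV_chain)
qed

lemma nonsingular_lift_measurable: "nonsingular_lift S \<Longrightarrow> S \<in> borel_measurable borel"
proof (rule borel_measurable_continuous_onI)
  assume "nonsingular_lift S"
  then show "continuous_on UNIV S"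
    unfolding nonsingular_lift_def continuous_on_eq_continuous_within
    by (metis DERIV_isCont continuous_at_imp_continuous_at_within)
qed

lemma negligible_periodic:
  assumes "negligible (A \<inter> {0..<1})" "\<And>x n. x \<in> A \<Longrightarrow> x + of_int n \<in> A"
  shows "negligible (A :: real set)"
proof (rule negligible_subset)
  show "negligible (\<Union>n. (+) (of_int n) ` (A \<inter> {0..<1}))"
  proof (rule negligible_countable_Union)
    fix B assume "B \<in> range (\<lambda>n. (+) (of_int n) ` (A \<inter> {0..<1}))"
    then show "negligible B" using negligible_translation[OF assms(1)] by blast
  qed simp
  show "A \<subseteq> (\<Union>n. (+) (of_int n) ` (A \<inter> {0..<1}))"
  proof
    fix x assume "x \<in> A"
    then have "frac x \<in> A" using assms(2)[of x "- \<lfloor>x\<rfloor>"] by (simp add: frac_def)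
    moreover have "x = of_int \<lfloor>x\<rfloor> + frac x" by (simp add: frac_def)
    ultimately show "x \<in> (\<Union>n. (+) (of_int n) ` (A \<inter> {0..<1}))"
      by (intro UN_I[of "\<lfloor>x\<rfloor>"] image_eqI[of _ _ "frac x"]) (auto simp: frac_lt_1)
  qed
qed

lemma null_sets_circ_negligible:
  assumes "A \<in> null_sets circ"
  shows "negligible A" "A \<subseteq> {0..<1}"
proof -
  have "A \<in> null_sets lborel" "A \<subseteq> {0..<1}"
    using assms unfolding circ_def by (auto simp: null_sets_restrict_space)
  then show "negligible A" "A \<subseteq> {0..<1}"
    by (auto simp: negligible_iff_null_sets null_sets_completionI)
qed

lemma AE_circ_of_negligible:
  assumes "negligible A"
  shows "AE x in circ. x \<notin> A"
proof -
  have "AE x in lebesgue. x \<notin> A" using assms by (simp add: negligible_iff_null_sets AE_not_in)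
  then have "AE x in lborel. x \<notin> A" by (simp add: AE_completion_iff)
  then show ?thesis unfolding circ_def by (subst AE_restrict_space_iff) auto
qed

text \<open>Non-singularity: it makes image measures absolutely continuous, and composition with the map
  well defined on essentially bounded functions.\<close>

lemma nonsingular_lift_null:
  assumes S: "nonsingular_lift S" and A: "A \<in> null_sets circ"
  shows "AE x in circ. frac (S x) \<notin> A"
proof -
  obtain D where D: "\<And>x. D x \<noteq> 0" "\<And>x. (S has_real_derivative D x) (at x)"
    using S unfolding nonsingular_lift_def by metis
  define Z where "Z = {x. frac x \<in> A}"
  have "Z \<inter> {0..<1} = A" using null_sets_circ_negligible(2)[OF A] by (auto simp: Z_def frac_eq)
  then have "negligible (Z \<inter> {0..<1})" by (simp add: null_sets_circ_negligible(1)[OF A])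
  then have "negligible Z"
    by (rule negligible_periodic) (simp add: Z_def frac_def)
  then have "negligible {x \<in> UNIV. S x \<in> Z}"
  proof (rule negligible_differentiable_vimage[where f' = "\<lambda>x. (*) (D x)"])
    show "inj ((*) (D x))" for x using D(1)[of x] by (auto simp: inj_def)
    show "(S has_derivative (*) (D x)) (at x within UNIV)" for x
      using D(2)[of x] by (simp add: has_field_derivative_def)
  qed
  from AE_circ_of_negligible[OF this] show ?thesis by (simp add: Z_def)
qed

lemma Linf_compose:
  assumes S: "nonsingular_lift S" and \<phi>: "Linf \<phi>"
  shows "Linf (\<lambda>x. \<phi> (S x))"
proof -
  obtain M where M: "AE x in circ. \<bar>\<phi> x\<bar> \<le> M" and per: "periodic1 \<phi>" and m: "\<phi> \<in> borel_measurable borel"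
    using \<phi> by (auto simp: Linf_def)
  obtain d where d: "\<And>x. S (x + 1) = S x + of_int d"
    using S unfolding nonsingular_lift_def circle_lift_def by blast
  have "periodic1 (\<lambda>x. \<phi> (S x))" using periodic1_int[OF per] by (simp add: periodic1_def d)
  moreover have "(\<lambda>x. \<phi> (S x)) \<in> borel_measurable borel"
    by (rule measurable_compose[OF nonsingular_lift_measurable[OF S] m])
  moreover obtain A where A: "A \<in> null_sets circ" "{x \<in> space circ. \<not> \<bar>\<phi> x\<bar> \<le> M} \<subseteq> A"
    using M unfolding eventually_ae_filter by blast
  have "AE x in circ. \<bar>\<phi> (S x)\<bar> \<le> M"
    using nonsingular_lift_null[OF S A(1)]
  proof eventually_elim
    case (elim x)
    have "frac (S x) \<in> space circ" by (simp add: frac_lt_1)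
    then have "\<bar>\<phi> (frac (S x))\<bar> \<le> M" using elim A(2) by blast
    then show ?case by (simp add: periodic1_frac[OF per])
  qed
  ultimately show ?thesis by (auto simp: Linf_def)
qed

lemma integrable_mult_Linf:
  assumes "Linf k" "integrable circ w"
  shows "integrable circ (\<lambda>x. k x * w x)"
proof -
  obtain M where M: "AE x in circ. \<bar>k x\<bar> \<le> M" and m: "k \<in> borel_measurable borel"
    using assms by (auto simp: Linf_def)
  have wm: "w \<in> borel_measurable circ" using assms by auto
  show ?thesis
  proof (rule Bochner_Integration.integrable_bound[where f = "\<lambda>x. M * w x"])
    show "integrable circ (\<lambda>x. M * w x)" using assms by simp
    show "(\<lambda>x. k x * w x) \<in> borel_measurable circ"
      by (intro borel_measurable_times borel_measurable_circ m wm)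
    show "AE x in circ. norm (k x * w x) \<le> norm (M * w x)"
      using M by eventually_elim (auto simp: abs_mult intro!: mult_right_mono)
  qed
qed

lemma Linf_bounded:
  "periodic1 \<phi> \<Longrightarrow> \<phi> \<in> borel_measurable borel \<Longrightarrow> (\<And>x. \<bar>\<phi> x\<bar> \<le> M) \<Longrightarrow> Linf \<phi>"
  unfolding Linf_def by (auto intro!: exI[of _ M])

lemma Linf_test_function: "test_function \<phi> \<Longrightarrow> Linf \<phi>"
  using test_function_bounded[of \<phi>]
  by (metis Linf_bounded test_function_periodic test_function_measurable)

lemma is_transferD: "is_transfer S \<psi> \<rho> \<Longrightarrow> Linf \<phi> \<Longrightarrow>
    (\<integral>x. \<phi> (S x) * \<psi> x \<partial>circ) = (\<integral>x. \<phi> x * \<rho> x \<partial>circ)"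
  by (simp add: is_transfer_def)

lemma is_transfer_L1: "is_transfer S \<psi> \<rho> \<Longrightarrow> L1 \<rho>"
  by (simp add: is_transfer_def)

text \<open>For a density the transferred density is the Radon-Nikodym derivative of the image measure.\<close>

lemma is_transfer_exists_nonneg:
  assumes S: "nonsingular_lift S" and \<psi>: "L1 \<psi>" "\<And>x. 0 \<le> \<psi> x"
  shows "\<exists>\<rho>. is_transfer S \<psi> \<rho>"
proof -
  have \<psi>m[measurable]: "\<psi> \<in> borel_measurable circ" using L1D(2)[OF \<psi>(1)] by auto
  have Sm: "(\<lambda>x. frac (S x)) \<in> circ \<rightarrow>\<^sub>M circ"
    using measurable_compose[OF borel_measurable_circ[OF nonsingular_lift_measurable[OF S]] frac_measurable] .
  define \<mu> where "\<mu> = density circ (\<lambda>x. ennreal (\<psi> x))"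
  define \<nu> where "\<nu> = distr \<mu> circ (\<lambda>x. frac (S x))"
  have Sm': "(\<lambda>x. frac (S x)) \<in> \<mu> \<rightarrow>\<^sub>M circ" using Sm by (simp add: \<mu>_def)
  have fin: "finite_measure \<mu>"
  proof (rule finite_measureI)
    have "emeasure \<mu> (space \<mu>) = (\<integral>\<^sup>+x. ennreal (\<psi> x) * indicator (space circ) x \<partial>circ)"
      unfolding \<mu>_def space_density by (rule emeasure_density[OF _ sets.top]) simp
    also have "\<dots> = (\<integral>\<^sup>+x. ennreal (\<psi> x) \<partial>circ)" by (intro nn_integral_cong) auto
    also have "\<dots> = ennreal (\<integral>x. \<psi> x \<partial>circ)"
      using \<psi> by (intro nn_integral_eq_integral L1D) auto
    finally show "emeasure \<mu> (space \<mu>) \<noteq> \<infinity>" by simp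
  qed
  have fin\<nu>: "finite_measure \<nu>"
    unfolding \<nu>_def by (rule finite_measure.finite_measure_distr[OF fin Sm'])
  have ac: "absolutely_continuous circ \<nu>"
    unfolding absolutely_continuous_def
  proof
    fix A assume A: "A \<in> null_sets circ"
    then have As: "A \<in> sets circ" by auto
    have "AE x in \<mu>. frac (S x) \<notin> A"
      unfolding \<mu>_def using nonsingular_lift_null[OF S A] by (auto simp: AE_density elim: eventually_mono)
    moreover have "{x \<in> space circ. x \<notin> A} \<in> sets circ"
      using sets.compl_sets[OF As] by (simp only: set_diff_eq)
    ultimately have "AE x in \<nu>. x \<notin> A"
      unfolding \<nu>_def by (subst AE_distr_iff[OF Sm']) auto
    then show "A \<in> null_sets \<nu>"
      using As by (subst (asm) AE_iff_null_sets[symmetric]) (auto simp: \<nu>_def)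
  qed
  have sets\<nu>: "sets \<nu> = sets circ" by (simp add: \<nu>_def)
  obtain D where Dm[measurable]: "D \<in> borel_measurable circ"
    and D: "AE x in circ. RN_deriv circ \<nu> x = ennreal (D x)" "\<And>x. 0 \<le> D x"
    using circ.real_RN_deriv[OF fin\<nu> ac sets\<nu>] by metis
  have dens: "density circ (\<lambda>x. ennreal (D x)) = \<nu>"
  proof -
    have "density circ (\<lambda>x. ennreal (D x)) = density circ (RN_deriv circ \<nu>)"
      using D(1) by (intro density_cong) (auto elim: eventually_mono)
    also have "\<dots> = \<nu>" by (rule circ.density_RN_deriv[OF ac sets\<nu>])
    finally show ?thesis .
  qed
  have Dint: "integrable circ D"
  proof (rule integrableI_nonneg)
    have "(\<integral>\<^sup>+x. ennreal (D x) \<partial>circ) = (\<integral>\<^sup>+x. ennreal (D x) * indicator (space circ) x \<partial>circ)"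
      by (intro nn_integral_cong) auto
    also have "\<dots> = emeasure (density circ (\<lambda>x. ennreal (D x))) (space circ)"
      by (rule emeasure_density[OF _ sets.top, symmetric]) simp
    also have "\<dots> < \<infinity>"
      unfolding dens using finite_measure.emeasure_finite[OF fin\<nu>, of "space circ"] by (simp add: less_top)
    finally show "(\<integral>\<^sup>+x. ennreal (D x) \<partial>circ) < \<infinity>" .
  qed (use D in auto)
  have eqc: "D (frac x) = D x" if "x \<in> space circ" for x using that by (simp add: frac_eq)
  have "is_transfer S \<psi> (\<lambda>x. D (frac x))"
    unfolding is_transfer_def
  proof (intro conjI allI impI)
    show "L1 (\<lambda>x. D (frac x))"
      unfolding L1_def
    proof
      show "periodic1 (\<lambda>x. D (frac x))" by (simp add: periodic1_def frac_1_eq)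
      show "integrable circ (\<lambda>x. D (frac x))"
        using Dint by (subst Bochner_Integration.integrable_cong[where g = D]) (auto simp: eqc)
    qed
    fix \<phi> assume \<phi>: "Linf \<phi>"
    then have per: "periodic1 \<phi>" and m: "\<phi> \<in> borel_measurable borel" by (auto simp: Linf_def)
    have mc: "\<phi> \<in> borel_measurable circ" by (rule borel_measurable_circ[OF m])
    have "(\<integral>x. \<phi> (S x) * \<psi> x \<partial>circ) = (\<integral>x. \<psi> x *\<^sub>R \<phi> (frac (S x)) \<partial>circ)"
      by (simp add: periodic1_frac[OF per] mult.commute)
    also have "\<dots> = (\<integral>x. \<phi> (frac (S x)) \<partial>\<mu>)"
      unfolding \<mu>_def using measurable_compose[OF Sm mc] \<psi>(2)
      by (intro integral_density[symmetric]) auto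
    also have "\<dots> = (\<integral>x. \<phi> x \<partial>\<nu>)"
      unfolding \<nu>_def by (rule integral_distr[OF Sm' mc, symmetric])
    also have "\<dots> = (\<integral>x. D x *\<^sub>R \<phi> x \<partial>circ)"
      unfolding dens[symmetric] using mc D(2) by (intro integral_density) auto
    also have "\<dots> = (\<integral>x. \<phi> x * D (frac x) \<partial>circ)"
      by (intro Bochner_Integration.integral_cong) (auto simp: eqc)
    finally show "(\<integral>x. \<phi> (S x) * \<psi> x \<partial>circ) = (\<integral>x. \<phi> x * D (frac x) \<partial>circ)" .
  qed
  then show ?thesis by blast
qed

lemma is_transfer_diff:
  assumes S: "nonsingular_lift S" and L: "L1 \<psi>" "L1 \<psi>'"
    and t: "is_transfer S \<psi> \<rho>" "is_transfer S \<psi>' \<rho>'"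
  shows "is_transfer S (\<lambda>x. \<psi> x - \<psi>' x) (\<lambda>x. \<rho> x - \<rho>' x)"
  unfolding is_transfer_def
proof (intro conjI allI impI)
  note L' = is_transfer_L1[OF t(1)] is_transfer_L1[OF t(2)]
  show "L1 (\<lambda>x. \<rho> x - \<rho>' x)" by (rule L1_diff[OF L'])
  fix \<phi> assume \<phi>: "Linf \<phi>"
  note c = Linf_compose[OF S \<phi>]
  show "(\<integral>x. \<phi> (S x) * (\<psi> x - \<psi>' x) \<partial>circ) = (\<integral>x. \<phi> x * (\<rho> x - \<rho>' x) \<partial>circ)"
    using integrable_mult_Linf[OF \<phi> L1D(2)[OF L'(1)]] integrable_mult_Linf[OF \<phi> L1D(2)[OF L'(2)]]
      integrable_mult_Linf[OF c L1D(2)[OF L(1)]] integrable_mult_Linf[OF c L1D(2)[OF L(2)]]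
      is_transferD[OF t(1) \<phi>] is_transferD[OF t(2) \<phi>]
    by (simp add: right_diff_distrib)
qed

lemma is_transfer_exists:
  assumes S: "nonsingular_lift S" and \<psi>: "L1 \<psi>"
  shows "\<exists>\<rho>. is_transfer S \<psi> \<rho>"
proof -
  have p: "L1 (\<lambda>x. max 0 (\<psi> x))" "L1 (\<lambda>x. max 0 (- \<psi> x))"
    using \<psi> by (auto simp: L1_def periodic1_def)
  obtain \<rho> \<rho>' where "is_transfer S (\<lambda>x. max 0 (\<psi> x)) \<rho>" "is_transfer S (\<lambda>x. max 0 (- \<psi> x)) \<rho>'"
    using is_transfer_exists_nonneg[OF S p(1)] is_transfer_exists_nonneg[OF S p(2)] by auto
  from is_transfer_diff[OF S p this]
  have "is_transfer S (\<lambda>x. max 0 (\<psi> x) - max 0 (- \<psi> x)) (\<lambda>x. \<rho> x - \<rho>' x)" .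
  also have "(\<lambda>x. max 0 (\<psi> x) - max 0 (- \<psi> x)) = \<psi>" by (auto simp: fun_eq_iff max_def)
  finally show ?thesis by blast
qed

lemma is_transfer_transfer_op:
  "nonsingular_lift S \<Longrightarrow> L1 \<psi> \<Longrightarrow> is_transfer S \<psi> (transfer_op S \<psi>)"
  unfolding transfer_op_def
  by (rule someI_ex[where P = "is_transfer S \<psi>"]) (rule is_transfer_exists)

lemma is_transfer_unique:
  assumes t: "is_transfer S \<psi> \<rho>" "is_transfer S \<psi> \<rho>'"
  shows "AE x in circ. \<rho> x = \<rho>' x"
proof -
  note L = is_transfer_L1[OF t(1)] is_transfer_L1[OF t(2)]
  note Ld = L1_diff[OF L]
  define \<phi> where "\<phi> x = sgn (\<rho> x - \<rho>' x)" for x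
  have \<phi>: "Linf \<phi>"
  proof (rule Linf_bounded[where M = 1])
    show "periodic1 \<phi>" using L1D(1)[OF Ld] by (simp add: periodic1_def \<phi>_def)
    show "\<phi> \<in> borel_measurable borel"
      unfolding \<phi>_def using L1_borel_measurable[OF Ld] by simp
  qed (simp add: \<phi>_def abs_sgn_eq)
  have "(\<integral>x. \<phi> x * \<rho> x \<partial>circ) = (\<integral>x. \<phi> x * \<rho>' x \<partial>circ)"
    using is_transferD[OF t(1) \<phi>] is_transferD[OF t(2) \<phi>] by simp
  then have "(\<integral>x. \<phi> x * (\<rho> x - \<rho>' x) \<partial>circ) = 0"
    using integrable_mult_Linf[OF \<phi> L1D(2)[OF L(1)]] integrable_mult_Linf[OF \<phi> L1D(2)[OF L(2)]]
    by (simp add: right_diff_distrib)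
  moreover have "\<phi> x * (\<rho> x - \<rho>' x) = \<bar>\<rho> x - \<rho>' x\<bar>" for x
    by (simp add: \<phi>_def abs_sgn mult.commute)
  ultimately have "L1_norm (\<lambda>x. \<rho> x - \<rho>' x) = 0" by (simp add: L1_norm_def)
  from L1_norm_eq_0[OF Ld this] show ?thesis by simp
qed

text \<open>The Lasota-Yorke inequality speaks of the transfer operator of a composed map, the decay estimate of
  a composition of transfer operators; this identifies the two.\<close>

lemma is_transfer_comp:
  assumes R: "nonsingular_lift R" and t: "is_transfer S \<psi> \<rho>" "is_transfer R \<rho> \<rho>'"
  shows "is_transfer (R \<circ> S) \<psi> \<rho>'"
  unfolding is_transfer_def
proof (intro conjI allI impI)
  show "L1 \<rho>'" by (rule is_transfer_L1[OF t(2)])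
  fix \<phi> assume \<phi>: "Linf \<phi>"
  show "(\<integral>x. \<phi> ((R \<circ> S) x) * \<psi> x \<partial>circ) = (\<integral>x. \<phi> x * \<rho>' x \<partial>circ)"
    using is_transferD[OF t(1) Linf_compose[OF R \<phi>]] is_transferD[OF t(2) \<phi>] by simp
qed

lemma transfer_op_integral:
  assumes "nonsingular_lift S" "L1 \<psi>"
  shows "(\<integral>x. transfer_op S \<psi> x \<partial>circ) = (\<integral>x. \<psi> x \<partial>circ)"
proof -
  have "Linf (\<lambda>_. 1)" by (rule Linf_bounded[where M = 1]) (auto simp: periodic1_def)
  from is_transferD[OF is_transfer_transfer_op[OF assms] this] show ?thesis by simp
qed

lemma transfer_op_L1: "nonsingular_lift S \<Longrightarrow> L1 \<psi> \<Longrightarrow> L1 (transfer_op S \<psi>)"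
  by (rule is_transfer_L1[OF is_transfer_transfer_op])

lemma transfer_op_funpow_L1: "nonsingular_lift S \<Longrightarrow> L1 \<psi> \<Longrightarrow> L1 ((transfer_op S ^^ n) \<psi>)"
  by (induction n) (auto intro: transfer_op_L1)

lemma nonsingular_lift_funpow: "nonsingular_lift S \<Longrightarrow> nonsingular_lift (S ^^ n)"
  by (induction n) (auto intro: nonsingular_lift_comp nonsingular_lift_id)

lemma is_transfer_funpow:
  assumes S: "nonsingular_lift S" and \<psi>: "L1 \<psi>"
  shows "is_transfer (S ^^ n) \<psi> ((transfer_op S ^^ n) \<psi>)"
proof (induction n)
  case 0
  show ?case using \<psi> by (simp add: is_transfer_def)
next
  case (Suc n)
  from is_transfer_comp[OF S Suc is_transfer_transfer_op[OF S transfer_op_funpow_L1[OF S \<psi>]]]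
  show ?case by (simp add: o_def)
qed

lemma transfer_op_funpow_diff:
  assumes S: "nonsingular_lift S" and L: "L1 f" "L1 g"
  shows "AE x in circ. (transfer_op S ^^ n) f x - (transfer_op S ^^ n) g x = (transfer_op S ^^ n) (\<lambda>x. f x - g x) x"
  by (rule is_transfer_unique[OF
      is_transfer_diff[OF nonsingular_lift_funpow[OF S] L is_transfer_funpow[OF S L(1)] is_transfer_funpow[OF S L(2)]]
      is_transfer_funpow[OF S L1_diff[OF L]]])

lemma Pi_N_transfer_op:
  assumes N: "N \<ge> 1" and S: "nonsingular_lift S" and \<psi>: "L1 \<psi>"
  shows "Pi_N N (transfer_op S \<psi>) x = (\<integral>z. fejer N (x - S z) * \<psi> z \<partial>circ)"
  unfolding Pi_N_def
  using is_transferD[OF is_transfer_transfer_op[OF S \<psi>]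
      Linf_test_function[OF test_function_reflect(1)[OF fejer_test[OF N], of x]]] by simp

text \<open>Exponential decay of the iterates on functions of zero mean inverts \<open>I - L\<close> there: \<open>f\<close> is the
  telescoping sum of the iterates of \<open>f - L f\<close>.\<close>

lemma sobolev_norm_le_resolvent:
  assumes S: "nonsingular_lift S" and C: "C > 0" "0 < \<theta>" "\<theta> < 1"
    and gap: "\<And>n h. sobolev i h \<Longrightarrow> (\<integral>x. h x \<partial>circ) = 0 \<Longrightarrow>
      sobolev i ((transfer_op S ^^ n) h) \<and> sobolev_norm i ((transfer_op S ^^ n) h) \<le> C * \<theta> ^ n * sobolev_norm i h"
    and f: "sobolev i f" "(\<integral>x. f x \<partial>circ) = 0"
  shows "sobolev_norm i f \<le> C / (1 - \<theta>) * sobolev_norm i (\<lambda>x. f x - transfer_op S f x)"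
proof -
  define P where "P = transfer_op S"
  define q where "q x = f x - P f x" for x
  note fL = sobolev_L1[OF f(1)]
  have Pf: "sobolev i (P f)" using gap[OF f, of 1] by (simp add: P_def)
  have PfL: "L1 (P f)" by (rule sobolev_L1[OF Pf])
  have q: "sobolev i q" unfolding q_def by (rule sobolev_diff[OF f(1) Pf])
  have q0: "(\<integral>x. q x \<partial>circ) = 0"
    unfolding q_def using L1D(2)[OF fL] L1D(2)[OF PfL] transfer_op_integral[OF S fL] by (simp add: P_def)
  have sob: "sobolev i ((P ^^ n) f)" "sobolev i ((P ^^ n) q)" for n
    using gap[OF f] gap[OF q q0] by (auto simp: P_def)
  have step: "sobolev_norm i ((P ^^ n) f) \<le> sobolev_norm i ((P ^^ Suc n) f) + sobolev_norm i ((P ^^ n) q)" for n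
  proof -
    have s: "sobolev i (\<lambda>x. (P ^^ Suc n) f x + (P ^^ n) q x)" by (rule sobolev_add[OF sob])
    have ae: "AE x in circ. (P ^^ Suc n) f x + (P ^^ n) q x = (P ^^ n) f x"
      using transfer_op_funpow_diff[OF S fL PfL, of n]
      by eventually_elim (simp add: P_def q_def[abs_def] funpow_swap1)
    have "sobolev_norm i ((P ^^ n) f) = sobolev_norm i (\<lambda>x. (P ^^ Suc n) f x + (P ^^ n) q x)"
      by (rule sobolev_norm_cong_AE[OF s sobolev_L1[OF sob(1)] ae])
    also have "\<dots> \<le> sobolev_norm i ((P ^^ Suc n) f) + sobolev_norm i ((P ^^ n) q)"
      by (rule sobolev_norm_add[OF sob])
    finally show ?thesis .
  qed
  have tele: "sobolev_norm i f \<le> sobolev_norm i ((P ^^ n) f) + (\<Sum>j<n. sobolev_norm i ((P ^^ j) q))" for n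
  proof (induction n)
    case (Suc n)
    then show ?case using step[of n] by simp
  qed simp
  have bound: "sobolev_norm i f \<le> C * \<theta> ^ n * sobolev_norm i f + C / (1 - \<theta>) * sobolev_norm i q" for n
  proof -
    have "(\<Sum>j<n. sobolev_norm i ((P ^^ j) q)) \<le> (\<Sum>j<n. C * \<theta> ^ j * sobolev_norm i q)"
      using gap[OF q q0] by (intro sum_mono) (auto simp: P_def)
    also have "\<dots> = C * (\<Sum>j<n. \<theta> ^ j) * sobolev_norm i q"
      by (simp add: sum_distrib_left sum_distrib_right mult_ac)
    also have "(\<Sum>j<n. \<theta> ^ j) = (1 - \<theta> ^ n) / (1 - \<theta>)" using C by (simp add: sum_gp_strict)
    also have "C * ((1 - \<theta> ^ n) / (1 - \<theta>)) * sobolev_norm i q \<le> C * (1 / (1 - \<theta>)) * sobolev_norm i q"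
      using C by (intro mult_right_mono mult_left_mono divide_right_mono) auto
    finally show ?thesis using tele[of n] gap[OF f, of n] by (simp add: P_def)
  qed
  have "(\<lambda>n. C * \<theta> ^ n * sobolev_norm i f + C / (1 - \<theta>) * sobolev_norm i q)
      \<longlonglongrightarrow> C * 0 * sobolev_norm i f + C / (1 - \<theta>) * sobolev_norm i q"
    using C by (intro tendsto_intros LIMSEQ_power_zero) auto
  then have "sobolev_norm i f \<le> C * 0 * sobolev_norm i f + C / (1 - \<theta>) * sobolev_norm i q"
    by (rule LIMSEQ_le_const) (use bound in blast)
  then show ?thesis by (simp add: q_def[abs_def] P_def)
qed

section \<open>Regularity of the coupling\<close>

text \<open>In the first variable the mean value theorem gives a Lipschitz bound that is uniform on a box; in
  the second variable, at a fixed value of the first, differentiability gives continuity.\<close>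

lemma continuous_if_partial_derivatives:
  fixes g :: "real \<Rightarrow> real \<Rightarrow> real"
  assumes der: "\<And>x y. ((\<lambda>t. g t y) has_real_derivative gx x y) (at x)"
    "\<And>x y. ((\<lambda>t. g x t) has_real_derivative gy x y) (at y)"
    and cont: "continuous_on UNIV (\<lambda>(x, y). gx x y)"
  shows "continuous_on UNIV (\<lambda>(x, y). g x y)"
proof -
  have "isCont (\<lambda>(x, y). g x y) (a, b)" for a b
  proof -
    have "compact ((\<lambda>(x, y). gx x y) ` ({a - 1..a + 1} \<times> {b - 1..b + 1}))"
      by (intro compact_continuous_image continuous_on_subset[OF cont] compact_Times) auto
    then obtain B where B: "\<And>x y. x \<in> {a - 1..a + 1} \<Longrightarrow> y \<in> {b - 1..b + 1} \<Longrightarrow> \<bar>gx x y\<bar> \<le> B"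
      using compact_imp_bounded bounded_real by fastforce
    have near: "\<bar>g x y - g a y\<bar> \<le> B * \<bar>x - a\<bar>" if "\<bar>x - a\<bar> < 1" "\<bar>y - b\<bar> < 1" for x y
    proof -
      have "norm (g x y - g a y) \<le> B * norm (x - a)"
      proof (rule field_differentiable_bound[where S = "{a - 1..a + 1}" and f = "\<lambda>t. g t y" and f' = "\<lambda>t. gx t y"])
        show "((\<lambda>t. g t y) has_field_derivative gx z y) (at z within {a - 1..a + 1})" for z
          by (rule has_field_derivative_at_within[OF der(1)])
        show "norm (gx z y) \<le> B" if "z \<in> {a - 1..a + 1}" for z
        proof -
          have "y \<in> {b - 1..b + 1}" using \<open>\<bar>y - b\<bar> < 1\<close> by (auto simp: abs_less_iff)
          from B[OF \<open>z \<in> _\<close> this] show ?thesis by simp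
        qed
      qed (use that in auto)
      then show ?thesis by simp
    qed
    have ya: "isCont (g a) b" using der(2) DERIV_isCont by blast
    have "((\<lambda>z. snd z) \<longlongrightarrow> b) (at (a, b))"
      using tendsto_snd[OF tendsto_ident_at, of "(a, b)" UNIV] by simp
    from isCont_tendsto_compose[OF ya this] have ga: "((\<lambda>z. g a (snd z)) \<longlongrightarrow> g a b) (at (a, b))" .
    have fa: "((\<lambda>z. fst z) \<longlongrightarrow> a) (at (a, b))"
      using tendsto_fst[OF tendsto_ident_at, of "(a, b)" UNIV] by simp
    have "((\<lambda>z. B * \<bar>fst z - a\<bar> + \<bar>g a (snd z) - g a b\<bar>) \<longlongrightarrow> B * \<bar>a - a\<bar> + \<bar>g a b - g a b\<bar>) (at (a, b))"
      by (intro tendsto_intros fa ga)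
    then have lim: "((\<lambda>z. B * \<bar>fst z - a\<bar> + \<bar>g a (snd z) - g a b\<bar>) \<longlongrightarrow> 0) (at (a, b))" by simp
    have "((\<lambda>z. (case z of (x, y) \<Rightarrow> g x y) - g a b) \<longlongrightarrow> 0) (at (a, b))"
    proof (rule Lim_null_comparison[OF _ lim])
      have "\<forall>\<^sub>F z in at (a, b). dist z (a, b) < 1"
        by (simp add: eventually_at) (metis zero_less_one)
      then show "\<forall>\<^sub>F z in at (a, b). norm ((case z of (x, y) \<Rightarrow> g x y) - g a b)
          \<le> B * \<bar>fst z - a\<bar> + \<bar>g a (snd z) - g a b\<bar>"
      proof eventually_elim
        case (elim z)
        obtain x y where z: "z = (x, y)" by fastforce
        have "\<bar>x - a\<bar> < 1" "\<bar>y - b\<bar> < 1"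
          using elim dist_fst_le[of z "(a, b)"] dist_snd_le[of z "(a, b)"] by (auto simp: z dist_real_def)
        from near[OF this] show ?case by (simp add: z)
      qed
    qed
    then show ?thesis by (simp add: isCont_def LIM_zero_iff)
  qed
  then show ?thesis by (simp add: continuous_on_eq_continuous_at)
qed

lemma C_k2_continuous: "C_k2 k g \<Longrightarrow> continuous_on UNIV (\<lambda>(x, y). g x y)"
proof (induction k arbitrary: g)
  case (Suc k)
  then obtain gx gy where der: "\<And>x y. ((\<lambda>t. g t y) has_real_derivative gx x y) (at x)"
      "\<And>x y. ((\<lambda>t. g x t) has_real_derivative gy x y) (at y)" and "C_k2 k gx"
    unfolding C_k2.simps by blast
  then show ?case using continuous_if_partial_derivatives[OF der Suc.IH] by blast
qed simp

lemma C_k2_derivatives: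
  "C_k2 k g \<Longrightarrow> \<exists>G. G 0 = g \<and> (\<forall>i<k. \<forall>x y. ((\<lambda>t. G i t y) has_real_derivative G (Suc i) x y) (at x))
    \<and> (\<forall>i\<le>k. continuous_on UNIV (\<lambda>(x, y). G i x y))"
proof (induction k arbitrary: g)
  case 0
  then show ?case by (intro exI[of _ "\<lambda>_. g"]) simp
next
  case (Suc k)
  then obtain gx gy where der: "\<And>x y. ((\<lambda>t. g t y) has_real_derivative gx x y) (at x)" and "C_k2 k gx"
    unfolding C_k2.simps by blast
  then obtain G where G: "G 0 = gx" "\<And>i x y. i < k \<Longrightarrow> ((\<lambda>t. G i t y) has_real_derivative G (Suc i) x y) (at x)"
      "\<And>i. i \<le> k \<Longrightarrow> continuous_on UNIV (\<lambda>(x, y). G i x y)"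
    using Suc.IH by blast
  define G' where "G' i = (case i of 0 \<Rightarrow> g | Suc i \<Rightarrow> G i)" for i
  show ?case
  proof (intro exI[of _ G'] conjI allI impI)
    show "G' 0 = g" by (simp add: G'_def)
    show "((\<lambda>t. G' i t y) has_real_derivative G' (Suc i) x y) (at x)" if "i < Suc k" for i x y
      using that G(1,2) der by (cases i) (auto simp: G'_def)
    show "continuous_on UNIV (\<lambda>(x, y). G' i x y)" if "i \<le> Suc k" for i
      using that G(3) C_k2_continuous[OF Suc.prems] by (cases i) (auto simp: G'_def)
  qed
qed

lemma DERIV_periodic:
  assumes "\<And>x. (f has_real_derivative f' x) (at x)" "\<And>x. f (x + 1) = f x + c"
  shows "f' (x + 1) = f' x"
proof -
  have "((\<lambda>x. f (x + 1)) has_real_derivative f' (x + 1)) (at x)"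
    using DERIV_shift[of f "f' (x + 1)" x 1] assms(1) by (simp add: add.commute)
  moreover have "((\<lambda>x. f (x + 1)) has_real_derivative f' x) (at x)"
    unfolding assms(2) by (auto intro!: derivative_eq_intros assms(1))
  ultimately show ?thesis by (rule DERIV_unique)
qed

lemma periodic2_bounded:
  fixes f :: "real \<Rightarrow> real \<Rightarrow> real"
  assumes "continuous_on UNIV (\<lambda>(x, y). f x y)" "\<And>x y. f (x + 1) y = f x y" "\<And>x y. f x (y + 1) = f x y"
  shows "\<exists>B. \<forall>x y. \<bar>f x y\<bar> \<le> B"
proof -
  have "compact ((\<lambda>(x, y). f x y) ` ({0..1} \<times> {0..1}))"
    by (intro compact_continuous_image continuous_on_subset[OF assms(1)] compact_Times) auto
  then obtain B where B: "\<And>x y. x \<in> {0..1} \<Longrightarrow> y \<in> {0..1} \<Longrightarrow> \<bar>f x y\<bar> \<le> B"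
    using compact_imp_bounded bounded_real by fastforce
  have "\<bar>f x y\<bar> \<le> B" for x y
  proof -
    have "f x y = f (frac x) y" using periodic1_frac[of "\<lambda>x. f x y" x] assms(2) by (simp add: periodic1_def)
    also have "\<dots> = f (frac x) (frac y)"
      using periodic1_frac[of "f (frac x)" y] assms(3) by (simp add: periodic1_def)
    finally show ?thesis using B[of "frac x" "frac y"] by (simp add: frac_lt_1 less_imp_le)
  qed
  then show ?thesis by blast
qed

text \<open>The functions \<open>W i\<close> are the derivatives in the first variable of \<open>(x, y) \<mapsto> g (T x) y\<close>, given by
  the formula of Faa di Bruno. Three derivatives have to be taken under an integral in \<open>y\<close>; a bound for
  the fourth makes the difference quotients converge uniformly.\<close>

lemma coupling_derivatives:
  assumes T: "circle_lift T" "C_k 5 T"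
    and g: "\<And>x y. g (x + 1) y = g x y \<and> g x (y + 1) = g x y" "C_k2 5 g"
  obtains W M where "\<And>x y. W 0 x y = g (T x) y"
    "\<And>i x y. i < 4 \<Longrightarrow> ((\<lambda>t. W i t y) has_real_derivative W (Suc i) x y) (at x)"
    "\<And>i x. i \<le> 4 \<Longrightarrow> W i x \<in> borel_measurable borel"
    "\<And>i x y. i \<le> 4 \<Longrightarrow> W i (x + 1) y = W i x y"
    "\<And>i x y. i \<le> (4::nat) \<Longrightarrow> \<bar>W i x y\<bar> \<le> M"
proof -
  obtain G where G0: "G 0 = g"
    and Gd: "\<And>i x y. i < 5 \<Longrightarrow> ((\<lambda>t. G i t y) has_real_derivative G (Suc i) x y) (at x)"
    and Gc: "\<And>i. i \<le> 5 \<Longrightarrow> continuous_on UNIV (\<lambda>(x, y). G i x y)"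
    using C_k2_derivatives[OF g(2)] by blast
  have Gp: "G i (x + 1) y = G i x y \<and> G i x (y + 1) = G i x y" if "i \<le> 5" for i x y
    using that
  proof (induction i arbitrary: x y)
    case 0
    then show ?case using g(1) by (simp add: G0)
  next
    case (Suc i)
    have d: "((\<lambda>t. G i t y) has_real_derivative G (Suc i) x y) (at x)" for x y
      using Suc.prems by (intro Gd) simp
    have "G (Suc i) (x + 1) y = G (Suc i) x y"
      by (rule DERIV_periodic[OF d, where c = 0]) (use Suc in simp)
    moreover have "(\<lambda>t. G i t (y + 1)) = (\<lambda>t. G i t y)" using Suc by simp
    then have "G (Suc i) x (y + 1) = G (Suc i) x y" using d DERIV_unique by metis
    ultimately show ?case by blast
  qed
  define D where "D i = (deriv ^^ i) T" for i
  have Dd: "(D i has_real_derivative D (Suc i) x) (at x)" if "i < 5" for i x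
    using T(2) that by (simp add: D_def C_k_def DERIV_deriv_iff_real_differentiable)
  have Dc: "continuous_on UNIV (D i)" if "i < 5" for i
    using Dd[OF that] DERIV_isCont by (auto simp: continuous_on_eq_continuous_at)
  obtain d where d: "\<And>x. T (x + 1) = T x + of_int d" using T(1) by (auto simp: circle_lift_def)
  have Dp: "D (Suc i) (x + 1) = D (Suc i) x" if "i < 5" for i x
    using that
  proof (induction i arbitrary: x)
    case 0
    show ?case by (rule DERIV_periodic[OF Dd[of 0]]) (auto simp: D_def d)
  next
    case (Suc i)
    show ?case by (rule DERIV_periodic[OF Dd[of "Suc i"], where c = 0]) (use Suc in auto)
  qed
  define A where "A i x y = G i (T x) y" for i x y
  have D0: "D 0 = T" by (simp add: D_def)
  have Ad: "((\<lambda>t. A i t y) has_real_derivative A (Suc i) x y * D 1 x) (at x)" if "i < 5" for i x y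
    unfolding A_def using DERIV_chain2[OF Gd[OF that] Dd[of 0]] by (simp add: D0)
  have Ac: "continuous_on UNIV (\<lambda>z. A i (fst z) (snd z))" if "i \<le> 5" for i
  proof -
    have "continuous_on UNIV (\<lambda>z. (T (fst z), snd z :: real))"
      using Dc[of 0] by (auto simp: D0 intro!: continuous_intros intro: continuous_on_compose2)
    from continuous_on_compose2[OF Gc[OF that] this] show ?thesis by (simp add: A_def)
  qed
  have Ap: "A i (x + 1) y = A i x y" "A i x (y + 1) = A i x y" if "i \<le> 5" for i x y
  proof -
    have "periodic1 (\<lambda>x. G i x y)" using Gp[OF that] by (simp add: periodic1_def)
    from periodic1_int[OF this] show "A i (x + 1) y = A i x y" by (simp add: A_def d)
    show "A i x (y + 1) = A i x y" using Gp[OF that] by (simp add: A_def)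
  qed
  define W where "W i = (\<lambda>x y. [A 0 x y,
     A 1 x y * D 1 x,
     A 2 x y * (D 1 x)\<^sup>2 + A 1 x y * D 2 x,
     A 3 x y * (D 1 x) ^ 3 + 3 * A 2 x y * D 1 x * D 2 x + A 1 x y * D 3 x,
     A 4 x y * (D 1 x) ^ 4 + 6 * A 3 x y * (D 1 x)\<^sup>2 * D 2 x
       + A 2 x y * (3 * (D 2 x)\<^sup>2 + 4 * D 1 x * D 3 x) + A 1 x y * D 4 x] ! i)" for i
  have W_eqs: "W 0 x y = A 0 x y" "W 1 x y = A 1 x y * D 1 x"
    "W 2 x y = A 2 x y * (D 1 x)\<^sup>2 + A 1 x y * D 2 x"
    "W 3 x y = A 3 x y * (D 1 x) ^ 3 + 3 * A 2 x y * D 1 x * D 2 x + A 1 x y * D 3 x"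
    "W 4 x y = A 4 x y * (D 1 x) ^ 4 + 6 * A 3 x y * (D 1 x)\<^sup>2 * D 2 x
       + A 2 x y * (3 * (D 2 x)\<^sup>2 + 4 * D 1 x * D 3 x) + A 1 x y * D 4 x" for x y
    by (simp_all add: W_def)
  have Wd: "((\<lambda>t. W i t y) has_real_derivative W (Suc i) x y) (at x)" if "i < 4" for i x y
  proof -
    have dd: "(D 1 has_real_derivative D 2 x) (at x)" "(D 2 has_real_derivative D 3 x) (at x)"
      "(D 3 has_real_derivative D 4 x) (at x)"
      "((\<lambda>t. A 1 t y) has_real_derivative A 2 x y * D 1 x) (at x)"
      "((\<lambda>t. A 2 t y) has_real_derivative A 3 x y * D 1 x) (at x)"
      "((\<lambda>t. A 3 t y) has_real_derivative A 4 x y * D 1 x) (at x)"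
      using Dd[of 1 x] Dd[of 2 x] Dd[of 3 x] Ad[of 1 y x] Ad[of 2 y x] Ad[of 3 y x]
      by (simp_all add: eval_nat_numeral)
    have 0: "((\<lambda>t. W 0 t y) has_real_derivative W 1 x y) (at x)"
      unfolding W_eqs using Ad[of 0 y x] by simp
    have 1: "((\<lambda>t. W 1 t y) has_real_derivative W 2 x y) (at x)"
      unfolding W_eqs
      by (rule DERIV_cong[OF DERIV_mult[OF dd(4) dd(1)]]) (simp add: power2_eq_square)
    have 2: "((\<lambda>t. W 2 t y) has_real_derivative W 3 x y) (at x)"
      unfolding W_eqs
      by (rule DERIV_cong[OF DERIV_add[OF DERIV_mult[OF dd(5) DERIV_power[OF dd(1), of 2]]
          DERIV_mult[OF dd(4) dd(2)]]]) (simp add: power2_eq_square power3_eq_cube algebra_simps)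
    have 3: "((\<lambda>t. W 3 t y) has_real_derivative W 4 x y) (at x)"
      unfolding W_eqs
      by (rule DERIV_cong[OF DERIV_add[OF DERIV_add[OF DERIV_mult[OF dd(6) DERIV_power[OF dd(1), of 3]]
          DERIV_mult[OF DERIV_mult[OF DERIV_cmult[OF dd(5), of 3] dd(1)] dd(2)]] DERIV_mult[OF dd(4) dd(3)]]])
         (simp add: power2_eq_square power3_eq_cube power4_eq_xxxx algebra_simps)
    consider "i = 0" | "i = 1" | "i = 2" | "i = 3" using \<open>i < 4\<close> by linarith
    then show ?thesis
      using 0 1 2 3 by cases (simp_all add: eval_nat_numeral)
  qed
  have Wc: "continuous_on UNIV (\<lambda>z. W i (fst z) (snd z))" if "i \<le> 4" for i
  proof -
    have Dc': "continuous_on UNIV (\<lambda>z::real \<times> real. D i (fst z))" if "i < 5" for i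
      by (rule continuous_on_compose2[OF Dc[OF that] continuous_on_fst[OF continuous_on_id]]) auto
    have "continuous_on UNIV (\<lambda>z. W 0 (fst z) (snd z))" "continuous_on UNIV (\<lambda>z. W 1 (fst z) (snd z))"
      "continuous_on UNIV (\<lambda>z. W 2 (fst z) (snd z))" "continuous_on UNIV (\<lambda>z. W 3 (fst z) (snd z))"
      "continuous_on UNIV (\<lambda>z. W 4 (fst z) (snd z))"
      unfolding W_eqs by (intro continuous_on_add continuous_on_mult continuous_on_power
        continuous_on_const Ac Dc'; simp)+
    moreover have "i = 0 \<or> i = 1 \<or> i = 2 \<or> i = 3 \<or> i = 4" using \<open>i \<le> 4\<close> by linarith
    ultimately show ?thesis by (elim disjE) (simp_all only:)
  qed
  have Wp: "W i (x + 1) y = W i x y" "W i x (y + 1) = W i x y" if "i \<le> 4" for i x y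
  proof -
    have "D 1 (x + 1) = D 1 x" "D 2 (x + 1) = D 2 x" "D 3 (x + 1) = D 3 x" "D 4 (x + 1) = D 4 x"
      using Dp[of 0 x] Dp[of 1 x] Dp[of 2 x] Dp[of 3 x] by (simp_all add: eval_nat_numeral)
    moreover have "A i (x + 1) y = A i x y" "A i x (y + 1) = A i x y" if "i \<le> 4" for i
      using Ap that by simp_all
    moreover have "i = 0 \<or> i = 1 \<or> i = 2 \<or> i = 3 \<or> i = 4" using \<open>i \<le> 4\<close> by linarith
    ultimately show "W i (x + 1) y = W i x y" "W i x (y + 1) = W i x y"
      by (elim disjE, simp_all add: W_eqs del: One_nat_def)+
  qed
  have "\<exists>B. \<forall>x y. \<bar>W i x y\<bar> \<le> B" if "i \<le> 4" for i
    using Wc[OF that] Wp[OF that] by (intro periodic2_bounded) (auto simp: case_prod_beta')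
  then obtain B where B: "\<And>i x y. i \<le> 4 \<Longrightarrow> \<bar>W i x y\<bar> \<le> B i" by metis
  have B0: "0 \<le> B i" if "i \<le> 4" for i using B[OF that, of 0 0] by linarith
  show ?thesis
  proof (rule that[of W "\<Sum>i\<le>4. B i"])
    show "W 0 x y = g (T x) y" for x y by (simp add: W_def A_def G0)
    show "W i x \<in> borel_measurable borel" if "i \<le> 4" for i x
    proof (rule borel_measurable_continuous_onI)
      have "continuous_on UNIV (\<lambda>y::real. (x, y))" by (intro continuous_intros)
      from continuous_on_compose2[OF Wc[OF that] this] show "continuous_on UNIV (W i x)" by simp
    qed
    show "\<bar>W i x y\<bar> \<le> (\<Sum>i\<le>4. B i)" if "i \<le> 4" for i x y
    proof -
      have "B i \<le> (\<Sum>i\<le>4. B i)" using that B0 by (intro member_le_sum) auto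
      then show ?thesis using B[OF that, of x y] by linarith
    qed
  qed (use Wd Wp in auto)
qed

section \<open>The discretised operator and its derivative\<close>

lemma lipschitz_of_DERIV_bound:
  fixes f :: "real \<Rightarrow> real"
  assumes "\<And>x. (f has_real_derivative f' x) (at x)" "\<And>x. \<bar>f' x\<bar> \<le> B"
  shows "\<bar>f x - f y\<bar> \<le> B * \<bar>x - y\<bar>"
  using field_differentiable_bound[of UNIV f f' B x y] assms by simp

lemma second_order_bound:
  fixes f :: "real \<Rightarrow> real"
  assumes f: "\<And>x. (f has_real_derivative f' x) (at x)"
    and f': "\<And>x. (f' has_real_derivative f'' x) (at x)" and B: "\<And>x. \<bar>f'' x\<bar> \<le> B"
  shows "\<bar>f (x + h) - f x - h * f' x\<bar> \<le> B * h\<^sup>2"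
proof -
  have B0: "0 \<le> B" using B[of 0] by linarith
  have "norm ((f (x + h) - (x + h) * f' x) - (f x - x * f' x)) \<le> (B * \<bar>h\<bar>) * norm (x + h - x)"
  proof (rule field_differentiable_bound[where S = "closed_segment x (x + h)" and f = "\<lambda>t. f t - t * f' x"
        and f' = "\<lambda>t. f' t - f' x"])
    show "((\<lambda>t. f t - t * f' x) has_field_derivative f' t - f' x) (at t within closed_segment x (x + h))" for t
      by (rule has_field_derivative_at_within) (auto intro!: derivative_eq_intros f)
    fix t assume "t \<in> closed_segment x (x + h)"
    then have "\<bar>t - x\<bar> \<le> \<bar>h\<bar>" by (auto simp: closed_segment_eq_real_ivl split: if_splits)
    then have "B * \<bar>t - x\<bar> \<le> B * \<bar>h\<bar>" using B0 by (rule mult_left_mono)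
    then show "norm (f' t - f' x) \<le> B * \<bar>h\<bar>"
      using lipschitz_of_DERIV_bound[OF f' B, of t x] by simp
  qed auto
  also have "(f (x + h) - (x + h) * f' x) - (f x - x * f' x) = f (x + h) - f x - h * f' x"
    by (simp add: algebra_simps)
  also have "(B * \<bar>h\<bar>) * norm (x + h - x) = B * h\<^sup>2" by (simp add: power2_eq_square)
  finally show ?thesis by simp
qed

lemma DERIV_of_second_order_bound:
  fixes f :: "real \<Rightarrow> real"
  assumes "\<And>h. \<bar>f (x + h) - f x - h * D\<bar> \<le> C * h\<^sup>2"
  shows "(f has_real_derivative D) (at x)"
  unfolding DERIV_def
proof (rule LIM_zero_cancel, rule Lim_null_comparison)
  show "((\<lambda>h. C * \<bar>h\<bar>) \<longlongrightarrow> 0) (at 0)" by (auto intro!: tendsto_eq_intros)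
  have "\<bar>(f (x + h) - f x) / h - D\<bar> \<le> C * \<bar>h\<bar>" if "h \<noteq> 0" for h
  proof -
    have "(f (x + h) - f x) / h - D = (f (x + h) - f x - h * D) / h"
      using that by (simp add: diff_divide_distrib)
    then have "\<bar>(f (x + h) - f x) / h - D\<bar> = \<bar>f (x + h) - f x - h * D\<bar> / \<bar>h\<bar>"
      by (simp only: abs_divide)
    also have "\<dots> \<le> C * h\<^sup>2 / \<bar>h\<bar>" using assms that by (intro divide_right_mono) auto
    also have "h\<^sup>2 = \<bar>h\<bar> * \<bar>h\<bar>" by (simp add: power2_eq_square)
    also have "C * (\<bar>h\<bar> * \<bar>h\<bar>) / \<bar>h\<bar> = C * \<bar>h\<bar>" using that by (simp del: abs_mult_self_eq)
    finally show ?thesis .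
  qed
  then show "\<forall>\<^sub>F h in at 0. norm ((f (x + h) - f x) / h - D) \<le> C * \<bar>h\<bar>"
    by (simp add: eventually_at_filter)
qed

lemma fejer_bounds:
  assumes "N \<ge> 1"
  obtains B where "B \<ge> 0" "\<And>x. \<bar>fejer N x\<bar> \<le> B" "\<And>x. \<bar>deriv (fejer N) x\<bar> \<le> B"
    "\<And>x. \<bar>deriv (deriv (fejer N)) x\<bar> \<le> B"
proof -
  note K = fejer_test[OF assms]
  note K' = test_function_deriv[OF K]
  note K'' = test_function_deriv[OF K']
  obtain B0 where B0: "B0 \<ge> 0" "\<And>x. \<bar>fejer N x\<bar> \<le> B0" using test_function_bounded[OF K] by metis
  obtain B1 where B1: "B1 \<ge> 0" "\<And>x. \<bar>deriv (fejer N) x\<bar> \<le> B1" using test_function_bounded[OF K'] by metis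
  obtain B2 where B2: "B2 \<ge> 0" "\<And>x. \<bar>deriv (deriv (fejer N)) x\<bar> \<le> B2" using test_function_bounded[OF K''] by metis
  show ?thesis
  proof (rule that[of "B0 + B1 + B2"])
    fix x
    show "\<bar>fejer N x\<bar> \<le> B0 + B1 + B2" using B0(2)[of x] B1(1) B2(1) by linarith
    show "\<bar>deriv (fejer N) x\<bar> \<le> B0 + B1 + B2" using B1(2)[of x] B0(1) B2(1) by linarith
    show "\<bar>deriv (deriv (fejer N)) x\<bar> \<le> B0 + B1 + B2" using B2(2)[of x] B0(1) B1(1) by linarith
  qed (use B0 B1 B2 in auto)
qed

lemma F_space_zero_if_L1_norm_zero: "f \<in> F_space N \<Longrightarrow> L1_norm f \<le> 0 \<Longrightarrow> f x = 0"
  using F_space_sup_bound[of N] by (metis L1_norm_nonneg abs_le_zero_iff mult_zero_right order_antisym)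

text \<open>The difference of two derivatives is linear and of smaller order than its argument, hence zero. So
  the choice made in the definition of \<open>frechet_F\<close> agrees with any derivative that can be exhibited.\<close>

lemma has_frechet_F_unique:
  assumes D: "has_frechet_F N \<Phi> f D" and D': "has_frechet_F N \<Phi> f D'" and u: "u \<in> F_space N"
    and d0: "d0 > 0" "\<And>u. u \<in> F_space N \<Longrightarrow> sobolev_norm 1 u < d0 \<Longrightarrow> \<Phi> (\<lambda>x. f x + u x) \<in> F_space N"
    and \<Phi>f: "\<Phi> f \<in> F_space N"
  shows "D u = D' u"
proof
  fix x
  define v where "v x = D u x - D' u x" for x
  have DF: "D w \<in> F_space N" "D' w \<in> F_space N" if "w \<in> F_space N" for w
    using D D' that by (auto simp: has_frechet_F_def)
  have v: "v \<in> F_space N" unfolding v_def by (intro F_space_diff DF u)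
  have key: "sobolev_norm 1 v \<le> 2 * \<eta> * sobolev_norm 1 u" if \<eta>: "\<eta> > 0" for \<eta>
  proof -
    let ?R = "\<lambda>D u x. \<Phi> (\<lambda>y. f y + u y) x - \<Phi> f x - D u x"
    obtain d1 where d1: "d1 > 0" "\<And>u. u \<in> F_space N \<Longrightarrow> sobolev_norm 1 u < d1 \<Longrightarrow>
        sobolev_norm 1 (?R D u) \<le> \<eta> * sobolev_norm 1 u"
      using D \<eta> unfolding has_frechet_F_def by blast
    obtain d2 where d2: "d2 > 0" "\<And>u. u \<in> F_space N \<Longrightarrow> sobolev_norm 1 u < d2 \<Longrightarrow>
        sobolev_norm 1 (?R D' u) \<le> \<eta> * sobolev_norm 1 u"
      using D' \<eta> unfolding has_frechet_F_def by blast
    define d where "d = min d0 (min d1 d2)"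
    define t where "t = d / (2 * (sobolev_norm 1 u + 1))"
    have s0: "0 \<le> sobolev_norm 1 u" by simp
    have d: "d > 0" using d0 d1 d2 by (simp add: d_def)
    have t: "t > 0" using d s0 by (simp add: t_def add_nonneg_pos)
    define w where "w x = t * u x" for x
    have w: "w \<in> F_space N" unfolding w_def by (rule F_space_cmult[OF u])
    have wn: "sobolev_norm 1 w = t * sobolev_norm 1 u"
      unfolding w_def using t sobolev_norm_cmult[OF sobolev_F_space[OF u]] by simp
    have "t * sobolev_norm 1 u \<le> t * (sobolev_norm 1 u + 1)" using t by (intro mult_left_mono) auto
    also have "\<dots> = d / 2"
    proof -
      have "sobolev_norm 1 u + 1 \<noteq> 0" using s0 by linarith
      then show ?thesis unfolding t_def by (metis divide_divide_eq_left nonzero_eq_divide_eq)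
    qed
    also have "\<dots> < d" using d by simp
    finally have "sobolev_norm 1 w < d" using wn by simp
    then have wd: "sobolev_norm 1 w < d0" "sobolev_norm 1 w < d1" "sobolev_norm 1 w < d2"
      by (auto simp: d_def)
    have RF: "?R D w \<in> F_space N" "?R D' w \<in> F_space N"
      by (intro F_space_diff d0(2)[OF w wd(1)] \<Phi>f DF w)+
    have "D w = (\<lambda>x. t * D u x)" "D' w = (\<lambda>x. t * D' u x)"
      using D D' u unfolding has_frechet_F_def w_def by blast+
    then have "(\<lambda>x. t * v x) = (\<lambda>x. ?R D' w x - ?R D w x)" by (simp add: fun_eq_iff v_def algebra_simps)
    then have "t * sobolev_norm 1 v = sobolev_norm 1 (\<lambda>x. ?R D' w x - ?R D w x)"
      using sobolev_norm_cmult[OF sobolev_F_space[OF v], of 1 t] t by simp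
    also have "\<dots> \<le> sobolev_norm 1 (?R D' w) + sobolev_norm 1 (?R D w)"
      by (rule sobolev_norm_diff[OF sobolev_F_space[OF RF(2)] sobolev_F_space[OF RF(1)]])
    also have "\<dots> \<le> \<eta> * sobolev_norm 1 w + \<eta> * sobolev_norm 1 w"
      by (intro add_mono d1(2) d2(2) w wd)
    also have "\<dots> = t * (2 * \<eta> * sobolev_norm 1 u)" unfolding wn by (simp add: algebra_simps)
    finally show ?thesis using t by simp
  qed
  have "sobolev_norm 1 v \<le> 0"
  proof (rule field_le_epsilon)
    fix e :: real assume e: "e > 0"
    define s where "s = sobolev_norm 1 u"
    have s: "0 \<le> s" by (simp add: s_def)
    then have "s * e \<le> (s + 1) * e" using e by (intro mult_right_mono) auto
    then have "2 * (e / (2 * (s + 1))) * s \<le> e" using s by (simp add: pos_divide_le_eq algebra_simps)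
    moreover have "0 < e / (2 * (s + 1))" using e s by simp
    ultimately show "sobolev_norm 1 v \<le> 0 + e"
      using key[of "e / (2 * (s + 1))"] by (simp add: s_def)
  qed
  then have "L1_norm v \<le> 0" using L1_norm_le_sobolev_norm[of v 1] by linarith
  from F_space_zero_if_L1_norm_zero[OF v this, of x] show "D u x = D' u x" by (simp add: v_def)
qed

lemma frechet_F_eq:
  assumes D: "has_frechet_F N \<Phi> f D" and u: "u \<in> F_space N"
    and d0: "d0 > 0" "\<And>u. u \<in> F_space N \<Longrightarrow> sobolev_norm 1 u < d0 \<Longrightarrow> \<Phi> (\<lambda>x. f x + u x) \<in> F_space N"
    and \<Phi>f: "\<Phi> f \<in> F_space N"
  shows "frechet_F N \<Phi> f u = D u"
proof -
  have "has_frechet_F N \<Phi> f (frechet_F N \<Phi> f)"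
    unfolding frechet_F_def by (rule someI[where P = "has_frechet_F N \<Phi> f", OF D])
  then show ?thesis
    using has_frechet_F_unique[where N = N and \<Phi> = \<Phi> and f = f and D = "frechet_F N \<Phi> f" and D' = D] D u d0 \<Phi>f
    by blast
qed

text \<open>\<open>W i\<close> stands for the \<open>i\<close>-th derivative of \<open>x \<mapsto> g (T x) y\<close>. The bound \<open>M\<close> depends on \<open>T\<close> and \<open>g\<close>
  only: the size of the coupling \<open>\<epsilon>\<close> that the theorem allows is expressed through it.\<close>

locale smooth_coupling =
  fixes T :: "real \<Rightarrow> real" and g :: "real \<Rightarrow> real \<Rightarrow> real"
    and W :: "nat \<Rightarrow> real \<Rightarrow> real \<Rightarrow> real" and M \<epsilon> :: real
  assumes T_lift: "circle_lift T"
    and T_deriv: "\<And>x. (T has_real_derivative deriv T x) (at x)"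
    and W_0: "\<And>x y. W 0 x y = g (T x) y"
    and W_deriv: "\<And>i x y. i < 4 \<Longrightarrow> ((\<lambda>t. W i t y) has_real_derivative W (Suc i) x y) (at x)"
    and W_measurable: "\<And>i x. i \<le> 4 \<Longrightarrow> W i x \<in> borel_measurable borel"
    and W_periodic: "\<And>i x y. i \<le> 4 \<Longrightarrow> W i (x + 1) y = W i x y"
    and W_bound: "\<And>i x y. i \<le> 4 \<Longrightarrow> \<bar>W i x y\<bar> \<le> M"
    and eps_nonneg: "0 \<le> \<epsilon>"
begin

text \<open>\<open>V 0 u\<close> is the displacement that the density \<open>u\<close> causes per unit of coupling, as a function of the
  point before \<open>T\<close> is applied, and \<open>V i u\<close> is its \<open>i\<close>-th derivative.\<close>

definition V :: "nat \<Rightarrow> (real \<Rightarrow> real) \<Rightarrow> real \<Rightarrow> real" where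
  "V i u x = (\<integral>y. W i x y * u y \<partial>circ)"

lemma M_nonneg: "0 \<le> M"
  using W_bound[of 0 0 0] by linarith

lemma V_integrable: "i \<le> 4 \<Longrightarrow> L1 u \<Longrightarrow> integrable circ (\<lambda>y. W i x y * u y)"
  by (intro integrable_mult_bounded[where B = M] W_measurable W_bound L1D)

lemma V_bound: "i \<le> 4 \<Longrightarrow> L1 u \<Longrightarrow> \<bar>V i u x\<bar> \<le> M * L1_norm u"
  unfolding V_def by (intro integral_mult_le_sup W_measurable W_bound L1D)

lemma V_add: "i \<le> 4 \<Longrightarrow> L1 u \<Longrightarrow> L1 v \<Longrightarrow> V i (\<lambda>y. u y + v y) x = V i u x + V i v x"
  unfolding V_def by (simp add: distrib_left V_integrable)

lemma V_cmult: "V i (\<lambda>y. a * u y) x = a * V i u x"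
  unfolding V_def by (simp add: mult.left_commute)

lemma V_periodic: "i \<le> 4 \<Longrightarrow> periodic1 (V i u)"
  unfolding V_def periodic1_def by (simp add: W_periodic)

lemma V_DERIV:
  assumes i: "i < 3" and u: "L1 u"
  shows "(V i u has_real_derivative V (Suc i) u x) (at x)"
proof (rule DERIV_of_second_order_bound)
  fix h
  have m: "(\<lambda>y. W i (x + h) y - W i x y - h * W (Suc i) x y) \<in> borel_measurable borel"
    using i by (intro borel_measurable_diff borel_measurable_times borel_measurable_const W_measurable) auto
  have "V i u (x + h) - V i u x - h * V (Suc i) u x
      = (\<integral>y. (W i (x + h) y - W i x y - h * W (Suc i) x y) * u y \<partial>circ)"
    unfolding V_def using i V_integrable[OF _ u, of i] V_integrable[OF _ u, of "Suc i"]
    by (simp add: left_diff_distrib mult.assoc)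
  also have "\<bar>\<dots>\<bar> \<le> (M * h\<^sup>2) * L1_norm u"
    using i by (intro integral_mult_le_sup m L1D u second_order_bound[OF W_deriv W_deriv W_bound]) auto
  finally show "\<bar>V i u (x + h) - V i u x - h * V (Suc i) u x\<bar> \<le> (M * L1_norm u) * h\<^sup>2"
    by (simp add: mult_ac)
qed

lemma V_continuous:
  assumes i: "i \<le> 3" and u: "L1 u"
  shows "continuous_on UNIV (V i u)"
proof -
  have "\<bar>V i u x - V i u y\<bar> \<le> (M * L1_norm u) * \<bar>x - y\<bar>" for x y
  proof -
    have m: "(\<lambda>z. W i x z - W i y z) \<in> borel_measurable borel"
      using i by (intro borel_measurable_diff W_measurable) auto
    have "V i u x - V i u y = (\<integral>z. (W i x z - W i y z) * u z \<partial>circ)"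
      unfolding V_def using i V_integrable[OF _ u, of i] by (simp add: left_diff_distrib)
    also have "\<bar>\<dots>\<bar> \<le> (M * \<bar>x - y\<bar>) * L1_norm u"
      using i by (intro integral_mult_le_sup m L1D u lipschitz_of_DERIV_bound[OF W_deriv W_bound]) auto
    finally show ?thesis by (simp add: mult_ac)
  qed
  moreover have "0 \<le> M * L1_norm u" using M_nonneg by simp
  ultimately have "(M * L1_norm u)-lipschitz_on UNIV (V i u)"
    by (intro lipschitz_onI) (auto simp: dist_real_def)
  then show ?thesis by (rule lipschitz_on_continuous_on)
qed

lemma V_measurable: "i \<le> 3 \<Longrightarrow> L1 u \<Longrightarrow> V i u \<in> borel_measurable borel"
  by (rule borel_measurable_continuous_onI[OF V_continuous])

definition S :: "(real \<Rightarrow> real) \<Rightarrow> real \<Rightarrow> real" where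
  "S h x = T x + \<epsilon> * V 0 h x"

lemma T_map_eq: "T_map T g \<epsilon> h = S h"
  by (simp add: T_map_def I_map_def fun_eq_iff S_def V_def W_0)

lemma S_DERIV: "L1 h \<Longrightarrow> (S h has_real_derivative deriv T x + \<epsilon> * V 1 h x) (at x)"
  unfolding S_def[abs_def] using V_DERIV[of 0 h x] T_deriv by (auto intro!: derivative_eq_intros)

lemma deriv_S: "L1 h \<Longrightarrow> deriv (S h) x = deriv T x + \<epsilon> * V 1 h x"
  by (rule DERIV_imp_deriv[OF S_DERIV])

lemma S_measurable: "L1 h \<Longrightarrow> S h \<in> borel_measurable borel"
  using S_DERIV DERIV_isCont
  by (intro borel_measurable_continuous_onI) (fastforce simp: continuous_on_eq_continuous_at)

lemma nonsingular_lift_S: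
  assumes h: "L1 h" and d: "\<And>x. deriv (S h) x \<noteq> 0"
  shows "nonsingular_lift (S h)"
  unfolding nonsingular_lift_def
proof (intro conjI allI)
  obtain d where "\<And>x. T (x + 1) = T x + of_int d" using T_lift by (auto simp: circle_lift_def)
  then show "circle_lift (S h)"
    unfolding circle_lift_def S_def using V_periodic[of 0 h]
    by (intro exI[of _ d]) (simp add: periodic1_def)
  show "\<exists>D. D \<noteq> 0 \<and> (S h has_real_derivative D) (at x)" for x
    using S_DERIV[OF h, of x] d[of x] by (auto simp: deriv_S[OF h])
qed

lemma S_perturb: "L1 h \<Longrightarrow> L1 u \<Longrightarrow> S (\<lambda>y. h y + u y) z = S h z + \<epsilon> * V 0 u z"
  by (simp add: S_def V_add distrib_left)

lemma deriv_S_perturb: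
  assumes "L1 h" "L1 u"
  shows "\<bar>deriv (S (\<lambda>y. h y + u y)) x - deriv (S h) x\<bar> \<le> \<epsilon> * M * L1_norm u"
proof -
  have "deriv (S (\<lambda>y. h y + u y)) x - deriv (S h) x = \<epsilon> * V 1 u x"
    using assms by (simp add: deriv_S L1_add V_add distrib_left)
  moreover have "\<epsilon> * \<bar>V 1 u x\<bar> \<le> \<epsilon> * (M * L1_norm u)"
    using assms eps_nonneg by (intro mult_left_mono V_bound) auto
  ultimately show ?thesis using eps_nonneg by (simp add: abs_mult)
qed

text \<open>By duality the discretised operator is an integral operator whose kernel depends smoothly on
  the argument through \<open>S h\<close>; its formal derivative is \<open>dPhi\<close>.\<close>

definition Phi :: "nat \<Rightarrow> (real \<Rightarrow> real) \<Rightarrow> real \<Rightarrow> real" where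
  "Phi N h x = (\<integral>z. fejer N (x - S h z) * h z \<partial>circ)"

definition dPhi :: "nat \<Rightarrow> (real \<Rightarrow> real) \<Rightarrow> (real \<Rightarrow> real) \<Rightarrow> real \<Rightarrow> real" where
  "dPhi N h u x = (\<integral>z. fejer N (x - S h z) * u z \<partial>circ)
     - \<epsilon> * (\<integral>z. deriv (fejer N) (x - S h z) * (V 0 u z * h z) \<partial>circ)"

lemma self_consistent_N_eq:
  assumes "N \<ge> 1" "L1 h" "\<And>x. deriv (S h) x \<noteq> 0"
  shows "self_consistent_N T g \<epsilon> N h = Phi N h"
  using Pi_N_transfer_op[OF assms(1) nonsingular_lift_S[OF assms(2,3)] assms(2)]
  by (simp add: self_consistent_N_def self_consistent_def T_map_eq Phi_def fun_eq_iff)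

lemma
  assumes i: "i \<le> 3" and u: "L1 u" and h: "L1 h"
  shows L1_V_mult: "L1 (\<lambda>z. V i u z * h z)"
    and L1_norm_V_mult: "L1_norm (\<lambda>z. V i u z * h z) \<le> M * L1_norm u * L1_norm h"
proof -
  have B: "\<bar>V i u x\<bar> \<le> M * L1_norm u" for x using i by (intro V_bound u) auto
  show L: "L1 (\<lambda>z. V i u z * h z)"
    using i by (intro L1_mult_bounded[OF h _ _ B] V_periodic V_measurable u) auto
  have "L1_norm (\<lambda>z. V i u z * h z) \<le> (\<integral>z. (M * L1_norm u) * \<bar>h z\<bar> \<partial>circ)"
    unfolding L1_norm_def[of "\<lambda>z. V i u z * h z"]
    using integrable_abs[OF L1D(2)[OF L]] L1D(2)[OF h] B
    by (intro integral_mono) (auto simp: abs_mult intro!: mult_right_mono)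
  then show "L1_norm (\<lambda>z. V i u z * h z) \<le> M * L1_norm u * L1_norm h" by (simp add: L1_norm_def)
qed

lemma V_mult_integrable: "L1 u \<Longrightarrow> L1 h \<Longrightarrow> integrable circ (\<lambda>z. V 0 u z * h z)"
  by (rule L1D(2)[OF L1_V_mult[OF le0]])

lemma kernel_measurable:
  "test_function \<kappa> \<Longrightarrow> L1 h \<Longrightarrow> (\<lambda>z. \<kappa> (x - S h z)) \<in> borel_measurable borel"
  by (rule measurable_compose[OF _ test_function_measurable])
     (auto intro!: borel_measurable_diff S_measurable)

lemma Phi_F_space: "N \<ge> 1 \<Longrightarrow> L1 h \<Longrightarrow> Phi N h \<in> F_space N"
  unfolding Phi_def by (intro F_space_average fejer_F_space S_measurable L1D)

lemma dPhi_F_space: "N \<ge> 1 \<Longrightarrow> L1 h \<Longrightarrow> L1 u \<Longrightarrow> dPhi N h u \<in> F_space N"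
  unfolding dPhi_def
  by (intro F_space_diff F_space_cmult F_space_average fejer_F_space F_space_deriv S_measurable
      L1D(2) V_mult_integrable)

lemma integral_deriv_test: "test_function \<phi> \<Longrightarrow> (\<integral>x. deriv \<phi> x \<partial>circ) = 0"
  using integral_circ_FTC_real[OF test_function_DERIV test_function_continuous[OF test_function_deriv], of \<phi>]
    test_function_periodic[of \<phi>] by (simp add: periodic1_def) (metis add_0)

lemma integral_Phi: "N \<ge> 1 \<Longrightarrow> L1 h \<Longrightarrow> (\<integral>x. Phi N h x \<partial>circ) = (\<integral>x. h x \<partial>circ)"
  unfolding Phi_def by (simp add: integral_average fejer_test S_measurable L1D integral_fejer)

lemma integral_dPhi:
  assumes "N \<ge> 1" "L1 h" "L1 u"
  shows "(\<integral>x. dPhi N h u x \<partial>circ) = (\<integral>x. u x \<partial>circ)"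
proof -
  note K = fejer_test[OF assms(1)]
  define a where "a x = (\<integral>z. fejer N (x - S h z) * u z \<partial>circ)" for x
  define b where "b x = (\<integral>z. deriv (fejer N) (x - S h z) * (V 0 u z * h z) \<partial>circ)" for x
  have "a \<in> F_space N" "b \<in> F_space N"
    unfolding a_def[abs_def] b_def[abs_def] using assms
    by (intro F_space_average fejer_F_space F_space_deriv S_measurable L1D(2) V_mult_integrable; simp)+
  then have i: "integrable circ a" "integrable circ b" by (auto intro: L1D F_space_L1)
  have "(\<integral>x. a x \<partial>circ) = (\<integral>x. u x \<partial>circ)"
    unfolding a_def using assms by (simp add: integral_average[OF K] S_measurable L1D integral_fejer)
  moreover have "(\<integral>x. b x \<partial>circ) = 0"
    unfolding b_def using assms
    by (simp add: integral_average[OF test_function_deriv[OF K]] S_measurable V_mult_integrable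
        integral_deriv_test[OF K])
  moreover have "(\<integral>x. dPhi N h u x \<partial>circ) = (\<integral>x. a x - \<epsilon> * b x \<partial>circ)" by (simp add: dPhi_def a_def b_def)
  ultimately show ?thesis using i by simp
qed

lemma
  assumes N: "N \<ge> 1" and h: "L1 h"
  shows dPhi_integrable1: "L1 u \<Longrightarrow> integrable circ (\<lambda>z. fejer N (x - S h z) * u z)"
    and dPhi_integrable2: "integrable circ w \<Longrightarrow> integrable circ (\<lambda>z. deriv (fejer N) (x - S h z) * w z)"
proof -
  obtain B where "\<And>x. \<bar>fejer N x\<bar> \<le> B" "\<And>x. \<bar>deriv (fejer N) x\<bar> \<le> B"
    using fejer_bounds[OF N] by metis
  then show "L1 u \<Longrightarrow> integrable circ (\<lambda>z. fejer N (x - S h z) * u z)"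
    and "integrable circ w \<Longrightarrow> integrable circ (\<lambda>z. deriv (fejer N) (x - S h z) * w z)"
    using kernel_measurable[OF fejer_test[OF N] h] kernel_measurable[OF test_function_deriv[OF fejer_test[OF N]] h]
    by (auto intro!: integrable_mult_bounded[where B = B] dest: L1D(2))
qed

lemma dPhi_add:
  assumes "N \<ge> 1" "L1 h" "L1 u" "L1 v"
  shows "dPhi N h (\<lambda>x. u x + v x) = (\<lambda>x. dPhi N h u x + dPhi N h v x)"
proof
  fix x
  note i = dPhi_integrable1[OF assms(1,2,3), of x] dPhi_integrable1[OF assms(1,2,4), of x]
    dPhi_integrable2[OF assms(1,2) V_mult_integrable[OF assms(3,2)], of x]
    dPhi_integrable2[OF assms(1,2) V_mult_integrable[OF assms(4,2)], of x]
  show "dPhi N h (\<lambda>x. u x + v x) x = dPhi N h u x + dPhi N h v x"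
    using i by (simp add: dPhi_def V_add[OF _ assms(3,4)] distrib_left distrib_right)
qed

lemma dPhi_cmult: "dPhi N h (\<lambda>x. a * u x) = (\<lambda>x. a * dPhi N h u x)"
proof
  fix x
  have "(\<integral>z. fejer N (x - S h z) * (a * u z) \<partial>circ) = a * (\<integral>z. fejer N (x - S h z) * u z \<partial>circ)"
    by (simp add: mult.left_commute)
  moreover have "(\<integral>z. deriv (fejer N) (x - S h z) * (a * V 0 u z * h z) \<partial>circ)
      = a * (\<integral>z. deriv (fejer N) (x - S h z) * (V 0 u z * h z) \<partial>circ)"
    by (simp add: mult.left_commute mult.assoc)
  ultimately show "dPhi N h (\<lambda>x. a * u x) x = a * dPhi N h u x"
    by (simp add: dPhi_def V_cmult right_diff_distrib)
qed

text \<open>The derivative, its dependence on the base point and the remainder are controlled by the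
  L1 norm, since the kernel is smooth.\<close>

lemma dPhi_bounds:
  assumes N: "N \<ge> 1"
  obtains B where "B \<ge> 0"
    "\<And>h u. L1 h \<Longrightarrow> L1 u \<Longrightarrow> L1_norm (dPhi N h u) \<le> B * (1 + L1_norm h) * L1_norm u"
    "\<And>h u. L1 h \<Longrightarrow> L1 u \<Longrightarrow>
      L1_norm (\<lambda>x. Phi N (\<lambda>y. h y + u y) x - Phi N h x - dPhi N h u x) \<le> B * (1 + L1_norm h) * (L1_norm u)\<^sup>2"
    "\<And>h v u. L1 h \<Longrightarrow> L1 v \<Longrightarrow> L1 u \<Longrightarrow>
      L1_norm (\<lambda>x. dPhi N (\<lambda>y. h y + v y) u x - dPhi N h u x)
        \<le> B * (1 + L1_norm h + L1_norm v) * L1_norm v * L1_norm u"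
proof -
  note K = fejer_test[OF N]
  note K' = test_function_deriv[OF K]
  note DK = test_function_DERIV[OF K]
  note DK' = test_function_DERIV[OF K']
  obtain B0 where B0: "B0 \<ge> 0" and bK: "\<And>x. \<bar>fejer N x\<bar> \<le> B0" and bK': "\<And>x. \<bar>deriv (fejer N) x\<bar> \<le> B0"
    and bK'': "\<And>x. \<bar>deriv (deriv (fejer N)) x\<bar> \<le> B0"
    using fejer_bounds[OF N] by metis
  define m where "m = \<epsilon> * M"
  have m: "0 \<le> m" using eps_nonneg M_nonneg by (simp add: m_def)
  have VE: "\<bar>\<epsilon> * V 0 u z\<bar> \<le> m * L1_norm u" if "L1 u" for u z
    using mult_left_mono[OF V_bound[OF _ that, of 0 z] eps_nonneg] eps_nonneg
    by (simp add: m_def abs_mult mult.assoc)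
  define B where "B = B0 * (1 + m) * (1 + m)"
  have B: "B \<ge> 0" using B0 m by (simp add: B_def)
  have mB: "B0 \<le> B" "B0 * m \<le> B" "B0 * m * m \<le> B" "B0 * m + B0 * m \<le> B"
    using B0 m by (simp_all add: B_def algebra_simps)
  have A1: "L1_norm (dPhi N h u) \<le> B * (1 + L1_norm h) * L1_norm u" if h: "L1 h" and u: "L1 u" for h u
  proof (rule L1_norm_le_sup[OF F_space_L1[OF dPhi_F_space[OF N h u]]])
    fix x
    have "\<bar>\<integral>z. fejer N (x - S h z) * u z \<partial>circ\<bar> \<le> B0 * L1_norm u"
      by (intro integral_mult_le_sup bK kernel_measurable K h L1D u)
    moreover have "\<bar>\<integral>z. deriv (fejer N) (x - S h z) * (V 0 u z * h z) \<partial>circ\<bar> \<le> B0 * L1_norm (\<lambda>z. V 0 u z * h z)"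
      by (intro integral_mult_le_sup bK' kernel_measurable K' h V_mult_integrable u)
    then have "\<bar>\<integral>z. deriv (fejer N) (x - S h z) * (V 0 u z * h z) \<partial>circ\<bar> \<le> B0 * (M * L1_norm u * L1_norm h)"
      using mult_left_mono[OF L1_norm_V_mult[OF le0 u h] B0] by linarith
    then have "\<bar>\<epsilon> * (\<integral>z. deriv (fejer N) (x - S h z) * (V 0 u z * h z) \<partial>circ)\<bar> \<le> \<epsilon> * (B0 * (M * L1_norm u * L1_norm h))"
      using eps_nonneg by (simp add: abs_mult mult_left_mono)
    ultimately have "\<bar>dPhi N h u x\<bar> \<le> B0 * L1_norm u + (B0 * m) * (L1_norm u * L1_norm h)"
      unfolding dPhi_def by (simp add: m_def mult_ac)
    also have "\<dots> \<le> B * L1_norm u + B * (L1_norm u * L1_norm h)"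
      by (intro add_mono mult_right_mono mB) auto
    finally show "\<bar>dPhi N h u x\<bar> \<le> B * (1 + L1_norm h) * L1_norm u" by (simp add: algebra_simps)
  qed
  have A2: "L1_norm (\<lambda>x. Phi N (\<lambda>y. h y + u y) x - Phi N h x - dPhi N h u x) \<le> B * (1 + L1_norm h) * (L1_norm u)\<^sup>2"
    if h: "L1 h" and u: "L1 u" for h u
  proof (rule L1_norm_le_sup)
    note hu = L1_add[OF h u]
    show "L1 (\<lambda>x. Phi N (\<lambda>y. h y + u y) x - Phi N h x - dPhi N h u x)"
      by (intro L1_diff F_space_L1[OF Phi_F_space] F_space_L1[OF dPhi_F_space] N h u hu)
    fix x
    let ?a = "\<lambda>z. x - S h z" and ?v = "\<lambda>z. - (\<epsilon> * V 0 u z)"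
    have Sv: "x - S (\<lambda>y. h y + u y) z = ?a z + ?v z" for z by (simp add: S_perturb[OF h u])
    have i0: "integrable circ (\<lambda>z. fejer N (?a z + ?v z) * w z)" if "L1 w" for w
      using dPhi_integrable1[OF N hu that, of x] by (simp add: Sv)
    have i1: "integrable circ (\<lambda>z. fejer N (?a z) * w z)" if "L1 w" for w
      by (rule dPhi_integrable1[OF N h that])
    have i2: "integrable circ (\<lambda>z. deriv (fejer N) (?a z) * (V 0 u z * h z))"
      by (rule dPhi_integrable2[OF N h V_mult_integrable[OF u h]])
    have km: "(\<lambda>z. fejer N (?a z + ?v z)) \<in> borel_measurable borel"
      using kernel_measurable[OF K hu, of x] by (simp add: Sv)
    have vm: "?v \<in> borel_measurable borel" using V_measurable[OF _ u, of 0] by simp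
    have "Phi N (\<lambda>y. h y + u y) x - Phi N h x - dPhi N h u x
        = (\<integral>z. fejer N (?a z + ?v z) * h z + fejer N (?a z + ?v z) * u z - fejer N (?a z) * h z
            - fejer N (?a z) * u z + \<epsilon> * (deriv (fejer N) (?a z) * (V 0 u z * h z)) \<partial>circ)"
      using i0[OF h] i0[OF u] i1[OF h] i1[OF u] i2
      by (simp add: Phi_def dPhi_def Sv distrib_left)
    also have "\<dots> = (\<integral>z. (fejer N (?a z + ?v z) - fejer N (?a z) - ?v z * deriv (fejer N) (?a z)) * h z
            + (fejer N (?a z + ?v z) - fejer N (?a z)) * u z \<partial>circ)"
      by (intro Bochner_Integration.integral_cong) (auto simp: algebra_simps)
    also have "\<dots> = (\<integral>z. (fejer N (?a z + ?v z) - fejer N (?a z) - ?v z * deriv (fejer N) (?a z)) * h z \<partial>circ)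
            + (\<integral>z. (fejer N (?a z + ?v z) - fejer N (?a z)) * u z \<partial>circ)"
    proof (rule Bochner_Integration.integral_add)
      have "integrable circ (\<lambda>z. fejer N (?a z + ?v z) * h z - fejer N (?a z) * h z
          + \<epsilon> * (deriv (fejer N) (?a z) * (V 0 u z * h z)))"
        using i0[OF h] i1[OF h] i2 by simp
      then show "integrable circ (\<lambda>z. (fejer N (?a z + ?v z) - fejer N (?a z) - ?v z * deriv (fejer N) (?a z)) * h z)"
        by (simp add: algebra_simps)
      show "integrable circ (\<lambda>z. (fejer N (?a z + ?v z) - fejer N (?a z)) * u z)"
        using i0[OF u] i1[OF u] by (simp add: left_diff_distrib)
    qed
    finally have eq: "Phi N (\<lambda>y. h y + u y) x - Phi N h x - dPhi N h u x = \<dots>" .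
    have q1: "\<bar>\<integral>z. (fejer N (?a z + ?v z) - fejer N (?a z) - ?v z * deriv (fejer N) (?a z)) * h z \<partial>circ\<bar>
        \<le> (B0 * (m * L1_norm u)\<^sup>2) * L1_norm h"
    proof (rule integral_mult_le_sup[OF L1D(2)[OF h]])
      show "(\<lambda>z. fejer N (?a z + ?v z) - fejer N (?a z) - ?v z * deriv (fejer N) (?a z)) \<in> borel_measurable borel"
        by (intro borel_measurable_diff borel_measurable_times km vm kernel_measurable K K' h)
      fix z
      have "\<bar>fejer N (?a z + ?v z) - fejer N (?a z) - ?v z * deriv (fejer N) (?a z)\<bar> \<le> B0 * (?v z)\<^sup>2"
        by (rule second_order_bound[OF DK DK' bK''])
      also have "(?v z)\<^sup>2 = \<bar>\<epsilon> * V 0 u z\<bar>\<^sup>2" by simp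
      also have "B0 * \<dots> \<le> B0 * (m * L1_norm u)\<^sup>2"
        by (intro mult_left_mono power_mono VE u B0) auto
      finally show "\<bar>fejer N (?a z + ?v z) - fejer N (?a z) - ?v z * deriv (fejer N) (?a z)\<bar> \<le> B0 * (m * L1_norm u)\<^sup>2" .
    qed
    have q2: "\<bar>\<integral>z. (fejer N (?a z + ?v z) - fejer N (?a z)) * u z \<partial>circ\<bar> \<le> (B0 * (m * L1_norm u)) * L1_norm u"
    proof (rule integral_mult_le_sup[OF L1D(2)[OF u]])
      show "(\<lambda>z. fejer N (?a z + ?v z) - fejer N (?a z)) \<in> borel_measurable borel"
        by (intro borel_measurable_diff km kernel_measurable K h)
      fix z
      have "\<bar>fejer N (?a z + ?v z) - fejer N (?a z)\<bar> \<le> B0 * \<bar>(?a z + ?v z) - ?a z\<bar>"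
        by (rule lipschitz_of_DERIV_bound[OF DK bK'])
      also have "\<dots> \<le> B0 * (m * L1_norm u)" using VE[OF u, of z] by (intro mult_left_mono B0) simp
      finally show "\<bar>fejer N (?a z + ?v z) - fejer N (?a z)\<bar> \<le> B0 * (m * L1_norm u)" .
    qed
    have "\<bar>Phi N (\<lambda>y. h y + u y) x - Phi N h x - dPhi N h u x\<bar>
        \<le> (B0 * (m * L1_norm u)\<^sup>2) * L1_norm h + (B0 * (m * L1_norm u)) * L1_norm u"
      unfolding eq using q1 q2 by linarith
    also have "\<dots> = (B0 * m * m) * ((L1_norm u)\<^sup>2 * L1_norm h) + (B0 * m) * (L1_norm u)\<^sup>2"
      by (simp add: power2_eq_square mult_ac)
    also have "\<dots> \<le> B * ((L1_norm u)\<^sup>2 * L1_norm h) + B * (L1_norm u)\<^sup>2"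
      by (intro add_mono mult_right_mono mB) auto
    finally show "\<bar>Phi N (\<lambda>y. h y + u y) x - Phi N h x - dPhi N h u x\<bar> \<le> B * (1 + L1_norm h) * (L1_norm u)\<^sup>2"
      by (simp add: algebra_simps)
  qed
  have A3: "L1_norm (\<lambda>x. dPhi N (\<lambda>y. h y + v y) u x - dPhi N h u x)
        \<le> B * (1 + L1_norm h + L1_norm v) * L1_norm v * L1_norm u"
    if h: "L1 h" and v: "L1 v" and u: "L1 u" for h v u
  proof (rule L1_norm_le_sup)
    note hv = L1_add[OF h v]
    show "L1 (\<lambda>x. dPhi N (\<lambda>y. h y + v y) u x - dPhi N h u x)"
      by (intro L1_diff F_space_L1[OF dPhi_F_space] N h u hv)
    fix x
    let ?a = "\<lambda>z. x - S h z" and ?b = "\<lambda>z. x - S (\<lambda>y. h y + v y) z"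
    define wh where "wh z = V 0 u z * h z" for z
    define wv where "wv z = V 0 u z * v z" for z
    have w: "V 0 u z * (h z + v z) = wh z + wv z" for z by (simp add: wh_def wv_def distrib_left)
    have wi: "integrable circ wh" "integrable circ wv"
      unfolding wh_def[abs_def] wv_def[abs_def] by (intro V_mult_integrable u h v)+
    have wn: "L1_norm wh \<le> M * L1_norm u * L1_norm h" "L1_norm wv \<le> M * L1_norm u * L1_norm v"
      unfolding wh_def[abs_def] wv_def[abs_def] by (intro L1_norm_V_mult le0 u h v)+
    have ab: "\<bar>?b z - ?a z\<bar> \<le> m * L1_norm v" for z
      using VE[OF v, of z] by (simp add: S_perturb[OF h v])
    note j = dPhi_integrable1[OF N hv u, of x] dPhi_integrable1[OF N h u, of x]
      dPhi_integrable2[OF N hv wi(1), of x] dPhi_integrable2[OF N hv wi(2), of x] dPhi_integrable2[OF N h wi(1), of x]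
    have "dPhi N (\<lambda>y. h y + v y) u x - dPhi N h u x
      = (\<integral>z. (fejer N (?b z) - fejer N (?a z)) * u z \<partial>circ)
        - \<epsilon> * (\<integral>z. (deriv (fejer N) (?b z) - deriv (fejer N) (?a z)) * wh z \<partial>circ)
        - \<epsilon> * (\<integral>z. deriv (fejer N) (?b z) * wv z \<partial>circ)"
      unfolding dPhi_def w wh_def[symmetric] using j
      by (simp add: left_diff_distrib distrib_left right_diff_distrib)
    moreover have "\<bar>\<integral>z. (fejer N (?b z) - fejer N (?a z)) * u z \<partial>circ\<bar> \<le> (B0 * (m * L1_norm v)) * L1_norm u"
    proof (rule integral_mult_le_sup[OF L1D(2)[OF u]])
      show "(\<lambda>z. fejer N (?b z) - fejer N (?a z)) \<in> borel_measurable borel"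
        by (intro borel_measurable_diff kernel_measurable K h hv)
      show "\<bar>fejer N (?b z) - fejer N (?a z)\<bar> \<le> B0 * (m * L1_norm v)" for z
        by (rule order_trans[OF lipschitz_of_DERIV_bound[OF DK bK'] mult_left_mono[OF ab B0]])
    qed
    moreover have "\<bar>\<epsilon> * (\<integral>z. (deriv (fejer N) (?b z) - deriv (fejer N) (?a z)) * wh z \<partial>circ)\<bar>
        \<le> \<epsilon> * ((B0 * (m * L1_norm v)) * (M * L1_norm u * L1_norm h))"
    proof -
      have "\<bar>\<integral>z. (deriv (fejer N) (?b z) - deriv (fejer N) (?a z)) * wh z \<partial>circ\<bar> \<le> (B0 * (m * L1_norm v)) * L1_norm wh"
      proof (rule integral_mult_le_sup[OF wi(1)])
        show "(\<lambda>z. deriv (fejer N) (?b z) - deriv (fejer N) (?a z)) \<in> borel_measurable borel"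
          by (intro borel_measurable_diff kernel_measurable K' h hv)
        show "\<bar>deriv (fejer N) (?b z) - deriv (fejer N) (?a z)\<bar> \<le> B0 * (m * L1_norm v)" for z
          by (rule order_trans[OF lipschitz_of_DERIV_bound[OF DK' bK''] mult_left_mono[OF ab B0]])
      qed
      also have "\<dots> \<le> (B0 * (m * L1_norm v)) * (M * L1_norm u * L1_norm h)"
        using wn(1) B0 m by (intro mult_left_mono) auto
      finally show ?thesis using eps_nonneg by (simp add: abs_mult mult_left_mono)
    qed
    moreover have "\<bar>\<epsilon> * (\<integral>z. deriv (fejer N) (?b z) * wv z \<partial>circ)\<bar> \<le> \<epsilon> * (B0 * (M * L1_norm u * L1_norm v))"
    proof -
      have "\<bar>\<integral>z. deriv (fejer N) (?b z) * wv z \<partial>circ\<bar> \<le> B0 * L1_norm wv"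
        by (intro integral_mult_le_sup wi bK' kernel_measurable K' hv)
      also have "\<dots> \<le> B0 * (M * L1_norm u * L1_norm v)" using wn(2) B0 by (intro mult_left_mono) auto
      finally show ?thesis using eps_nonneg by (simp add: abs_mult mult_left_mono)
    qed
    ultimately have "\<bar>dPhi N (\<lambda>y. h y + v y) u x - dPhi N h u x\<bar>
      \<le> (B0 * (m * L1_norm v)) * L1_norm u + \<epsilon> * ((B0 * (m * L1_norm v)) * (M * L1_norm u * L1_norm h))
        + \<epsilon> * (B0 * (M * L1_norm u * L1_norm v))" by linarith
    also have "\<dots> = (B0 * m + B0 * m) * (L1_norm v * L1_norm u) + (B0 * m * m) * (L1_norm v * L1_norm u * L1_norm h)"
      by (simp add: m_def algebra_simps)
    also have "\<dots> \<le> B * (L1_norm v * L1_norm u) + B * (L1_norm v * L1_norm u * L1_norm h)"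
      by (intro add_mono mult_right_mono mB mult_nonneg_nonneg L1_norm_nonneg)
    also have "\<dots> \<le> B * (L1_norm v * L1_norm u) + B * (L1_norm v * L1_norm u * L1_norm h)
        + B * (L1_norm v * L1_norm u * L1_norm v)"
      using B by simp
    finally show "\<bar>dPhi N (\<lambda>y. h y + v y) u x - dPhi N h u x\<bar>
        \<le> B * (1 + L1_norm h + L1_norm v) * L1_norm v * L1_norm u" by (simp add: algebra_simps)
  qed
  show ?thesis by (rule that[OF B A1 A2 A3])
qed

end

context smooth_coupling
begin

lemma self_consistent_N_near:
  assumes N: "N \<ge> 1" and f: "L1 f" and c: "c > 0" "\<And>x. c \<le> \<bar>deriv (S f) x\<bar>"
    and u: "L1 u" "\<epsilon> * M * L1_norm u < c"
  shows "self_consistent_N T g \<epsilon> N (\<lambda>x. f x + u x) = Phi N (\<lambda>x. f x + u x)"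
proof (rule self_consistent_N_eq[OF N L1_add[OF f u(1)]])
  show "deriv (S (\<lambda>x. f x + u x)) x \<noteq> 0" for x
    using deriv_S_perturb[OF f u(1), of x] c(2)[of x] u(2) by linarith
qed

lemma
  assumes N: "N \<ge> 1" and f: "f \<in> F_space N" and c: "c > 0" "\<And>x. c \<le> \<bar>deriv (S f) x\<bar>"
  shows has_frechet_dPhi: "has_frechet_F N (self_consistent_N T g \<epsilon> N) f (dPhi N f)"
    and frechet_F_dPhi: "u \<in> F_space N \<Longrightarrow> frechet_F N (self_consistent_N T g \<epsilon> N) f u = dPhi N f u"
proof -
  let ?\<Phi> = "self_consistent_N T g \<epsilon> N"
  note fL = F_space_L1[OF f]
  have m: "0 \<le> \<epsilon> * M" using eps_nonneg M_nonneg by simp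
  define d0 where "d0 = c / (\<epsilon> * M + 1)"
  have d0: "d0 > 0" using c m by (simp add: d0_def add_nonneg_pos)
  have small: "\<epsilon> * M * L1_norm u < c" if "sobolev_norm 1 u < d0" for u
  proof -
    have "(\<epsilon> * M + 1) * L1_norm u \<le> (\<epsilon> * M + 1) * sobolev_norm 1 u"
      using m by (intro mult_left_mono L1_norm_le_sobolev_norm) auto
    also have "\<dots> < (\<epsilon> * M + 1) * d0" using that m by (intro mult_strict_left_mono) auto
    also have "\<dots> = c" using m by (simp add: d0_def add_nonneg_eq_0_iff)
    finally have "\<epsilon> * M * L1_norm u + L1_norm u < c" by (simp add: distrib_right)
    then show ?thesis using L1_norm_nonneg[of u] by linarith
  qed
  have \<Phi>u: "?\<Phi> (\<lambda>x. f x + u x) = Phi N (\<lambda>x. f x + u x)" if "u \<in> F_space N" "sobolev_norm 1 u < d0" for u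
    by (rule self_consistent_N_near[OF N fL c F_space_L1[OF that(1)] small[OF that(2)]])
  have c0: "deriv (S f) x \<noteq> 0" for x using c(1) c(2)[of x] by auto
  have \<Phi>f: "?\<Phi> f = Phi N f" by (rule self_consistent_N_eq[OF N fL c0])
  obtain B where B: "B \<ge> 0"
    "\<And>h u. L1 h \<Longrightarrow> L1 u \<Longrightarrow> L1_norm (dPhi N h u) \<le> B * (1 + L1_norm h) * L1_norm u"
    "\<And>h u. L1 h \<Longrightarrow> L1 u \<Longrightarrow>
      L1_norm (\<lambda>x. Phi N (\<lambda>y. h y + u y) x - Phi N h x - dPhi N h u x) \<le> B * (1 + L1_norm h) * (L1_norm u)\<^sup>2"
    by (rule dPhi_bounds[OF N]) blast
  obtain C where C: "C \<ge> 0" "\<And>f. f \<in> F_space N \<Longrightarrow> sobolev_norm 1 f \<le> C * L1_norm f"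
    using F_space_sobolev_norm_bound[of N 1] by blast
  define E where "E = C * (B * (1 + L1_norm f))"
  have E: "E \<ge> 0" using B(1) C(1) by (simp add: E_def)
  show D: "has_frechet_F N ?\<Phi> f (dPhi N f)"
    unfolding has_frechet_F_def
  proof (intro conjI ballI allI impI)
    show "f \<in> F_space N" by (rule f)
    show "dPhi N f u \<in> F_space N" if "u \<in> F_space N" for u
      by (rule dPhi_F_space[OF N fL F_space_L1[OF that]])
    show "dPhi N f (\<lambda>x. u x + v x) = (\<lambda>x. dPhi N f u x + dPhi N f v x)" if "u \<in> F_space N" "v \<in> F_space N" for u v
      by (rule dPhi_add[OF N fL F_space_L1[OF that(1)] F_space_L1[OF that(2)]])
    show "dPhi N f (\<lambda>x. a * u x) = (\<lambda>x. a * dPhi N f u x)" for a u by (rule dPhi_cmult)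
    show "\<exists>B. \<forall>u\<in>F_space N. sobolev_norm 1 (dPhi N f u) \<le> B * sobolev_norm 1 u"
    proof (intro exI ballI)
      fix u assume u: "u \<in> F_space N"
      have "sobolev_norm 1 (dPhi N f u) \<le> C * L1_norm (dPhi N f u)"
        by (rule C(2)[OF dPhi_F_space[OF N fL F_space_L1[OF u]]])
      also have "\<dots> \<le> C * (B * (1 + L1_norm f) * L1_norm u)"
        by (intro mult_left_mono B(2) fL F_space_L1[OF u] C(1))
      also have "\<dots> = E * L1_norm u" by (simp add: E_def mult.assoc)
      also have "\<dots> \<le> E * sobolev_norm 1 u" by (intro mult_left_mono L1_norm_le_sobolev_norm E)
      finally show "sobolev_norm 1 (dPhi N f u) \<le> E * sobolev_norm 1 u" .
    qed
    fix \<eta> :: real assume \<eta>: "0 < \<eta>"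
    show "\<exists>\<delta>>0. \<forall>u\<in>F_space N. sobolev_norm 1 u < \<delta> \<longrightarrow>
      sobolev_norm 1 (\<lambda>x. ?\<Phi> (\<lambda>y. f y + u y) x - ?\<Phi> f x - dPhi N f u x) \<le> \<eta> * sobolev_norm 1 u"
    proof (intro exI conjI ballI impI)
      show "0 < min d0 (\<eta> / (E + 1))" using d0 \<eta> E by simp
      fix u assume u: "u \<in> F_space N" and us: "sobolev_norm 1 u < min d0 (\<eta> / (E + 1))"
      note uL = F_space_L1[OF u]
      let ?R = "\<lambda>x. Phi N (\<lambda>y. f y + u y) x - Phi N f x - dPhi N f u x"
      have RF: "?R \<in> F_space N"
        by (intro F_space_diff Phi_F_space dPhi_F_space N fL uL L1_add)
      have s: "0 \<le> sobolev_norm 1 u" by simp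
      have "sobolev_norm 1 ?R \<le> C * L1_norm ?R" by (rule C(2)[OF RF])
      also have "\<dots> \<le> C * (B * (1 + L1_norm f) * (L1_norm u)\<^sup>2)"
        by (intro mult_left_mono B(3) fL uL C(1))
      also have "\<dots> = E * (L1_norm u)\<^sup>2" by (simp add: E_def mult.assoc)
      also have "\<dots> \<le> E * (sobolev_norm 1 u)\<^sup>2"
        by (intro mult_left_mono power_mono L1_norm_le_sobolev_norm E) auto
      also have "\<dots> = (E * sobolev_norm 1 u) * sobolev_norm 1 u" by (simp add: power2_eq_square)
      also have "\<dots> \<le> \<eta> * sobolev_norm 1 u"
      proof (rule mult_right_mono[OF _ s])
        have "E * sobolev_norm 1 u \<le> (E + 1) * sobolev_norm 1 u" using s by (intro mult_right_mono) auto
        also have "\<dots> \<le> (E + 1) * (\<eta> / (E + 1))" using us E by (intro mult_left_mono) auto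
        also have "\<dots> = \<eta>" using E by simp
        finally show "E * sobolev_norm 1 u \<le> \<eta>" .
      qed
      finally show "sobolev_norm 1 (\<lambda>x. ?\<Phi> (\<lambda>y. f y + u y) x - ?\<Phi> f x - dPhi N f u x) \<le> \<eta> * sobolev_norm 1 u"
        using \<Phi>u[OF u] us by (simp add: \<Phi>f)
    qed
  qed
  have \<Phi>F: "?\<Phi> (\<lambda>x. f x + u x) \<in> F_space N" if "u \<in> F_space N" "sobolev_norm 1 u < d0" for u
    unfolding \<Phi>u[OF that] by (intro Phi_F_space N L1_add fL F_space_L1[OF that(1)])
  have \<Phi>fF: "?\<Phi> f \<in> F_space N" unfolding \<Phi>f by (rule Phi_F_space[OF N fL])
  show "frechet_F N ?\<Phi> f u = dPhi N f u" if "u \<in> F_space N" for u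
    using frechet_F_eq[where \<Phi> = ?\<Phi> and N = N and f = f and D = "dPhi N f"] D that d0 \<Phi>F \<Phi>fF by blast
qed

text \<open>By Leibniz' rule the first three derivatives and the product itself are sums of products
  \<open>V i u * D k h\<close> with binomial coefficients. Over all four lines the coefficients for \<open>k\<close> = 0, 1, 2, 3
  add up to 4, 6, 4, 1, whence the factor 6.\<close>

lemma
  assumes u: "L1 u" and h: "test_function h"
  shows sobolev_V_mult: "sobolev 3 (\<lambda>z. V 0 u z * h z)"
    and sobolev_norm_V_mult: "sobolev_norm 3 (\<lambda>z. V 0 u z * h z) \<le> 6 * (M * L1_norm u) * sobolev_norm 3 h"
proof -
  define D where "D i = (deriv ^^ i) h" for i
  have Dt: "test_function (D i)" for i unfolding D_def by (rule test_function_funpow[OF h])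
  have Dd: "(D i has_real_derivative D (Suc i) x) (at x)" for i x
    using test_function_DERIV[OF Dt[of i]] by (simp add: D_def)
  define Y where "Y i j = (\<lambda>z. V i u z * D j z)" for i j
  have Yd: "(Y i j has_real_derivative Y (Suc i) j x + Y i (Suc j) x) (at x)" if "i < 3" for i j x
    unfolding Y_def using DERIV_mult[OF V_DERIV[OF that u] Dd[of j x]] by (simp add: mult.commute)
  have Yc: "continuous_on UNIV (Y i j)" if "i \<le> 3" for i j
    unfolding Y_def by (intro continuous_on_mult V_continuous that u test_function_continuous Dt)
  have Yp: "periodic1 (Y i j)" if "i \<le> 3" for i j
    using V_periodic[of i u] test_function_periodic[OF Dt[of j]] that by (simp add: Y_def periodic1_def)
  have YL: "L1 (Y i j)" if "i \<le> 3" for i j by (rule L1_continuous[OF Yp[OF that] Yc[OF that]])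
  have Yn: "L1_norm (Y i j) \<le> M * L1_norm u * L1_norm (D j)" if "i \<le> 3" for i j
    unfolding Y_def by (rule L1_norm_V_mult[OF that u test_function_L1[OF Dt]])
  define p where "p i = (\<lambda>x. [Y 0 0 x, Y 1 0 x + Y 0 1 x, Y 2 0 x + 2 * Y 1 1 x + Y 0 2 x,
    Y 3 0 x + 3 * Y 2 1 x + 3 * Y 1 2 x + Y 0 3 x] ! i)" for i
  have p: "p 0 = (\<lambda>x. Y 0 0 x)" "p 1 = (\<lambda>x. Y 1 0 x + Y 0 1 x)" "p 2 = (\<lambda>x. Y 2 0 x + 2 * Y 1 1 x + Y 0 2 x)"
    "p 3 = (\<lambda>x. Y 3 0 x + 3 * Y 2 1 x + 3 * Y 1 2 x + Y 0 3 x)"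
    by (simp_all add: p_def)
  have cases: "i = 0 \<or> i = 1 \<or> i = 2 \<or> i = 3" if "i \<le> 3" for i :: nat using that by linarith
  have pp: "periodic1 (p i)" if "i \<le> 3" for i
    using cases[OF that] Yp unfolding periodic1_def by (elim disjE) (simp_all add: p del: One_nat_def)
  have pc: "continuous_on UNIV (p i)" if "i \<le> 3" for i
    using cases[OF that]
    by (elim disjE; simp only: p) (intro continuous_on_add continuous_on_mult continuous_on_const Yc; simp)+
  have pd: "(p i has_real_derivative p (Suc i) x) (at x)" if "i < 3" for i x
  proof -
    have Yd': "(Y 0 0 has_real_derivative Y 1 0 x + Y 0 1 x) (at x)"
      "(Y 1 0 has_real_derivative Y 2 0 x + Y 1 1 x) (at x)" "(Y 0 1 has_real_derivative Y 1 1 x + Y 0 2 x) (at x)"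
      "(Y 2 0 has_real_derivative Y 3 0 x + Y 2 1 x) (at x)" "(Y 1 1 has_real_derivative Y 2 1 x + Y 1 2 x) (at x)"
      "(Y 0 2 has_real_derivative Y 1 2 x + Y 0 3 x) (at x)"
      using Yd[of 0 0 x] Yd[of 1 0 x] Yd[of 0 1 x] Yd[of 2 0 x] Yd[of 1 1 x] Yd[of 0 2 x]
      by (simp_all add: eval_nat_numeral)
    have 0: "(p 0 has_real_derivative p 1 x) (at x)" unfolding p using Yd'(1) by simp
    have 1: "(p 1 has_real_derivative p 2 x) (at x)"
      unfolding p using DERIV_add[OF Yd'(2,3)] by (simp add: algebra_simps)
    have 2: "(p 2 has_real_derivative p 3 x) (at x)"
      unfolding p using DERIV_add[OF DERIV_add[OF Yd'(4) DERIV_cmult[OF Yd'(5), of 2]] Yd'(6)]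
      by (simp add: algebra_simps)
    have "i = 0 \<or> i = 1 \<or> i = 2" using that by linarith
    then show ?thesis using 0 1 2 by (auto simp: eval_nat_numeral)
  qed
  have w: "has_weak_deriv j (p 0) (p j)" if "j \<le> 3" for j
    by (rule has_weak_deriv_classical[where p = p and k = 3]) (use pp pc pd that in auto)
  have p0: "p 0 = (\<lambda>z. V 0 u z * h z)" by (simp add: p Y_def D_def)
  show "sobolev 3 (\<lambda>z. V 0 u z * h z)"
    unfolding p0[symmetric] by (rule sobolevI[OF L1_continuous[OF pp pc] w]) auto
  define m where "m = M * L1_norm u"
  have m: "0 \<le> m" using M_nonneg by (simp add: m_def)
  have Yn': "L1_norm (Y i j) \<le> m * L1_norm (D j)" if "i \<le> 3" for i j
    using Yn[OF that] by (simp add: m_def)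
  have cY: "L1_norm (\<lambda>x. c * Y i j x) \<le> c * (m * L1_norm (D j))" if "i \<le> 3" "c \<ge> 0" for c i j
    unfolding L1_norm_cmult using Yn'[OF that(1)] that(2) by (simp add: mult_left_mono)
  have "L1_norm (p 0) \<le> m * L1_norm (D 0)" unfolding p using Yn'[of 0 0] by simp
  moreover have "L1_norm (p 1) \<le> m * L1_norm (D 0) + m * L1_norm (D 1)"
    unfolding p by (rule order_trans[OF L1_norm_add add_mono]) (auto intro!: YL Yn')
  moreover have "L1_norm (p 2) \<le> m * L1_norm (D 0) + 2 * (m * L1_norm (D 1)) + m * L1_norm (D 2)"
    unfolding p
    by (intro order_trans[OF L1_norm_add add_mono] L1_add L1_cmult YL Yn' cY) auto
  moreover have "L1_norm (p 3) \<le> m * L1_norm (D 0) + 3 * (m * L1_norm (D 1)) + 3 * (m * L1_norm (D 2)) + m * L1_norm (D 3)"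
    unfolding p
    by (intro order_trans[OF L1_norm_add add_mono] L1_add L1_cmult YL Yn' cY) auto
  moreover have "0 \<le> m * L1_norm (D 0)" "0 \<le> m * L1_norm (D 1)" "0 \<le> m * L1_norm (D 2)"
    "0 \<le> m * L1_norm (D 3)"
    using m by simp_all
  ultimately have "L1_norm (p 0) + (L1_norm (p 1) + L1_norm (p 2) + L1_norm (p 3))
      \<le> 6 * (m * L1_norm (D 0)) + 6 * (m * L1_norm (D 1)) + 6 * (m * L1_norm (D 2)) + 6 * (m * L1_norm (D 3))"
    by argo
  moreover have "sobolev_norm 3 (p 0) = L1_norm (p 0) + (\<Sum>j=1..3. L1_norm (p j))"
    by (rule sobolev_norm_eq) (auto intro: w)
  moreover have "sobolev_norm 3 h = L1_norm h + (\<Sum>j=1..3. L1_norm (D j))"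
    unfolding D_def by (rule sobolev_norm_eq[OF test_function_has_weak_deriv[OF h]])
  moreover have "(\<Sum>j=1..3. a j) = a 1 + a 2 + a 3" for a :: "nat \<Rightarrow> real"
    by (simp add: eval_nat_numeral)
  ultimately have "sobolev_norm 3 (p 0) \<le> 6 * (m * sobolev_norm 3 h)"
    by (simp add: D_def distrib_left)
  then show "sobolev_norm 3 (\<lambda>z. V 0 u z * h z) \<le> 6 * (M * L1_norm u) * sobolev_norm 3 h"
    by (simp add: p0 m_def mult.assoc)
qed

text \<open>The derivative as an operator built from the transfer operator: integrating by parts moves the
  derivative of the kernel to the transferred function.\<close>

lemma dPhi_eq:
  assumes N: "N \<ge> 1" and h: "L1 h" and ns: "\<And>x. deriv (S h) x \<noteq> 0" and u: "L1 u"
    and \<rho>: "\<rho> = transfer_op (S h) (\<lambda>z. V 0 u z * h z)" "sobolev 1 \<rho>"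
  shows "dPhi N h u x = Pi_N N (transfer_op (S h) u) x - \<epsilon> * Pi_N N (weak_deriv 1 \<rho>) x"
proof -
  note Sn = nonsingular_lift_S[OF h ns]
  note K' = test_function_deriv[OF fejer_test[OF N]]
  have wL: "L1 (\<lambda>z. V 0 u z * h z)" by (rule L1_V_mult[OF le0 u h])
  have \<rho>L: "L1 \<rho>" by (rule sobolev_L1[OF \<rho>(2)])
  have w1: "has_weak_deriv 1 \<rho> (weak_deriv 1 \<rho>)" by (rule sobolev_has_weak_deriv[OF \<rho>(2)]) auto
  have "(\<integral>z. deriv (fejer N) (x - S h z) * (V 0 u z * h z) \<partial>circ) = (\<integral>z. deriv (fejer N) (x - z) * \<rho> z \<partial>circ)"
    unfolding \<rho>(1)
    by (rule is_transferD[OF is_transfer_transfer_op[OF Sn wL] Linf_test_function[OF test_function_reflect(1)[OF K']]])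
  also have "\<dots> = deriv (Pi_N N \<rho>) x"
    using F_space_average_deriv[OF fejer_F_space[OF N], of "\<lambda>z. z" \<rho> 1] L1D(2)[OF \<rho>L]
    by (simp add: Pi_N_def[abs_def])
  also have "\<dots> = Pi_N N (weak_deriv 1 \<rho>) x" using Pi_N_funpow_deriv[OF N \<rho>L w1] by simp
  finally show ?thesis by (simp add: dPhi_def Pi_N_transfer_op[OF N Sn u])
qed

end

section \<open>Estimates at a fixed point of the discretised operator\<close>

text \<open>The Lasota-Yorke inequality for a single step, its consequence for the iterates of the constant
  density and the decay on functions of mean zero are recorded for the one map \<open>S h\<close> given by the fixed
  point \<open>h\<close>; the discretisation enters only through the averages \<open>Pi_N N\<close>.\<close>

locale discretised_fixed_point = smooth_coupling +
  fixes N :: nat and h :: "real \<Rightarrow> real" and lam C_LY C_gap \<theta> K :: real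
  assumes N: "N \<ge> 1"
    and h_ball: "h \<in> B_ball K"
    and h_fixed: "Phi N h = h"
    and expanding: "\<And>x. deriv (S h) x \<noteq> 0"
    and lam: "0 < lam" "lam < 1"
    and C_LY: "0 < C_LY"
    and LY: "\<And>i \<psi>. i \<in> {1..3} \<Longrightarrow> sobolev i \<psi> \<Longrightarrow> sobolev i (transfer_op (S h) \<psi>) \<and>
      sobolev_norm i (transfer_op (S h) \<psi>) \<le> lam ^ i * sobolev_norm i \<psi> + C_LY * sobolev_norm (i - 1) \<psi>"
    and LY_one: "\<And>n. sobolev_norm 2 ((transfer_op (S h) ^^ n) (\<lambda>_. 1)) \<le> lam ^ (2 * n) + C_LY"
    and gap_const: "0 < C_gap" "0 < \<theta>" "\<theta> < 1"
    and gap: "\<And>i n \<psi>. i \<in> {1, 2} \<Longrightarrow> sobolev i \<psi> \<Longrightarrow> (\<integral>x. \<psi> x \<partial>circ) = 0 \<Longrightarrow>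
      sobolev i ((transfer_op (S h) ^^ n) \<psi>) \<and>
      sobolev_norm i ((transfer_op (S h) ^^ n) \<psi>) \<le> C_gap * \<theta> ^ n * sobolev_norm i \<psi>"
begin

abbreviation P :: "(real \<Rightarrow> real) \<Rightarrow> real \<Rightarrow> real" where
  "P \<equiv> transfer_op (S h)"

lemma h_L1: "L1 h" and h_integral: "(\<integral>x. h x \<partial>circ) = 1" and h_norm2_le: "sobolev_norm 2 h \<le> K"
  using h_ball by (auto simp: B_ball_def D1_def)

lemma h_F: "h \<in> F_space N"
  using Phi_F_space[OF N h_L1] by (simp add: h_fixed)

lemma h_test: "test_function h"
  by (rule F_space_test_function[OF h_F])

lemma S_nonsingular: "nonsingular_lift (S h)"
  by (rule nonsingular_lift_S[OF h_L1 expanding])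

lemma h_eq: "h = Pi_N N (P h)"
proof
  fix x
  have "h x = Phi N h x" by (simp add: h_fixed)
  then show "h x = Pi_N N (P h) x" by (simp add: Phi_def Pi_N_transfer_op[OF N S_nonsingular h_L1])
qed

lemma lam_power_le: "lam ^ i \<le> 1"
  using lam by (intro power_le_one) auto

lemma P_norm_le:
  assumes "i \<in> {1..3}" "sobolev i \<psi>"
  shows "sobolev_norm i (P \<psi>) \<le> (1 + C_LY) * sobolev_norm i \<psi>"
proof -
  have "lam ^ i * sobolev_norm i \<psi> \<le> 1 * sobolev_norm i \<psi>"
    by (intro mult_right_mono lam_power_le) auto
  moreover have "C_LY * sobolev_norm (i - 1) \<psi> \<le> C_LY * sobolev_norm i \<psi>"
    using C_LY by (intro mult_left_mono sobolev_norm_mono) auto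
  ultimately show ?thesis using LY[OF assms] by (simp add: distrib_right)
qed

text \<open>Averages are contractions in every Sobolev norm, so the Lasota-Yorke inequality bounds the \<open>W\<^sup>3\<^sup>,\<^sup>1\<close>
  norm of the fixed point by a fraction of itself plus a multiple of its \<open>W\<^sup>2\<^sup>,\<^sup>1\<close> norm. The third
  derivative is what makes averaging close to the identity in \<open>W\<^sup>2\<^sup>,\<^sup>1\<close>.\<close>

lemma h_norm3_le: "sobolev_norm 3 h \<le> C_LY * K / (1 - lam ^ 3)"
proof -
  have s: "sobolev 3 h" by (rule sobolev_test_function[OF h_test])
  have Ps: "sobolev 3 (P h)" using LY[of 3 h] s by simp
  have "sobolev_norm 3 h = sobolev_norm 3 (Pi_N N (P h))" using h_eq by simp
  also have "\<dots> \<le> sobolev_norm 3 (P h)" by (rule sobolev_norm_Pi_N[OF N Ps])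
  also have "\<dots> \<le> lam ^ 3 * sobolev_norm 3 h + C_LY * sobolev_norm 2 h" using LY[of 3 h] s by simp
  also have "\<dots> \<le> lam ^ 3 * sobolev_norm 3 h + C_LY * K" using C_LY h_norm2_le by simp
  finally have "(1 - lam ^ 3) * sobolev_norm 3 h \<le> C_LY * K" by (simp add: algebra_simps)
  moreover have "0 < 1 - lam ^ 3" using lam power_Suc_less_one[of lam 2] by simp
  ultimately show ?thesis by (simp add: pos_le_divide_eq mult.commute)
qed

lemma resolvent_bound:
  assumes "i \<in> {1, 2}" "sobolev i f" "(\<integral>x. f x \<partial>circ) = 0"
  shows "sobolev_norm i f \<le> C_gap / (1 - \<theta>) * sobolev_norm i (\<lambda>x. f x - P f x)"
  by (rule sobolev_norm_le_resolvent[OF S_nonsingular gap_const gap[OF assms(1)] assms(2,3)])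

text \<open>The fixed point is close to the invariant density of \<open>P\<close>, the limit of the iterates of the
  constant density, whose norm is at most \<open>C_LY\<close>. So it lies well inside the ball.\<close>

lemma h_norm2_interior:
  "sobolev_norm 2 h \<le> C_LY + C_gap / (1 - \<theta>) * (1 / sqrt N * ((1 + C_LY) * sobolev_norm 3 h))"
proof -
  define q where "q x = h x - P h x" for x
  define one where "one = (\<lambda>_::real. 1::real)"
  define C1 where "C1 = C_gap / (1 - \<theta>)"
  have C1: "0 \<le> C1" using gap_const by (simp add: C1_def)
  have s3: "sobolev 3 h" by (rule sobolev_test_function[OF h_test])
  have s2: "sobolev 2 h" by (rule sobolev_test_function[OF h_test])
  have Ps3: "sobolev 3 (P h)" using LY[of 3 h] s3 by simp
  have qs: "sobolev 2 q" unfolding q_def by (rule sobolev_diff[OF s2]) (rule sobolev_mono[OF Ps3], simp)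
  have q: "sobolev_norm 2 q \<le> 1 / sqrt N * ((1 + C_LY) * sobolev_norm 3 h)"
  proof -
    have "q = (\<lambda>x. Pi_N N (P h) x - P h x)" unfolding q_def using h_eq by metis
    then have "sobolev_norm 2 q \<le> 1 / sqrt N * sobolev_norm 3 (P h)"
      using sobolev_norm_Pi_N_minus[OF N, of 2 "P h"] Ps3 by (simp add: eval_nat_numeral)
    also have "\<dots> \<le> 1 / sqrt N * ((1 + C_LY) * sobolev_norm 3 h)"
      using P_norm_le[of 3 h] s3 by (intro mult_left_mono) auto
    finally show ?thesis .
  qed
  have oneL: "L1 one" by (simp add: one_def)
  have "1 \<in> {1, 2::nat}" by simp
  have ones: "sobolev 2 one"
    unfolding one_def by (rule sobolev_F_space[where N = 1])
      (auto simp: F_space_def intro!: exI[of _ "\<lambda>k. if k = 0 then 1 else 0"] simp: if_distrib[of "\<lambda>c. c * _"] cong: if_cong)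
  have Pn: "sobolev 2 ((P ^^ n) one)" for n
  proof (induction n)
    case (Suc n)
    then show ?case using LY[of 2 "(P ^^ n) one"] by simp
  qed (simp add: ones)
  define r where "r x = one x - P one x" for x
  have rs: "sobolev 2 r" unfolding r_def using sobolev_diff[OF ones Pn[of 1]] by simp
  have r0: "(\<integral>x. r x \<partial>circ) = 0"
    unfolding r_def using transfer_op_integral[OF S_nonsingular oneL] L1D(2)[OF oneL]
      L1D(2)[OF transfer_op_L1[OF S_nonsingular oneL]] by simp
  have bound: "sobolev_norm 2 h \<le> (lam ^ (2 * n) + C_LY) + C1 * (sobolev_norm 2 q + C_gap * \<theta> ^ n * sobolev_norm 2 r)" for n
  proof -
    define a where "a = (P ^^ n) one"
    note as = Pn[of n, folded a_def]
    have aL: "L1 a" by (rule sobolev_L1[OF as])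
    have Pas: "sobolev 2 (P a)" using Pn[of "Suc n"] by (simp add: a_def)
    have a1: "(\<integral>x. a x \<partial>circ) = 1"
    proof -
      have "Linf (\<lambda>_. 1)" by (rule Linf_bounded[where M = 1]) (auto simp: periodic1_def)
      from is_transferD[OF is_transfer_funpow[OF S_nonsingular oneL, of n] this]
      show ?thesis by (simp add: a_def one_def)
    qed
    define f where "f x = h x - a x" for x
    have fs: "sobolev 2 f" unfolding f_def by (rule sobolev_diff[OF s2 as])
    have f0: "(\<integral>x. f x \<partial>circ) = 0"
      unfolding f_def using L1D(2)[OF h_L1] L1D(2)[OF aL] h_integral a1 by simp
    have Pfs: "sobolev 2 (P f)" using LY[of 2 f] fs by simp
    have Pr: "sobolev 2 ((P ^^ n) r)" "sobolev_norm 2 ((P ^^ n) r) \<le> C_gap * \<theta> ^ n * sobolev_norm 2 r"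
      using gap[of 2 r n] rs r0 by auto
    have ae1: "AE x in circ. P h x - P a x = P f x"
      using transfer_op_funpow_diff[OF S_nonsingular h_L1 aL, of 1] by (simp add: f_def[abs_def])
    have ae2: "AE x in circ. a x - P a x = (P ^^ n) r x"
      using transfer_op_funpow_diff[OF S_nonsingular oneL sobolev_L1[OF Pn[of 1]], of n]
      by (simp add: r_def[abs_def] a_def funpow_swap1)
    have ae: "AE x in circ. q x - (P ^^ n) r x = f x - P f x"
      using ae1 ae2 by eventually_elim (simp add: q_def f_def)
    have "sobolev_norm 2 f \<le> C1 * sobolev_norm 2 (\<lambda>x. f x - P f x)"
      unfolding C1_def by (rule resolvent_bound[OF _ fs f0]) simp
    also have "sobolev_norm 2 (\<lambda>x. f x - P f x) = sobolev_norm 2 (\<lambda>x. q x - (P ^^ n) r x)"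
      by (rule sobolev_norm_cong_AE[OF sobolev_diff[OF qs Pr(1)] sobolev_L1[OF sobolev_diff[OF fs Pfs]] ae])
    also have "C1 * \<dots> \<le> C1 * (sobolev_norm 2 q + C_gap * \<theta> ^ n * sobolev_norm 2 r)"
      using sobolev_norm_diff[OF qs Pr(1)] Pr(2) by (intro mult_left_mono C1) linarith
    finally have f: "sobolev_norm 2 f \<le> C1 * (sobolev_norm 2 q + C_gap * \<theta> ^ n * sobolev_norm 2 r)" .
    have "h = (\<lambda>x. a x + f x)" by (simp add: f_def)
    then have "sobolev_norm 2 h \<le> sobolev_norm 2 a + sobolev_norm 2 f"
      using sobolev_norm_add[OF as fs] by metis
    moreover have "sobolev_norm 2 a \<le> lam ^ (2 * n) + C_LY"
      using LY_one[of n] by (simp add: a_def one_def)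
    ultimately show ?thesis using f by linarith
  qed
  have lam2: "(\<lambda>n. lam ^ (2 * n)) \<longlonglongrightarrow> 0"
  proof -
    have "(\<lambda>n. (lam\<^sup>2) ^ n) \<longlonglongrightarrow> 0"
      using lam by (intro LIMSEQ_power_zero) (simp add: power_less_one_iff abs_square_less_1)
    then show ?thesis by (simp add: power_mult)
  qed
  have \<theta>0: "(\<lambda>n. \<theta> ^ n) \<longlonglongrightarrow> 0" using gap_const by (intro LIMSEQ_power_zero) auto
  have "(\<lambda>n. (lam ^ (2 * n) + C_LY) + C1 * (sobolev_norm 2 q + C_gap * \<theta> ^ n * sobolev_norm 2 r))
      \<longlonglongrightarrow> (0 + C_LY) + C1 * (sobolev_norm 2 q + C_gap * 0 * sobolev_norm 2 r)"
    by (intro tendsto_intros lam2 \<theta>0)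
  then have "sobolev_norm 2 h \<le> (0 + C_LY) + C1 * (sobolev_norm 2 q + C_gap * 0 * sobolev_norm 2 r)"
    by (rule LIMSEQ_le_const) (use bound in blast)
  also have "\<dots> \<le> C_LY + C1 * (1 / sqrt N * ((1 + C_LY) * sobolev_norm 3 h))"
    using mult_left_mono[OF q C1] by simp
  finally show ?thesis by (simp add: C1_def)
qed

text \<open>A function \<open>e\<close> with \<open>e - D e = r\<close> is more regular than its \<open>W\<^sup>1\<^sup>,\<^sup>1\<close> norm shows, by the Lasota-Yorke
  inequality: its \<open>W\<^sup>2\<^sup>,\<^sup>1\<close> norm is controlled by its \<open>W\<^sup>1\<^sup>,\<^sup>1\<close> norm and \<open>r\<close>. Hence averaging changes
  \<open>P e\<close> little in \<open>W\<^sup>1\<^sup>,\<^sup>1\<close> for large \<open>N\<close>, and \<open>e - P e\<close> is, up to a small multiple of \<open>e\<close>, bounded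
  by \<open>r\<close>. The resolvent of \<open>P\<close> then bounds \<open>e\<close>. The restrictions on \<open>\<epsilon>\<close> do not involve \<open>N\<close>.\<close>

lemma lower_bound:
  fixes C_Q A :: real
  defines "C_Q \<equiv> (1 + C_LY) * (6 * M * (C_LY * K / (1 - lam ^ 3)))"
    and "A \<equiv> (C_LY + 2) / (1 - lam\<^sup>2)"
    and "C\<^sub>1 \<equiv> C_gap / (1 - \<theta>)"
  assumes eps1: "\<epsilon> * C_Q \<le> 1" and eps2: "C\<^sub>1 * (\<epsilon> * C_Q) \<le> 1 / 4"
    and N_large: "C\<^sub>1 * (1 / sqrt N * ((1 + C_LY) * A)) \<le> 1 / 4"
    and e: "e \<in> F0_space N"
  shows "sobolev_norm 1 e \<le> (1 / 2 + 2 * C\<^sub>1) * sobolev_norm 2 (\<lambda>x. e x - dPhi N h e x)"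
proof -
  define r where "r x = e x - dPhi N h e x" for x
  have eF: "e \<in> F_space N" and e0: "(\<integral>x. e x \<partial>circ) = 0" using e by (auto simp: F0_space_def)
  note eL = F_space_L1[OF eF]
  have es: "sobolev i e" for i by (rule sobolev_F_space[OF eF])
  have rF: "r \<in> F_space N" unfolding r_def by (intro F_space_diff eF dPhi_F_space N h_L1 eL)
  have rs: "sobolev i r" for i by (rule sobolev_F_space[OF rF])
  have C1: "0 \<le> C\<^sub>1" using gap_const by (simp add: C\<^sub>1_def)
  define w where "w z = V 0 e z * h z" for z
  define \<rho> where "\<rho> = P w"
  have ws: "sobolev 3 w" unfolding w_def[abs_def] by (rule sobolev_V_mult[OF eL h_test])
  have \<rho>s: "sobolev 3 \<rho>" unfolding \<rho>_def using LY[of 3 w] ws by simp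
  have wn: "sobolev_norm 3 w \<le> 6 * (M * L1_norm e) * (C_LY * K / (1 - lam ^ 3))"
  proof -
    have "sobolev_norm 3 w \<le> 6 * (M * L1_norm e) * sobolev_norm 3 h"
      unfolding w_def[abs_def] by (rule sobolev_norm_V_mult[OF eL h_test])
    also have "\<dots> \<le> 6 * (M * L1_norm e) * (C_LY * K / (1 - lam ^ 3))"
      using M_nonneg by (intro mult_left_mono h_norm3_le) auto
    finally show ?thesis .
  qed
  have \<rho>n: "sobolev_norm 3 \<rho> \<le> C_Q * sobolev_norm 1 e"
  proof -
    have "sobolev_norm 3 \<rho> \<le> (1 + C_LY) * sobolev_norm 3 w"
      unfolding \<rho>_def by (rule P_norm_le[OF _ ws]) simp
    also have "\<dots> \<le> (1 + C_LY) * (6 * (M * L1_norm e) * (C_LY * K / (1 - lam ^ 3)))"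
      using C_LY by (intro mult_left_mono wn) auto
    also have "\<dots> = C_Q * L1_norm e" by (simp add: C_Q_def)
    also have "\<dots> \<le> C_Q * sobolev_norm 1 e"
    proof (rule mult_left_mono[OF L1_norm_le_sobolev_norm])
      have "0 \<le> sobolev_norm 3 h" by simp
      then have "0 \<le> C_LY * K / (1 - lam ^ 3)" using h_norm3_le by linarith
      then show "0 \<le> C_Q" using C_LY M_nonneg unfolding C_Q_def by (intro mult_nonneg_nonneg) auto
    qed
    finally show ?thesis .
  qed
  define Q where "Q = Pi_N N (weak_deriv 1 \<rho>)"
  have w1: "sobolev 2 (weak_deriv 1 \<rho>)" "sobolev_norm 2 (weak_deriv 1 \<rho>) \<le> sobolev_norm 3 \<rho>"
    using sobolev_weak_deriv[of 2 1 \<rho>] \<rho>s by auto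
  have QF: "Q \<in> F_space N" unfolding Q_def by (rule Pi_N_F_space[OF N sobolev_L1[OF w1(1)]])
  have Qs: "sobolev i Q" for i by (rule sobolev_F_space[OF QF])
  have Qn: "sobolev_norm 2 Q \<le> C_Q * sobolev_norm 1 e"
    unfolding Q_def using sobolev_norm_Pi_N[OF N w1(1)] w1(2) \<rho>n by linarith
  have \<epsilon>Qn: "sobolev_norm i (\<lambda>x. \<epsilon> * Q x) \<le> \<epsilon> * C_Q * sobolev_norm 1 e" if "i \<le> 2" for i
  proof -
    have "sobolev_norm i (\<lambda>x. \<epsilon> * Q x) = \<epsilon> * sobolev_norm i Q"
      using sobolev_norm_cmult[OF Qs] eps_nonneg by simp
    also have "\<dots> \<le> \<epsilon> * (C_Q * sobolev_norm 1 e)"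
      using sobolev_norm_mono[OF that, of Q] Qn eps_nonneg by (intro mult_left_mono) auto
    finally show ?thesis by (simp add: mult.assoc)
  qed
  have \<epsilon>Qs: "sobolev i (\<lambda>x. \<epsilon> * Q x)" for i by (rule sobolev_cmult[OF Qs])
  have Pe: "sobolev 2 (P e)" using LY[of 2 e] es by simp
  have PeL: "L1 (P e)" by (rule sobolev_L1[OF Pe])
  have PPs: "sobolev i (Pi_N N (P e))" for i by (rule sobolev_F_space[OF Pi_N_F_space[OF N PeL]])
  have \<rho>_eq: "\<rho> = P (\<lambda>z. V 0 e z * h z)" by (simp only: \<rho>_def w_def[abs_def])
  have \<rho>1: "sobolev 1 \<rho>" by (rule sobolev_mono[OF \<rho>s]) simp
  have dec: "e x = (Pi_N N (P e) x - \<epsilon> * Q x) + r x" for x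
    unfolding r_def dPhi_eq[OF N h_L1 expanding eL \<rho>_eq \<rho>1] Q_def by simp
  \<comment> \<open>Short names: the estimates below are linear in these three numbers.\<close>
  define n1 where "n1 = sobolev_norm 1 e"
  define n2 where "n2 = sobolev_norm 2 e"
  define nr where "nr = sobolev_norm 2 r"
  have nn: "0 \<le> n1" "0 \<le> n2" "0 \<le> nr" by (simp_all add: n1_def n2_def nr_def)
  have lam2: "0 < 1 - lam\<^sup>2" using lam power_Suc_less_one[of lam 1] by (simp add: power2_eq_square)
  have stepA: "n2 \<le> A * (n1 + nr)"
  proof -
    have "n2 = sobolev_norm 2 (\<lambda>x. (Pi_N N (P e) x - \<epsilon> * Q x) + r x)"
      unfolding n2_def by (rule arg_cong[where f = "sobolev_norm 2"]) (rule ext, rule dec)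
    also have "\<dots> \<le> sobolev_norm 2 (\<lambda>x. Pi_N N (P e) x - \<epsilon> * Q x) + nr"
      unfolding nr_def by (rule sobolev_norm_add[OF sobolev_diff[OF PPs \<epsilon>Qs] rs])
    also have "\<dots> \<le> (sobolev_norm 2 (Pi_N N (P e)) + sobolev_norm 2 (\<lambda>x. \<epsilon> * Q x)) + nr"
      by (intro add_right_mono sobolev_norm_diff PPs \<epsilon>Qs)
    also have "\<dots> \<le> ((lam\<^sup>2 * n2 + C_LY * n1) + n1) + nr"
    proof -
      have "sobolev_norm 2 (Pi_N N (P e)) \<le> lam\<^sup>2 * n2 + C_LY * n1"
        using order_trans[OF sobolev_norm_Pi_N[OF N Pe]] LY[of 2 e] es by (simp add: n1_def n2_def)
      moreover have "\<epsilon> * C_Q * n1 \<le> 1 * n1" using eps1 nn by (intro mult_right_mono) auto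
      ultimately show ?thesis using \<epsilon>Qn[of 2] unfolding n1_def by linarith
    qed
    also have "\<dots> \<le> lam\<^sup>2 * n2 + (C_LY + 2) * (n1 + nr)"
      using nn C_LY by (simp add: distrib_left distrib_right)
    finally have "n2 * (1 - lam\<^sup>2) \<le> (C_LY + 2) * (n1 + nr)" by (simp add: algebra_simps)
    then have "n2 \<le> (C_LY + 2) * (n1 + nr) / (1 - lam\<^sup>2)" using lam2 by (simp add: pos_le_divide_eq)
    then show ?thesis by (simp add: A_def)
  qed
  have "n1 \<le> C\<^sub>1 * sobolev_norm 1 (\<lambda>x. e x - P e x)"
    unfolding n1_def C\<^sub>1_def by (rule resolvent_bound[OF _ es e0]) simp
  also have "sobolev_norm 1 (\<lambda>x. e x - P e x) \<le> 1 / sqrt N * ((1 + C_LY) * n2) + \<epsilon> * C_Q * n1 + nr"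
  proof -
    have Pe1: "sobolev 1 (P e)" by (rule sobolev_mono[OF Pe]) simp
    have "(\<lambda>x. e x - P e x) = (\<lambda>x. ((Pi_N N (P e) x - P e x) - \<epsilon> * Q x) + r x)"
    proof
      fix x show "e x - P e x = ((Pi_N N (P e) x - P e x) - \<epsilon> * Q x) + r x" using dec[of x] by linarith
    qed
    then have "sobolev_norm 1 (\<lambda>x. e x - P e x) = sobolev_norm 1 (\<lambda>x. ((Pi_N N (P e) x - P e x) - \<epsilon> * Q x) + r x)"
      by (rule arg_cong)
    also have "\<dots> \<le> sobolev_norm 1 (\<lambda>x. (Pi_N N (P e) x - P e x) - \<epsilon> * Q x) + sobolev_norm 1 r"
      by (intro sobolev_norm_add sobolev_diff PPs Pe1 \<epsilon>Qs rs)
    also have "\<dots> \<le> (sobolev_norm 1 (\<lambda>x. Pi_N N (P e) x - P e x) + sobolev_norm 1 (\<lambda>x. \<epsilon> * Q x)) + sobolev_norm 1 r"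
      by (intro add_right_mono sobolev_norm_diff sobolev_diff PPs Pe1 \<epsilon>Qs)
    also have "\<dots> \<le> (1 / sqrt N * ((1 + C_LY) * n2) + \<epsilon> * C_Q * n1) + nr"
    proof (intro add_mono)
      have "sobolev_norm 1 (\<lambda>x. Pi_N N (P e) x - P e x) \<le> 1 / sqrt N * sobolev_norm 2 (P e)"
        using sobolev_norm_Pi_N_minus[OF N, of 1 "P e"] Pe by (simp add: eval_nat_numeral)
      also have "\<dots> \<le> 1 / sqrt N * ((1 + C_LY) * n2)"
        unfolding n2_def using P_norm_le[of 2 e] es by (intro mult_left_mono) auto
      finally show "sobolev_norm 1 (\<lambda>x. Pi_N N (P e) x - P e x) \<le> 1 / sqrt N * ((1 + C_LY) * n2)" .
      show "sobolev_norm 1 (\<lambda>x. \<epsilon> * Q x) \<le> \<epsilon> * C_Q * n1" unfolding n1_def by (rule \<epsilon>Qn) simp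
      show "sobolev_norm 1 r \<le> nr" unfolding nr_def by (rule sobolev_norm_mono) simp
    qed
    finally show ?thesis by simp
  qed
  also have "1 / sqrt N * ((1 + C_LY) * n2) \<le> 1 / sqrt N * ((1 + C_LY) * (A * (n1 + nr)))"
    using C_LY by (intro mult_left_mono stepA) auto
  finally have "n1 \<le> C\<^sub>1 * (1 / sqrt N * ((1 + C_LY) * (A * (n1 + nr))) + \<epsilon> * C_Q * n1 + nr)"
    using C1 by (simp add: mult_left_mono)
  also have "\<dots> = (C\<^sub>1 * (1 / sqrt N * ((1 + C_LY) * A))) * (n1 + nr) + (C\<^sub>1 * (\<epsilon> * C_Q)) * n1 + C\<^sub>1 * nr"
    by (simp add: distrib_left mult.assoc)
  also have "\<dots> \<le> 1 / 4 * (n1 + nr) + 1 / 4 * n1 + C\<^sub>1 * nr"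
    using nn by (intro add_mono mult_right_mono N_large eps2) auto
  finally have "n1 \<le> 1 / 2 * nr + 2 * (C\<^sub>1 * nr)" by (simp add: distrib_left)
  then have "n1 \<le> (1 / 2 + 2 * C\<^sub>1) * nr" by (simp add: distrib_right)
  then show ?thesis by (simp add: n1_def nr_def r_def[abs_def])
qed

end

section \<open>Newton's method\<close>

subsection \<open>Injective endomorphisms of finite-dimensional function spaces\<close>

interpretation fun_space: vector_space "\<lambda>(a::real) (f::real \<Rightarrow> real). (\<lambda>x. a * f x)"
  by standard (auto simp: fun_eq_iff algebra_simps)

interpretation fun_pair: vector_space_pair "\<lambda>(a::real) (f::real \<Rightarrow> real). (\<lambda>x. a * f x)"
  "\<lambda>(a::real) (f::real \<Rightarrow> real). (\<lambda>x. a * f x)" ..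

text \<open>The image of a basis is again independent with as many elements, so nothing can be independent of
  it. The map need only be linear on the subspace; it is replaced by a linear map of the whole space
  that agrees with it on the basis.\<close>

lemma inj_endomorphism_surj:
  fixes f :: "(real \<Rightarrow> real) \<Rightarrow> real \<Rightarrow> real"
  assumes fin: "finite X" "U \<subseteq> fun_space.span X" and sub: "fun_space.subspace U"
    and maps: "\<And>u. u \<in> U \<Longrightarrow> f u \<in> U"
    and add: "\<And>u v. u \<in> U \<Longrightarrow> v \<in> U \<Longrightarrow> f (\<lambda>x. u x + v x) = (\<lambda>x. f u x + f v x)"
    and cmult: "\<And>a u. u \<in> U \<Longrightarrow> f (\<lambda>x. a * u x) = (\<lambda>x. a * f u x)"
    and inj: "inj_on f U"
  shows "f ` U = U"
proof -
  obtain B where B: "B \<subseteq> U" "fun_space.independent B" "U \<subseteq> fun_space.span B"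
    using fun_space.maximal_independent_subset by blast
  have spB: "fun_space.span B = U" by (rule fun_space.span_subspace[OF B(1,3) sub])
  have finB: "finite B"
    using fun_space.independent_span_bound[OF fin(1) B(2)] B(1) fin(2) by blast
  obtain g where lin: "Vector_Spaces.linear (\<lambda>a f x. a * f x) (\<lambda>a f x. a * f x) g" and gf: "\<And>b. b \<in> B \<Longrightarrow> g b = f b"
    using fun_pair.linear_independent_extend[OF B(2), of f] by blast
  interpret g: Vector_Spaces.linear "\<lambda>a f x. a * f x" "\<lambda>a f x. a * f x" g by (rule lin)
  have geq: "u \<in> U \<and> g u = f u" if "u \<in> fun_space.span B" for u
    using that
  proof (induction rule: fun_space.span_induct_alt)
    case base
    have z: "0 \<in> U" using sub by (simp add: fun_space.subspace_def)
    have "f (\<lambda>x. 0 * (0::real \<Rightarrow> real) x) = (\<lambda>x. 0 * f 0 x)" by (rule cmult[OF z])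
    then have "f 0 = 0" by (simp add: zero_fun_def)
    moreover have "g 0 = 0" by (rule g.zero)
    ultimately show ?case using z by (simp add: zero_fun_def)
  next
    case (step c x y)
    then have x: "x \<in> U" and y: "y \<in> U" "g y = f y" using B(1) by auto
    have cx: "(\<lambda>z. c * x z) \<in> U" using sub x by (simp add: fun_space.subspace_def)
    have "(\<lambda>z. c * x z) + y \<in> U" using sub cx y by (simp add: fun_space.subspace_def)
    moreover have "g ((\<lambda>z. c * x z) + y) = (\<lambda>z. c * g x z) + g y"
      by (simp add: g.add g.scale)
    moreover have "f ((\<lambda>z. c * x z) + y) = (\<lambda>z. c * f x z) + f y"
      using add[OF cx y(1)] cmult[OF x, of c] by (simp add: plus_fun_def)
    moreover have "g x = f x" using gf step by simp
    ultimately show ?case using y(2) by (intro conjI) (simp_all only:)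
  qed
  have injg: "inj_on g (fun_space.span B)"
    using inj geq unfolding spB by (metis inj_on_cong)
  have ind: "fun_space.independent (g ` B)"
    by (rule fun_pair.linear_independent_injective_image[OF lin B(2) injg])
  have cardB: "card (g ` B) = card B"
    by (rule card_image) (rule inj_on_subset[OF injg fun_space.span_superset])
  have gU: "fun_space.span (g ` B) = f ` U"
    using fun_pair.linear_span_image[OF lin, of B] geq spB by (metis (no_types, lifting) image_cong)
  have "v \<in> f ` U" if v: "v \<in> U" for v
  proof (rule ccontr)
    assume nv: "v \<notin> f ` U"
    then have "v \<notin> fun_space.span (g ` B)" by (simp add: gU)
    then have nB: "v \<notin> g ` B" and "fun_space.independent (insert v (g ` B))"
      using ind fun_space.span_base fun_space.independent_insertI by blast+
    moreover have "g ` B \<subseteq> U" using geq maps B(1) spB by auto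
    then have "insert v (g ` B) \<subseteq> fun_space.span B" using v by (simp add: spB)
    ultimately have "card (insert v (g ` B)) \<le> card B"
      using fun_space.independent_span_bound[OF finB] by blast
    then show False using nB finB cardB by simp
  qed
  then show ?thesis using maps by blast
qed

lemma sum_apply: "(\<Sum>i\<in>A. f i) x = (\<Sum>i\<in>A. f i x)" for f :: "'i \<Rightarrow> 'a \<Rightarrow> real"
  by (induction A rule: infinite_finite_induct) auto

text \<open>As a real vector space the real-valued elements are spanned by the real and imaginary parts of the
  characters.\<close>

lemma F_space_finite_span:
  "\<exists>X. finite X \<and> F_space N \<subseteq> fun_space.span X"
proof (intro exI conjI subsetI)
  define a where "a k = (\<lambda>x. Re (e_fun k x))" for k
  define b where "b k = (\<lambda>x. Im (e_fun k x))" for k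
  let ?I = "{- int N + 1..int N}"
  show "finite (a ` ?I \<union> b ` ?I)" by simp
  fix f assume "f \<in> F_space N"
  then obtain c where c: "\<And>x. complex_of_real (f x) = (\<Sum>k\<in>?I. c k * e_fun k x)"
    by (auto simp: F_space_def)
  have "f x = Re (\<Sum>k\<in>?I. c k * e_fun k x)" for x using c[of x] by (metis Re_complex_of_real)
  then have "f = (\<lambda>x. \<Sum>k\<in>?I. Re (c k) * a k x + (- Im (c k)) * b k x)"
    by (simp add: a_def b_def fun_eq_iff)
  also have "\<dots> = (\<Sum>k\<in>?I. (\<lambda>x. Re (c k) * a k x) + (\<lambda>x. (- Im (c k)) * b k x))"
    by (simp add: fun_eq_iff sum_apply)
  also have "\<dots> \<in> fun_space.span (a ` ?I \<union> b ` ?I)"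
    by (intro fun_space.span_sum fun_space.span_add fun_space.span_scale fun_space.span_base) auto
  finally show "f \<in> fun_space.span (a ` ?I \<union> b ` ?I)" .
qed

lemma F0_space_add:
  assumes "u \<in> F0_space N" "v \<in> F0_space N"
  shows "(\<lambda>x. u x + v x) \<in> F0_space N"
  using assms F_space_add[of u N v] L1D(2)[OF F_space_L1[of u N]] L1D(2)[OF F_space_L1[of v N]]
  by (simp add: F0_space_def)

lemma F0_space_cmult: "u \<in> F0_space N \<Longrightarrow> (\<lambda>x. a * u x) \<in> F0_space N"
  using F_space_cmult[of u N a] by (simp add: F0_space_def)

lemma F0_space_diff: "u \<in> F0_space N \<Longrightarrow> v \<in> F0_space N \<Longrightarrow> (\<lambda>x. u x - v x) \<in> F0_space N"
  using F0_space_add[of u N "\<lambda>x. (-1) * v x"] F0_space_cmult[of v N "-1"] by simp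

lemma F0_space_subspace: "fun_space.subspace (F0_space N)"
  unfolding fun_space.subspace_def
proof (intro conjI ballI allI)
  show "0 \<in> F0_space N" using F_space_zero[of N] by (simp add: F0_space_def zero_fun_def)
  show "x + y \<in> F0_space N" if "x \<in> F0_space N" "y \<in> F0_space N" for x y
    using F0_space_add[OF that] by (simp add: plus_fun_def)
qed (auto intro: F0_space_cmult)

lemma F0_spaceD: "u \<in> F0_space N \<Longrightarrow> u \<in> F_space N" "u \<in> F0_space N \<Longrightarrow> (\<integral>x. u x \<partial>circ) = 0"
  by (auto simp: F0_space_def)

subsection \<open>Quadratic convergence\<close>

lemma quadratic_recursion:
  fixes a :: "nat \<Rightarrow> real"
  assumes L: "L > 0" and a: "\<And>n. 0 \<le> a n" "L * a 0 \<le> 1 / 2" and rec: "\<And>n. a (Suc n) \<le> L * (a n)\<^sup>2"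
  shows "a n \<le> 1 / L * (1 / 2) ^ (2 ^ n)"
proof (induction n)
  case 0
  then show ?case using a(2) L by (simp add: field_simps)
next
  case (Suc n)
  have "a (Suc n) \<le> L * (a n)\<^sup>2" by (rule rec)
  also have "\<dots> \<le> L * (1 / L * (1 / 2) ^ (2 ^ n))\<^sup>2"
    using L a(1) Suc by (intro mult_left_mono power_mono) auto
  also have "\<dots> = 1 / L * ((1 / 2) ^ (2 ^ n))\<^sup>2"
    using L by (simp add: power_mult_distrib power2_eq_square)
  also have "((1 / 2 :: real) ^ (2 ^ n))\<^sup>2 = (1 / 2) ^ (2 ^ Suc n)"
    by (simp only: power_mult[symmetric] power_Suc mult.commute)
  finally show ?case .
qed

context discretised_fixed_point
begin

abbreviation op :: "(real \<Rightarrow> real) \<Rightarrow> real \<Rightarrow> real" where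
  "op \<equiv> self_consistent_N T g \<epsilon> N"

text \<open>Near the fixed point the lower bound for \<open>I - D\<close> persists, by continuity of the derivative.
  With finite dimension it makes every Newton step well defined, and with the quadratic remainder it
  makes the error of the next iterate at most a constant times the square of the present error.\<close>

lemma newton_convergence:
  fixes C_Q A c :: real
  defines "C_Q \<equiv> (1 + C_LY) * (6 * M * (C_LY * K / (1 - lam ^ 3)))"
    and "A \<equiv> (C_LY + 2) / (1 - lam\<^sup>2)"
    and "C\<^sub>1 \<equiv> C_gap / (1 - \<theta>)"
  assumes eps1: "\<epsilon> * C_Q \<le> 1" and eps2: "C\<^sub>1 * (\<epsilon> * C_Q) \<le> 1 / 4"
    and N_large: "C\<^sub>1 * (1 / sqrt N * ((1 + C_LY) * A)) \<le> 1 / 4"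
    and interior: "sobolev_norm 2 h < K"
    and c: "c > 0" "\<And>x. c \<le> \<bar>deriv (S h) x\<bar>"
  shows "\<exists>B'. B' \<subseteq> F_space N \<inter> B_ball K \<and>
    (\<exists>r>0. {f \<in> F_space N \<inter> D1. sobolev_norm 1 (\<lambda>x. f x - h x) < r} \<subseteq> B') \<and>
    (\<forall>f0\<in>B'. \<exists>f :: nat \<Rightarrow> real \<Rightarrow> real. f 0 = f0 \<and>
      (\<forall>n. newton_ok N op (f n) \<and> f (Suc n) = newton_step N op (f n)) \<and>
      (\<exists>C>0. \<exists>\<gamma>'. 0 < \<gamma>' \<and> \<gamma>' < 1 \<and> (\<forall>n. sobolev_norm 1 (\<lambda>x. f n x - h x) \<le> C * \<gamma>' ^ (2 ^ n))))"
proof -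
  have C1: "0 \<le> C\<^sub>1" using gap_const by (simp add: C\<^sub>1_def)
  obtain Cs where Cs: "Cs \<ge> 0" "\<And>f. f \<in> F_space N \<Longrightarrow> sobolev_norm 1 f \<le> Cs * L1_norm f"
    using F_space_sobolev_norm_bound[of N 1] by blast
  obtain Ct where Ct: "Ct \<ge> 0" "\<And>f. f \<in> F_space N \<Longrightarrow> sobolev_norm 2 f \<le> Ct * L1_norm f"
    using F_space_sobolev_norm_bound[of N 2] by blast
  obtain B where B: "B \<ge> 0"
    "\<And>h u. L1 h \<Longrightarrow> L1 u \<Longrightarrow>
      L1_norm (\<lambda>x. Phi N (\<lambda>y. h y + u y) x - Phi N h x - dPhi N h u x) \<le> B * (1 + L1_norm h) * (L1_norm u)\<^sup>2"
    "\<And>h v u. L1 h \<Longrightarrow> L1 v \<Longrightarrow> L1 u \<Longrightarrow>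
      L1_norm (\<lambda>x. dPhi N (\<lambda>y. h y + v y) u x - dPhi N h u x)
        \<le> B * (1 + L1_norm h + L1_norm v) * L1_norm v * L1_norm u"
    by (rule dPhi_bounds[OF N]) blast
  define m where "m = (1 / 2 + 2 * C\<^sub>1) * Ct + 1"
  have m: "m > 0" using C1 Ct(1) by (simp add: m_def add_nonneg_pos)
  define b where "b = B * (2 + L1_norm h)"
  have b: "b \<ge> 0" using B(1) by (simp add: b_def)
  define L where "L = 2 * m * b + 1"
  have L: "L \<ge> 1" using m b by (simp add: L_def)
  have \<epsilon>M: "0 \<le> \<epsilon> * M" using eps_nonneg M_nonneg by simp
  \<comment> \<open>On the ball of radius \<open>r0\<close> the map keeps a non-vanishing derivative, the lower bound loses at
    most a factor 2, and a Newton step at least halves the error.\<close>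
  define r0 where "r0 = min (min 1 (c / (2 * (\<epsilon> * M + 1)))) (1 / (2 * L))"
  have r0: "r0 > 0" "r0 \<le> 1" using c L \<epsilon>M by (auto simp: r0_def add_nonneg_pos)
  have r0_L: "L * r0 \<le> 1 / 2"
  proof -
    have "L * r0 \<le> L * (1 / (2 * L))" using L by (intro mult_left_mono) (auto simp: r0_def)
    then show ?thesis using L by simp
  qed
  have r0_b: "m * (b * r0) \<le> 1 / 2"
  proof -
    have "2 * m * b * r0 \<le> L * r0" using r0 by (intro mult_right_mono) (auto simp: L_def)
    then have "2 * (m * (b * r0)) \<le> 1 / 2" using r0_L by (simp add: mult.assoc)
    moreover have "0 \<le> m * (b * r0)" using m b r0 by simp
    ultimately show ?thesis by linarith
  qed
  have r0_c: "\<epsilon> * M * r0 \<le> c / 2"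
  proof -
    have "(\<epsilon> * M + 1) * r0 \<le> (\<epsilon> * M + 1) * (c / (2 * (\<epsilon> * M + 1)))"
      using \<epsilon>M by (intro mult_left_mono) (auto simp: r0_def)
    also have "\<dots> = c / 2"
    proof -
      have "\<epsilon> * M + 1 \<noteq> 0" using \<epsilon>M by linarith
      then show ?thesis by (metis divide_divide_eq_left mult.commute nonzero_eq_divide_eq)
    qed
    finally have "\<epsilon> * M * r0 + r0 \<le> c / 2" by (simp add: distrib_right)
    then show ?thesis using r0 by linarith
  qed
  \<comment> \<open>A Newton step need not preserve positivity, so the iterates are followed in a set of functions
    of integral one.\<close>
  define G where "G = {f \<in> F_space N. (\<integral>x. f x \<partial>circ) = 1 \<and> L1_norm (\<lambda>x. f x - h x) < r0}"
  have G: "f \<in> F_space N" "L1 f" "(\<lambda>x. f x - h x) \<in> F0_space N" "L1_norm (\<lambda>x. f x - h x) < r0" if "f \<in> G" for f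
  proof -
    show f: "f \<in> F_space N" and "L1_norm (\<lambda>x. f x - h x) < r0" using that by (auto simp: G_def)
    show fL: "L1 f" by (rule F_space_L1[OF f])
    show "(\<lambda>x. f x - h x) \<in> F0_space N"
      using that F_space_diff[OF f h_F] L1D(2)[OF fL] L1D(2)[OF h_L1] h_integral
      by (simp add: F0_space_def G_def)
  qed
  have G_exp: "c / 2 \<le> \<bar>deriv (S f) x\<bar>" if f: "f \<in> G" for f x
  proof -
    have u: "L1 (\<lambda>x. f x - h x)" by (rule F_space_L1[OF F0_spaceD(1)[OF G(3)[OF f]]])
    have "\<bar>deriv (S f) x - deriv (S h) x\<bar> \<le> \<epsilon> * M * L1_norm (\<lambda>x. f x - h x)"
      using deriv_S_perturb[OF h_L1 u, of x] by simp
    also have "\<dots> \<le> \<epsilon> * M * r0" using G(4)[OF f] \<epsilon>M by (intro mult_left_mono) auto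
    finally show ?thesis using r0_c c(2)[of x] by linarith
  qed
  have op_eq: "op f = Phi N f" if f: "f \<in> G" for f
  proof (rule self_consistent_N_eq[OF N G(2)[OF f]])
    show "deriv (S f) x \<noteq> 0" for x using G_exp[OF f, of x] c(1) by auto
  qed
  have c2: "c / 2 > 0" using c(1) by simp
  have frech: "has_frechet_F N op f (dPhi N f)" if f: "f \<in> G" for f
    by (rule has_frechet_dPhi[OF N G(1)[OF f] c2 G_exp[OF f]])
  have frechD: "frechet_F N op f e = dPhi N f e" if f: "f \<in> G" and e: "e \<in> F_space N" for f e
    by (rule frechet_F_dPhi[OF N G(1)[OF f] c2 G_exp[OF f] e])
  have ImD: "I_minus_D N op f e = (\<lambda>x. e x - dPhi N f e x)" if f: "f \<in> G" and e: "e \<in> F_space N" for f e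
    unfolding I_minus_D_def by (simp only: frechD[OF f e])
  have lower_h: "L1_norm e \<le> m * L1_norm (\<lambda>x. e x - dPhi N h e x)" if e: "e \<in> F0_space N" for e
  proof -
    have rF: "(\<lambda>x. e x - dPhi N h e x) \<in> F_space N"
      by (intro F_space_diff dPhi_F_space F0_spaceD(1)[OF e] N h_L1 F_space_L1[OF F0_spaceD(1)[OF e]])
    have "L1_norm e \<le> sobolev_norm 1 e" by (rule L1_norm_le_sobolev_norm)
    also have "\<dots> \<le> (1 / 2 + 2 * C\<^sub>1) * sobolev_norm 2 (\<lambda>x. e x - dPhi N h e x)"
      using lower_bound[OF _ _ _ e] eps1 eps2 N_large unfolding C_Q_def A_def C\<^sub>1_def by blast
    also have "\<dots> \<le> (1 / 2 + 2 * C\<^sub>1) * (Ct * L1_norm (\<lambda>x. e x - dPhi N h e x))"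
      using C1 by (intro mult_left_mono Ct(2) rF) auto
    also have "\<dots> \<le> m * L1_norm (\<lambda>x. e x - dPhi N h e x)" by (simp add: m_def distrib_right mult.assoc)
    finally show ?thesis .
  qed
  have lower: "L1_norm e \<le> 2 * m * L1_norm (\<lambda>x. e x - dPhi N f e x)"
    if f: "f \<in> G" and e: "e \<in> F0_space N" for f e
  proof -
    note eL = F_space_L1[OF F0_spaceD(1)[OF e]]
    define v where "v x = f x - h x" for x
    have v: "L1 v" unfolding v_def by (rule F_space_L1[OF F0_spaceD(1)[OF G(3)[OF f]]])
    have fv: "f = (\<lambda>x. h x + v x)" by (simp add: v_def)
    have vn: "L1_norm v \<le> r0" using G(4)[OF f] by (simp add: v_def[abs_def])
    have DL: "L1 (dPhi N f e)" "L1 (dPhi N h e)"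
      by (intro F_space_L1[OF dPhi_F_space] N G(2)[OF f] eL h_L1)+
    have "L1_norm (\<lambda>x. dPhi N f e x - dPhi N h e x) \<le> B * (1 + L1_norm h + L1_norm v) * L1_norm v * L1_norm e"
      using B(3)[OF h_L1 v eL] by (simp only: fv[symmetric])
    also have "\<dots> \<le> b * r0 * L1_norm e"
      using B(1) vn r0 unfolding b_def by (intro mult_right_mono mult_mono mult_left_mono) auto
    finally have d: "L1_norm (\<lambda>x. dPhi N f e x - dPhi N h e x) \<le> b * r0 * L1_norm e" .
    have "L1_norm (\<lambda>x. e x - dPhi N h e x)
        = L1_norm (\<lambda>x. (e x - dPhi N f e x) + (dPhi N f e x - dPhi N h e x))" by simp
    also have "\<dots> \<le> L1_norm (\<lambda>x. e x - dPhi N f e x) + b * r0 * L1_norm e"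
      using L1_norm_add[OF L1_diff[OF eL DL(1)] L1_diff[OF DL]] d by linarith
    finally have "m * L1_norm (\<lambda>x. e x - dPhi N h e x)
        \<le> m * L1_norm (\<lambda>x. e x - dPhi N f e x) + (m * (b * r0)) * L1_norm e"
      using m by (simp add: distrib_left[symmetric] mult.assoc)
    moreover have "(m * (b * r0)) * L1_norm e \<le> 1 / 2 * L1_norm e"
      by (intro mult_right_mono r0_b) simp
    ultimately show ?thesis using lower_h[OF e] by linarith
  qed
  have bij: "bij_betw (I_minus_D N op f) (F0_space N) (F0_space N)" if f: "f \<in> G" for f
  proof -
    let ?F = "I_minus_D N op f"
    note fL = G(2)[OF f]
    have eq: "?F e = (\<lambda>x. e x - dPhi N f e x)" if "e \<in> F0_space N" for e
      by (rule ImD[OF f F0_spaceD(1)[OF that]])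
    have maps: "?F e \<in> F0_space N" if e: "e \<in> F0_space N" for e
    proof -
      note eL = F_space_L1[OF F0_spaceD(1)[OF e]]
      have "dPhi N f e \<in> F0_space N"
        using dPhi_F_space[OF N fL eL] integral_dPhi[OF N fL eL] F0_spaceD(2)[OF e] by (simp add: F0_space_def)
      then show ?thesis unfolding eq[OF e] by (rule F0_space_diff[OF e])
    qed
    have add: "?F (\<lambda>x. u x + v x) = (\<lambda>x. ?F u x + ?F v x)" if u: "u \<in> F0_space N" and v: "v \<in> F0_space N" for u v
      unfolding eq[OF u] eq[OF v] eq[OF F0_space_add[OF u v]]
        dPhi_add[OF N fL F_space_L1[OF F0_spaceD(1)[OF u]] F_space_L1[OF F0_spaceD(1)[OF v]]]
      by (simp add: fun_eq_iff)
    have cm: "?F (\<lambda>x. a * u x) = (\<lambda>x. a * ?F u x)" if u: "u \<in> F0_space N" for a u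
      unfolding eq[OF u] eq[OF F0_space_cmult[OF u]] dPhi_cmult by (simp add: fun_eq_iff right_diff_distrib)
    have inj: "inj_on ?F (F0_space N)"
    proof (rule inj_onI, rule ext)
      fix u v x assume u: "u \<in> F0_space N" and v: "v \<in> F0_space N" and uv: "?F u = ?F v"
      define w where "w x = u x - v x" for x
      have w: "w \<in> F0_space N" unfolding w_def by (rule F0_space_diff[OF u v])
      have "?F v = (\<lambda>x. ?F w x + ?F v x)"
        using add[OF w v] uv by (simp add: w_def)
      then have "?F w = (\<lambda>x. 0)" by (simp add: fun_eq_iff)
      then have "L1_norm w \<le> 2 * m * L1_norm (\<lambda>x. 0)"
        using lower[OF f w] unfolding eq[OF w] by (simp only:)
      then have "L1_norm w \<le> 0" by simp
      from F_space_zero_if_L1_norm_zero[OF F0_spaceD(1)[OF w] this, of x]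
      show "u x = v x" by (simp add: w_def)
    qed
    obtain X where X: "finite X" "F_space N \<subseteq> fun_space.span X" using F_space_finite_span by blast
    have F0X: "F0_space N \<subseteq> fun_space.span X" using X(2) F0_spaceD(1) by blast
    have "?F ` F0_space N = F0_space N"
    proof (rule inj_endomorphism_surj[where f = ?F and X = X])
      show "?F u \<in> F0_space N" if "u \<in> F0_space N" for u by (rule maps[OF that])
      show "?F (\<lambda>x. u x + v x) = (\<lambda>x. ?F u x + ?F v x)" if "u \<in> F0_space N" "v \<in> F0_space N" for u v
        by (rule add[OF that])
      show "?F (\<lambda>x. a * u x) = (\<lambda>x. a * ?F u x)" if "u \<in> F0_space N" for a u by (rule cm[OF that])
      show "finite X" by (rule X(1))
      show "F0_space N \<subseteq> fun_space.span X" by (rule F0X)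
      show "fun_space.subspace (F0_space N)" by (rule F0_space_subspace)
      show "inj_on ?F (F0_space N)" by (rule inj)
    qed
    then show ?thesis unfolding bij_betw_def using inj by (intro conjI)
  qed
  have resid: "(\<lambda>y. f y - op f y) \<in> F0_space N" if f: "f \<in> G" for f
  proof -
    note fL = G(2)[OF f]
    have PF: "Phi N f \<in> F_space N" by (rule Phi_F_space[OF N fL])
    show ?thesis
      unfolding op_eq[OF f] using F_space_diff[OF G(1)[OF f] PF] L1D(2)[OF fL] L1D(2)[OF F_space_L1[OF PF]]
        integral_Phi[OF N fL] by (simp add: F0_space_def)
  qed
  have ok: "newton_ok N op f" if f: "f \<in> G" for f
    unfolding newton_ok_def using frech[OF f] bij[OF f] resid[OF f] by blast
  have step: "newton_step N op f \<in> G \<and>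
      L1_norm (\<lambda>x. newton_step N op f x - h x) \<le> L * (L1_norm (\<lambda>x. f x - h x))\<^sup>2" if f: "f \<in> G" for f
  proof -
    note fL = G(2)[OF f]
    define d where "d = inv_into (F0_space N) (I_minus_D N op f) (\<lambda>y. f y - op f y)"
    have im: "(\<lambda>y. f y - op f y) \<in> I_minus_D N op f ` F0_space N"
      using bij[OF f] resid[OF f] by (simp add: bij_betw_def)
    have d: "d \<in> F0_space N" unfolding d_def by (rule inv_into_into[OF im])
    have deq: "I_minus_D N op f d = (\<lambda>y. f y - op f y)" unfolding d_def by (rule f_inv_into_f[OF im])
    define u where "u x = f x - h x" for x
    have u: "u \<in> F0_space N" unfolding u_def by (rule G(3)[OF f])
    note uL = F_space_L1[OF F0_spaceD(1)[OF u]]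
    define w where "w x = u x - d x" for x
    have w: "w \<in> F0_space N" unfolding w_def by (rule F0_space_diff[OF u d])
    have nw: "newton_step N op f x - h x = w x" for x
      by (simp add: newton_step_def d_def[symmetric] w_def u_def)
    define u' where "u' x = (-1) * u x" for x
    have u'L: "L1 u'" using L1_cmult[OF uL, of "-1"] by (simp add: u'_def[abs_def])
    \<comment> \<open>The new error \<open>w\<close> solves \<open>w - D w = r\<close> with the second-order remainder \<open>r\<close> at \<open>f\<close> in the
      direction of \<open>h\<close>.\<close>
    have fu': "(\<lambda>x. f x + u' x) = h" by (simp add: u'_def u_def)
    have "(\<lambda>x. w x - dPhi N f w x)
        = (\<lambda>x. (-1) * (Phi N (\<lambda>y. f y + u' y) x - Phi N f x - dPhi N f u' x))"
    proof
      fix x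
      have Du: "dPhi N f u x = dPhi N f w x + dPhi N f d x"
      proof -
        have "(\<lambda>x. w x + d x) = u" by (simp add: w_def)
        from dPhi_add[OF N fL F_space_L1[OF F0_spaceD(1)[OF w]] F_space_L1[OF F0_spaceD(1)[OF d]], unfolded this]
        show ?thesis by (rule fun_cong)
      qed
      have Du': "dPhi N f u' x = - dPhi N f u x" unfolding u'_def dPhi_cmult by simp
      have "(\<lambda>x. d x - dPhi N f d x) = (\<lambda>x. f x - Phi N f x)"
        using deq unfolding ImD[OF f F0_spaceD(1)[OF d]] op_eq[OF f] .
      then have "d x - dPhi N f d x = f x - Phi N f x" by (rule fun_cong)
      then show "w x - dPhi N f w x = (-1) * (Phi N (\<lambda>y. f y + u' y) x - Phi N f x - dPhi N f u' x)"
        unfolding fu' h_fixed Du' Du by (simp add: w_def u_def)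
    qed
    then have "L1_norm (\<lambda>x. w x - dPhi N f w x)
        = L1_norm (\<lambda>x. (-1) * (Phi N (\<lambda>y. f y + u' y) x - Phi N f x - dPhi N f u' x))"
      by (rule arg_cong[where f = L1_norm])
    also have "\<dots> = L1_norm (\<lambda>x. Phi N (\<lambda>y. f y + u' y) x - Phi N f x - dPhi N f u' x)"
      unfolding L1_norm_cmult by simp
    also have "\<dots> \<le> B * (1 + L1_norm f) * (L1_norm u')\<^sup>2" by (rule B(2)[OF fL u'L])
    also have "\<dots> \<le> b * (L1_norm u)\<^sup>2"
    proof -
      have "L1_norm f \<le> L1_norm h + L1_norm u"
        using L1_norm_add[OF h_L1 uL] by (simp add: u_def[abs_def])
      moreover have "L1_norm u < 1" using G(4)[OF f] r0(2) by (simp add: u_def[abs_def])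
      ultimately have "1 + L1_norm f \<le> 2 + L1_norm h" by linarith
      moreover have "L1_norm u' = L1_norm u" unfolding u'_def L1_norm_cmult by simp
      ultimately show ?thesis using B(1) unfolding b_def by (intro mult_mono) auto
    qed
    finally have res: "L1_norm (\<lambda>x. w x - dPhi N f w x) \<le> b * (L1_norm u)\<^sup>2" .
    have "L1_norm w \<le> 2 * m * (b * (L1_norm u)\<^sup>2)"
      using lower[OF f w] mult_left_mono[OF res, of "2 * m"] m by linarith
    also have "\<dots> \<le> L * (L1_norm u)\<^sup>2" by (simp add: L_def distrib_right mult.assoc)
    finally have err: "L1_norm w \<le> L * (L1_norm u)\<^sup>2" .
    have "L * (L1_norm u)\<^sup>2 \<le> 1 / 2 * L1_norm u"
    proof -
      have "L * L1_norm u \<le> L * r0" using G(4)[OF f] L by (intro mult_left_mono) (auto simp: u_def[abs_def])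
      then have "L * L1_norm u \<le> 1 / 2" using r0_L by linarith
      then have "(L * L1_norm u) * L1_norm u \<le> 1 / 2 * L1_norm u" by (intro mult_right_mono) auto
      then show ?thesis by (simp add: power2_eq_square mult.assoc)
    qed
    moreover have "L1_norm u < r0" using G(4)[OF f] by (simp add: u_def[abs_def])
    ultimately have "L1_norm w < r0"
      using err L1_norm_nonneg[of u] by linarith
    moreover have "newton_step N op f = (\<lambda>x. h x + w x)" using nw by (simp add: fun_eq_iff algebra_simps)
    ultimately have "newton_step N op f \<in> G"
      using F_space_add[OF h_F F0_spaceD(1)[OF w]] F0_spaceD(2)[OF w] h_integral L1D(2)[OF h_L1]
        L1D(2)[OF F_space_L1[OF F0_spaceD(1)[OF w]]] by (simp add: G_def)
    then show ?thesis using err by (simp add: nw u_def[abs_def])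
  qed
  \<comment> \<open>The fixed point is interior to the ball; norms are equivalent on \<open>F_space N\<close>, so a small
    neighbourhood in \<open>W\<^sup>1\<^sup>,\<^sup>1\<close> is small in \<open>W\<^sup>2\<^sup>,\<^sup>1\<close> and stays inside.\<close>
  define r where "r = min r0 ((K - sobolev_norm 2 h) / (Ct + 1))"
  have r: "r > 0" using r0 interior Ct(1) by (simp add: r_def)
  define B' where "B' = {f \<in> F_space N \<inter> D1. sobolev_norm 1 (\<lambda>x. f x - h x) < r}"
  have B'_ball: "B' \<subseteq> F_space N \<inter> B_ball K"
  proof
    fix f assume "f \<in> B'"
    then have f: "f \<in> F_space N" "f \<in> D1" "sobolev_norm 1 (\<lambda>x. f x - h x) < r" by (auto simp: B'_def)
    note uF = F_space_diff[OF f(1) h_F]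
    have "L1_norm (\<lambda>x. f x - h x) < (K - sobolev_norm 2 h) / (Ct + 1)"
      using f(3) L1_norm_le_sobolev_norm[of "\<lambda>x. f x - h x" 1] by (simp add: r_def)
    then have "(Ct + 1) * L1_norm (\<lambda>x. f x - h x) < K - sobolev_norm 2 h"
      using Ct(1) by (simp add: pos_less_divide_eq mult.commute)
    then have "Ct * L1_norm (\<lambda>x. f x - h x) + L1_norm (\<lambda>x. f x - h x) < K - sobolev_norm 2 h"
      by (simp add: distrib_right)
    then have "Ct * L1_norm (\<lambda>x. f x - h x) < K - sobolev_norm 2 h"
      using L1_norm_nonneg[of "\<lambda>x. f x - h x"] by linarith
    moreover have "sobolev_norm 2 f \<le> sobolev_norm 2 h + sobolev_norm 2 (\<lambda>x. f x - h x)"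
      using sobolev_norm_add[OF sobolev_F_space[OF h_F] sobolev_F_space[OF uF], of 2] by simp
    ultimately have "sobolev_norm 2 f \<le> K" using Ct(2)[OF uF] by linarith
    then show "f \<in> F_space N \<inter> B_ball K" using f sobolev_F_space[OF f(1)] by (simp add: B_ball_def)
  qed
  have B'_G: "f \<in> G" if "f \<in> B'" for f
  proof -
    have f: "f \<in> F_space N" "f \<in> D1" "sobolev_norm 1 (\<lambda>x. f x - h x) < r" using that by (auto simp: B'_def)
    then have "L1_norm (\<lambda>x. f x - h x) < r0"
      using L1_norm_le_sobolev_norm[of "\<lambda>x. f x - h x" 1] by (simp add: r_def)
    then show ?thesis using f by (simp add: G_def D1_def)
  qed
  have main: "\<exists>f :: nat \<Rightarrow> real \<Rightarrow> real. f 0 = f0 \<and>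
      (\<forall>n. newton_ok N op (f n) \<and> f (Suc n) = newton_step N op (f n)) \<and>
      (\<exists>C>0. \<exists>\<gamma>'. 0 < \<gamma>' \<and> \<gamma>' < 1 \<and> (\<forall>n. sobolev_norm 1 (\<lambda>x. f n x - h x) \<le> C * \<gamma>' ^ (2 ^ n)))"
    if f0: "f0 \<in> B'" for f0
  proof -
    define f where "f n = (newton_step N op ^^ n) f0" for n
    have fS: "f (Suc n) = newton_step N op (f n)" for n by (simp add: f_def)
    have fG: "f n \<in> G" for n
    proof (induction n)
      case 0
      show ?case using B'_G[OF f0] by (simp add: f_def)
    next
      case (Suc n)
      then show ?case using step by (simp add: fS)
    qed
    define a where "a n = L1_norm (\<lambda>x. f n x - h x)" for n
    have "L * a 0 \<le> L * r0"
      using G(4)[OF fG[of 0]] L by (intro mult_left_mono) (auto simp: a_def)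
    then have a0: "L * a 0 \<le> 1 / 2" using r0_L by linarith
    have a: "a n \<le> 1 / L * (1 / 2) ^ (2 ^ n)" for n
    proof (rule quadratic_recursion[where a = a])
      show "L * a 0 \<le> 1 / 2" by (rule a0)
      show "a (Suc n) \<le> L * (a n)\<^sup>2" for n using step[OF fG[of n]] by (simp add: a_def fS)
    qed (use L in \<open>auto simp: a_def\<close>)
    have "sobolev_norm 1 (\<lambda>x. f n x - h x) \<le> ((Cs + 1) / L) * (1 / 2) ^ (2 ^ n)" for n
    proof -
      have "sobolev_norm 1 (\<lambda>x. f n x - h x) \<le> Cs * a n"
        unfolding a_def by (rule Cs(2)[OF F0_spaceD(1)[OF G(3)[OF fG]]])
      also have "\<dots> \<le> (Cs + 1) * a n" by (intro mult_right_mono) (auto simp: a_def)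
      also have "\<dots> \<le> (Cs + 1) * (1 / L * (1 / 2) ^ (2 ^ n))" using Cs(1) by (intro mult_left_mono a) auto
      finally show ?thesis by simp
    qed
    moreover have "(Cs + 1) / L > 0" using Cs(1) L by simp
    ultimately have "\<exists>C>0. \<exists>\<gamma>'. 0 < \<gamma>' \<and> \<gamma>' < 1 \<and> (\<forall>n. sobolev_norm 1 (\<lambda>x. f n x - h x) \<le> C * \<gamma>' ^ (2 ^ n))"
      by (intro exI[of _ "(Cs + 1) / L"] exI[of _ "1 / 2"] conjI) auto
    then show ?thesis using ok[OF fG] fS by (intro exI[of _ f] conjI) (auto simp: f_def)
  qed
  show ?thesis
  proof (intro exI[of _ B'] conjI ballI)
    show "\<exists>r>0. {f \<in> F_space N \<inter> D1. sobolev_norm 1 (\<lambda>x. f x - h x) < r} \<subseteq> B'"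
      using r by (intro exI[of _ r]) (auto simp: B'_def)
  qed (use B'_ball main in auto)
qed

end

section \<open>Choice of the constants\<close>

lemma T_comp_const: "T_comp T g \<epsilon> (\<lambda>_. f) n = T_map T g \<epsilon> f ^^ n"
  by (induction n) auto

lemma L_comp_const: "L_comp T g \<epsilon> (\<lambda>_. f) n h = (transfer_op (T_map T g \<epsilon> f) ^^ n) h"
  by (induction n) auto

lemma one_F_space: "N \<ge> 1 \<Longrightarrow> (\<lambda>_. 1) \<in> F_space N"
  unfolding F_space_def
  by (auto intro!: exI[of _ "\<lambda>k. if k = 0 then 1 else 0"] simp: if_distrib[of "\<lambda>c. c * _"] cong: if_cong)

lemma sobolev_norm_one: "sobolev_norm i (\<lambda>_. 1) = 1"
proof -
  have t: "test_function (\<lambda>_. 1)" by (rule F_space_test_function[OF one_F_space[of 1]]) simp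
  have d: "(deriv ^^ Suc j) (\<lambda>_. 1 :: real) = (\<lambda>_. 0)" for j
    by (induction j) auto
  have "sobolev_norm i (\<lambda>_. 1) = L1_norm (\<lambda>_. 1) + (\<Sum>j=1..i. L1_norm ((deriv ^^ j) (\<lambda>_. 1)))"
    by (rule sobolev_norm_eq[OF test_function_has_weak_deriv[OF t]])
  also have "(\<Sum>j=1..i. L1_norm ((deriv ^^ j) (\<lambda>_. 1))) = (\<Sum>j=1..i. 0)"
  proof (rule sum.cong[OF refl])
    fix j assume "j \<in> {1..i}"
    then obtain k where "j = Suc k" by (cases j) auto
    then show "L1_norm ((deriv ^^ j) (\<lambda>_. 1)) = 0" using d[of k] by (simp only: L1_norm_const abs_zero)
  qed
  finally show ?thesis by simp
qed

lemma eventually_const_over_sqrt_less: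
  fixes a b :: real
  assumes "0 < b"
  shows "\<forall>\<^sub>F N in sequentially. a * (1 / sqrt (real N)) < b"
proof -
  have "(\<lambda>N. 1 / sqrt (real N)) \<longlonglongrightarrow> 0"
    by (rule tendsto_divide_0[OF tendsto_const])
       (rule filterlim_at_top_imp_at_infinity, rule filterlim_compose[OF sqrt_at_top filterlim_real_sequentially])
  then have "(\<lambda>N. a * (1 / sqrt (real N))) \<longlonglongrightarrow> a * 0" by (intro tendsto_intros)
  then show ?thesis by (rule order_tendstoD) (use assms in simp)
qed

theorem theorem2p3:
  fixes T :: "real \<Rightarrow> real" and g :: "real \<Rightarrow> real \<Rightarrow> real"
    and \<epsilon>0 \<epsilon>1 \<epsilon>2 lam C0 C_LY K C_gap \<theta> C_K \<gamma> :: real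
    and hstar :: "real \<Rightarrow> real \<Rightarrow> real"
  assumes T: "circle_lift T" "C_k 5 T" "uniformly_expanding T"
    and g: "\<forall>x y. g (x + 1) y = g x y \<and> g x (y + 1) = g x y" "C_k2 5 g"
    and params: "0 < \<epsilon>0" "0 < lam" "lam < 1" "0 < C0"
    and unif: "\<forall>\<epsilon>\<in>{0..\<epsilon>0}. \<forall>f\<in>D1.
        (\<forall>x. deriv (T_map T g \<epsilon> f) x \<noteq> 0 \<and> 1 / \<bar>deriv (T_map T g \<epsilon> f) x\<bar> \<le> lam)
        \<and> C5_norm (T_map T g \<epsilon> f) < C0"
    and LY: "0 < C_LY"
      "\<forall>\<epsilon>\<in>{0..\<epsilon>0}. \<forall>f :: nat \<Rightarrow> real \<Rightarrow> real. (\<forall>j. f j \<in> D1) \<longrightarrow>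
        (\<forall>i\<in>{1..4}. \<forall>n h. sobolev i h \<longrightarrow>
           sobolev i (transfer_op (T_comp T g \<epsilon> f n) h) \<and>
           sobolev_norm i (transfer_op (T_comp T g \<epsilon> f n) h)
             \<le> lam ^ (i * n) * sobolev_norm i h + C_LY * sobolev_norm (i - 1) h)"
    and K: "C_LY / (1 - lam\<^sup>2) \<le> K"
    and eps1: "0 < \<epsilon>1" "\<epsilon>1 \<le> \<epsilon>0" "0 < C_gap" "0 < \<theta>" "\<theta> < 1"
      "\<forall>\<epsilon>\<in>{0..\<epsilon>1}. \<forall>f :: nat \<Rightarrow> real \<Rightarrow> real. (\<forall>j. f j \<in> B_ball K) \<longrightarrow>
        (\<forall>i\<in>{1, 2}. \<forall>n h. sobolev i h \<and> (\<integral>x. h x \<partial>circ) = 0 \<longrightarrow>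
           sobolev i (L_comp T g \<epsilon> f n h) \<and>
           sobolev_norm i (L_comp T g \<epsilon> f n h) \<le> C_gap * \<theta> ^ n * sobolev_norm i h)"
    and eps2: "0 < \<epsilon>2" "\<epsilon>2 \<le> \<epsilon>1" "0 < C_K" "0 < \<gamma>" "\<gamma> < 1"
      "\<forall>\<epsilon>\<in>{0..\<epsilon>2}. hstar \<epsilon> \<in> B_ball K
        \<and> (AE x in circ. self_consistent T g \<epsilon> (hstar \<epsilon>) x = hstar \<epsilon> x)
        \<and> (\<forall>h\<in>B_ball K. (AE x in circ. self_consistent T g \<epsilon> h x = h x)
             \<longrightarrow> (AE x in circ. h x = hstar \<epsilon> x))"
      "\<forall>\<epsilon>\<in>{0..\<epsilon>2}. \<forall>h0\<in>B_ball K. \<forall>n.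
         sobolev 1 (\<lambda>x. (self_consistent T g \<epsilon> ^^ n) h0 x - hstar \<epsilon> x) \<and>
         sobolev_norm 1 (\<lambda>x. (self_consistent T g \<epsilon> ^^ n) h0 x - hstar \<epsilon> x) \<le> C_K * \<gamma> ^ n"
    and fixN: "\<forall>\<epsilon>\<in>{0..\<epsilon>0}. \<forall>N\<ge>1. \<exists>h\<in>B_ball K. self_consistent_N T g \<epsilon> N h = h"
  shows "\<exists>\<epsilon>7>0. \<forall>\<epsilon>. 0 \<le> \<epsilon> \<and> \<epsilon> < min \<epsilon>2 \<epsilon>7 \<longrightarrow>
    (\<forall>\<^sub>F N in sequentially. \<forall>hN\<in>B_ball K. self_consistent_N T g \<epsilon> N hN = hN \<longrightarrow>
      (\<exists>B'. B' \<subseteq> F_space N \<inter> B_ball K \<and>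
        (\<exists>r>0. {h \<in> F_space N \<inter> D1. sobolev_norm 1 (\<lambda>x. h x - hN x) < r} \<subseteq> B') \<and>
        (\<forall>h0\<in>B'. \<exists>h :: nat \<Rightarrow> real \<Rightarrow> real.
           h 0 = h0 \<and>
           (\<forall>n. newton_ok N (self_consistent_N T g \<epsilon> N) (h n) \<and>
                h (Suc n) = newton_step N (self_consistent_N T g \<epsilon> N) (h n)) \<and>
           (\<exists>C>0. \<exists>\<gamma>'. 0 < \<gamma>' \<and> \<gamma>' < 1 \<and>
              (\<forall>n. sobolev_norm 1 (\<lambda>x. h n x - hN x) \<le> C * \<gamma>' ^ (2 ^ n))))))"
proof -
  obtain W M where W: "\<And>x y. W 0 x y = g (T x) y"
    "\<And>i x y. i < 4 \<Longrightarrow> ((\<lambda>t. W i t y) has_real_derivative W (Suc i) x y) (at x)"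
    "\<And>i x. i \<le> 4 \<Longrightarrow> W i x \<in> borel_measurable borel"
    "\<And>i x y. i \<le> 4 \<Longrightarrow> W i (x + 1) y = W i x y"
    "\<And>i x y. i \<le> (4::nat) \<Longrightarrow> \<bar>W i x y\<bar> \<le> M"
    by (rule coupling_derivatives[OF T(1,2) _ g(2)]) (use g(1) in blast)+
  have M0: "0 \<le> M" using W(5)[of 0 0 0] by linarith
  have lam2: "0 < 1 - lam\<^sup>2" using params power_Suc_less_one[of lam 1] by (simp add: power2_eq_square)
  have lam3: "0 < 1 - lam ^ 3" using params power_Suc_less_one[of lam 2] by (simp add: eval_nat_numeral)
  have K_gt: "C_LY < K"
  proof -
    have "0 < lam\<^sup>2" using params by simp
    then have "C_LY * (1 - lam\<^sup>2) < C_LY * 1" using LY(1) by (intro mult_strict_left_mono) auto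
    then have "C_LY < C_LY / (1 - lam\<^sup>2)" using lam2 by (simp add: pos_less_divide_eq)
    then show ?thesis using K by linarith
  qed
  \<comment> \<open>\<open>C1\<close> bounds the resolvent, \<open>K3\<close> the fixed points in \<open>W\<^sup>3\<^sup>,\<^sup>1\<close>, and \<open>\<epsilon> * CQ\<close> the part of the
    derivative that comes from the dependence of the map on the density.\<close>
  define C1 where "C1 = C_gap / (1 - \<theta>)"
  define K3 where "K3 = C_LY * K / (1 - lam ^ 3)"
  define CQ where "CQ = (1 + C_LY) * (6 * M * K3)"
  define A where "A = (C_LY + 2) / (1 - lam\<^sup>2)"
  have C1: "0 \<le> C1" using eps1 by (simp add: C1_def)
  have K3: "0 \<le> K3" using LY(1) K_gt lam3 by (simp add: K3_def)
  have CQ: "0 \<le> CQ" using LY(1) M0 K3 by (simp add: CQ_def)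
  define \<epsilon>7 where "\<epsilon>7 = 1 / (4 * ((1 + C1) * (1 + CQ)))"
  have p: "0 < (1 + C1) * (1 + CQ)" using C1 CQ by (intro mult_pos_pos) auto
  have \<epsilon>7: "0 < \<epsilon>7" using p by (simp add: \<epsilon>7_def)
  show ?thesis
  proof (intro exI[of _ \<epsilon>7] conjI allI impI \<epsilon>7)
    fix \<epsilon> :: real assume \<epsilon>: "0 \<le> \<epsilon> \<and> \<epsilon> < min \<epsilon>2 \<epsilon>7"
    have \<epsilon>01: "\<epsilon> \<in> {0..\<epsilon>0}" "\<epsilon> \<in> {0..\<epsilon>1}" using \<epsilon> eps1(2) eps2(2) by auto
    have \<epsilon>p: "\<epsilon> * ((1 + C1) * (1 + CQ)) \<le> 1 / 4"
    proof -
      have "\<epsilon> * ((1 + C1) * (1 + CQ)) \<le> \<epsilon>7 * ((1 + C1) * (1 + CQ))"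
        using \<epsilon> p by (intro mult_right_mono) auto
      moreover have "1 / (4 * q) * q = 1 / 4" if "0 < q" for q :: real using that by simp
      from this[OF p] have "\<epsilon>7 * ((1 + C1) * (1 + CQ)) = 1 / 4" by (simp only: \<epsilon>7_def)
      ultimately show ?thesis by simp
    qed
    have "0 \<le> \<epsilon> * C1" "0 \<le> \<epsilon> * CQ" "0 \<le> \<epsilon> * (C1 * CQ)" using \<epsilon> C1 CQ by auto
    then have small: "\<epsilon> * CQ \<le> 1" "C1 * (\<epsilon> * CQ) \<le> 1 / 4"
      using \<epsilon>p \<epsilon> by (simp_all add: algebra_simps)
    \<comment> \<open>\<open>N\<close> has to be large for two reasons: the lower bound for \<open>I - D\<close>, and the fixed point being
      interior to the ball.\<close>
    have ev1: "\<forall>\<^sub>F N in sequentially. (C1 * ((1 + C_LY) * A)) * (1 / sqrt (real N)) < 1 / 4"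
      by (rule eventually_const_over_sqrt_less) simp
    have ev2: "\<forall>\<^sub>F N in sequentially. (C1 * ((1 + C_LY) * K3)) * (1 / sqrt (real N)) < K - C_LY"
      by (rule eventually_const_over_sqrt_less) (use K_gt in simp)
    show "\<forall>\<^sub>F N in sequentially. \<forall>hN\<in>B_ball K. self_consistent_N T g \<epsilon> N hN = hN \<longrightarrow>
      (\<exists>B'. B' \<subseteq> F_space N \<inter> B_ball K \<and>
        (\<exists>r>0. {h \<in> F_space N \<inter> D1. sobolev_norm 1 (\<lambda>x. h x - hN x) < r} \<subseteq> B') \<and>
        (\<forall>h0\<in>B'. \<exists>h :: nat \<Rightarrow> real \<Rightarrow> real.
           h 0 = h0 \<and>
           (\<forall>n. newton_ok N (self_consistent_N T g \<epsilon> N) (h n) \<and>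
                h (Suc n) = newton_step N (self_consistent_N T g \<epsilon> N) (h n)) \<and>
           (\<exists>C>0. \<exists>\<gamma>'. 0 < \<gamma>' \<and> \<gamma>' < 1 \<and>
              (\<forall>n. sobolev_norm 1 (\<lambda>x. h n x - hN x) \<le> C * \<gamma>' ^ (2 ^ n)))))"
      using ev1 ev2 eventually_ge_at_top[of 1]
    proof eventually_elim
      case (elim N)
      show ?case
      proof (intro ballI impI)
        fix hN assume hN: "hN \<in> B_ball K" and fixed: "self_consistent_N T g \<epsilon> N hN = hN"
        have hD: "hN \<in> D1" and hL: "L1 hN" using hN by (auto simp: B_ball_def D1_def)
        have T1: "(T has_real_derivative deriv T x) (at x)" for x
        proof -
          have "\<forall>j<5. \<forall>x. (deriv ^^ j) T differentiable (at x)" using T(2) by (simp add: C_k_def)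
          then have "(deriv ^^ 0) T differentiable (at x)" by (meson zero_less_numeral)
          then show ?thesis by (simp add: DERIV_deriv_iff_real_differentiable)
        qed
        interpret sc: smooth_coupling T g W M \<epsilon>
          by unfold_locales (use T(1) T1 W \<epsilon> in auto)
        have expand: "deriv (sc.S hN) x \<noteq> 0" "1 \<le> \<bar>deriv (sc.S hN) x\<bar>" for x
        proof -
          have d: "deriv (sc.S hN) x \<noteq> 0" "1 / \<bar>deriv (sc.S hN) x\<bar> \<le> lam"
            using unif[rule_format, OF \<epsilon>01(1) hD] unfolding sc.T_map_eq by blast+
          show "deriv (sc.S hN) x \<noteq> 0" by (rule d)
          then have "1 \<le> lam * \<bar>deriv (sc.S hN) x\<bar>" using d(2) by (simp add: pos_divide_le_eq)
          also have "\<dots> \<le> 1 * \<bar>deriv (sc.S hN) x\<bar>" using params by (intro mult_right_mono) auto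
          finally show "1 \<le> \<bar>deriv (sc.S hN) x\<bar>" by simp
        qed
        have ns: "nonsingular_lift (sc.S hN)" by (rule sc.nonsingular_lift_S[OF hL expand(1)])
        have LYn: "sobolev i (transfer_op (sc.S hN ^^ n) \<psi>) \<and> sobolev_norm i (transfer_op (sc.S hN ^^ n) \<psi>)
            \<le> lam ^ (i * n) * sobolev_norm i \<psi> + C_LY * sobolev_norm (i - 1) \<psi>"
          if "i \<in> {1..4}" "sobolev i \<psi>" for i n \<psi>
        proof -
          have "\<forall>j. (\<lambda>_::nat. hN) j \<in> D1" using hD by simp
          from LY(2)[rule_format, OF \<epsilon>01(1) this[rule_format] that, of n]
          show ?thesis by (simp only: T_comp_const sc.T_map_eq)
        qed
        have s1: "sobolev 2 (\<lambda>_. 1)" by (rule sobolev_F_space[OF one_F_space[of 1]]) simp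
        interpret fp: discretised_fixed_point T g W M \<epsilon> N hN lam C_LY C_gap \<theta> K
        proof unfold_locales
          show "sc.Phi N hN = hN" using fixed sc.self_consistent_N_eq[OF elim(3) hL expand(1)] by simp
          show "sobolev i (transfer_op (sc.S hN) \<psi>) \<and> sobolev_norm i (transfer_op (sc.S hN) \<psi>)
              \<le> lam ^ i * sobolev_norm i \<psi> + C_LY * sobolev_norm (i - 1) \<psi>"
            if "i \<in> {1..3}" "sobolev i \<psi>" for i \<psi>
          proof -
            have "i \<in> {1..4}" using that(1) by auto
            from LYn[OF this that(2), of 1] show ?thesis by simp
          qed
          show "sobolev_norm 2 ((transfer_op (sc.S hN) ^^ n) (\<lambda>_. 1)) \<le> lam ^ (2 * n) + C_LY" for n
          proof -
            have L: "sobolev 2 (transfer_op (sc.S hN ^^ n) (\<lambda>_. 1))"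
              "sobolev_norm 2 (transfer_op (sc.S hN ^^ n) (\<lambda>_. 1)) \<le> lam ^ (2 * n) + C_LY"
              using LYn[OF _ s1, of n] by (simp_all add: sobolev_norm_one)
            have "AE x in circ. transfer_op (sc.S hN ^^ n) (\<lambda>_. 1) x = (transfer_op (sc.S hN) ^^ n) (\<lambda>_. 1) x"
              by (rule is_transfer_unique[OF is_transfer_transfer_op[OF nonsingular_lift_funpow[OF ns] L1_const]
                  is_transfer_funpow[OF ns L1_const]])
            from sobolev_norm_cong_AE[OF L(1) transfer_op_funpow_L1[OF ns L1_const] this] L(2)
            show ?thesis by simp
          qed
          show "sobolev i ((transfer_op (sc.S hN) ^^ n) \<psi>) \<and>
              sobolev_norm i ((transfer_op (sc.S hN) ^^ n) \<psi>) \<le> C_gap * \<theta> ^ n * sobolev_norm i \<psi>"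
            if "i \<in> {1, 2}" "sobolev i \<psi>" "(\<integral>x. \<psi> x \<partial>circ) = 0" for i n \<psi>
          proof -
            have "\<forall>j. (\<lambda>_::nat. hN) j \<in> B_ball K" using hN by simp
            from eps1(6)[rule_format, OF \<epsilon>01(2) this[rule_format] that(1) conjI[OF that(2,3)], of n]
            show ?thesis by (simp only: L_comp_const sc.T_map_eq)
          qed
        qed (use elim hN expand params LY(1) eps1 in auto)
        have "C1 * (1 / sqrt (real N) * ((1 + C_LY) * sobolev_norm 3 hN))
            \<le> C1 * (1 / sqrt (real N) * ((1 + C_LY) * K3))"
          using C1 LY(1) fp.h_norm3_le unfolding K3_def by (intro mult_left_mono) auto
        also have "\<dots> < K - C_LY" using elim(2) by (simp add: mult_ac)
        finally have inside: "sobolev_norm 2 hN < K"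
          using fp.h_norm2_interior unfolding C1_def by linarith
        have N_large: "C1 * (1 / sqrt (real N) * ((1 + C_LY) * A)) \<le> 1 / 4"
          using elim(1) by (simp add: mult_ac)
        show "\<exists>B'. B' \<subseteq> F_space N \<inter> B_ball K \<and>
          (\<exists>r>0. {h \<in> F_space N \<inter> D1. sobolev_norm 1 (\<lambda>x. h x - hN x) < r} \<subseteq> B') \<and>
          (\<forall>h0\<in>B'. \<exists>h :: nat \<Rightarrow> real \<Rightarrow> real.
             h 0 = h0 \<and>
             (\<forall>n. newton_ok N (self_consistent_N T g \<epsilon> N) (h n) \<and>
                  h (Suc n) = newton_step N (self_consistent_N T g \<epsilon> N) (h n)) \<and>
             (\<exists>C>0. \<exists>\<gamma>'. 0 < \<gamma>' \<and> \<gamma>' < 1 \<and>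
                (\<forall>n. sobolev_norm 1 (\<lambda>x. h n x - hN x) \<le> C * \<gamma>' ^ (2 ^ n))))"
          by (rule fp.newton_convergence[OF small[unfolded CQ_def C1_def K3_def]
              N_large[unfolded C1_def A_def] inside zero_less_one expand(2)])
      qed
    qed
  qed
qed

end
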